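(* Let $X$ be a time-frequency shifts invariant Banach space on $\mathbb R^d$ with polynomial weight $v$ and constant $C>0$, so that $\|\pi_z u\|_X\le C\,v(z)\|u\|_X$ for all $u\in X$, $z\in\mathbb R^{2d}$. Let $L\in GL(2d)$ and $q\in L^1(\mathbb R^{2d})$. If $\int_{\mathbb R^{2d}}q(z)\,dz\ne0$ and the Fourier transform $\hat q$ satisfies $$\sum_{\kappa\in\mathbb Z^{2d}\setminus\{0\}}v(\mathcal J L^{-T}\kappa)\,|\hat q(L^{-T}\kappa)|<\frac1C\left|\int_{\mathbb R^{2d}}q(z)\,dz\right|,$$ then for all $\tau\in[0,1]$ the operator $\mathrm{Op}_\tau(q_L)$, where $q_L(z)=\sum_{\kappa\in\mathbb Z^{2d}}q(z+L\kappa)$, is invertible as an operator in $\mathcal L(X)$, and $$\|(\mathrm{Op}_\tau(q_L))^{-1}\|_{\mathcal L(X)}\le\frac{|\det L|}{(1+C)\,\sigma_0(q)-C\,\sigma_{L,v}(q)},$$ where $\sigma_0(q)=\left|\int_{\mathbb R^{2d}}q(z)\,dz\right|$ and $\sigma_{L,v}(q)=\sum_{\kappa\in\mathbb Z^{2d}}v(\mathcal J L^{-T}\kappa)|\hat q(L^{-T}\kappa)|$.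
   Context: $GL(2d)$ is the set of real invertible $2d\times 2d$ matrices, $L^{-T}=(L^{-1})^T$, and $\mathcal J=\begin{pmatrix}0&-I\\ I&0\end{pmatrix}$ with $d\times d$ blocks. Fourier transform: $\hat q(\theta)=\int_{\mathbb R^{2d}}q(z)e^{-2\pi i\langle\theta,z\rangle}dz$ (same normalization on $\mathbb R^d$). For $z=(x,\omega)\in\mathbb R^{2d}$, $T_xf(t)=f(t-x)$, $M_\omega f(t)=e^{2\pi i\omega\cdot t}f(t)$, $\pi_z f=M_\omega T_xf$ (extended to distributions). A polynomial weight is $v(z)=(1+|z|)^s$ for some $s\ge0$. A Banach space $X$ with $\mathcal S(\mathbb R^d)\hookrightarrow X\hookrightarrow\mathcal S'(\mathbb R^d)$ and $\mathcal S(\mathbb R^d)$ dense in $X$ is called time-frequency shifts invariant if for some polynomial weight $v$ and some constant $C>0$, $\|\pi_z u\|_X\le C v(z)\|u\|_X$ for all $u\in X$, $z\in\mathbb R^{2d}$. For $q\in L^1(\mathbb R^{2d})$ the series defining $q_L$ converges absolutely a.e. and in $\mathcal S'(\mathbb R^{2d})$. For a symbol $p\in\mathcal S'(\mathbb R^{2d})$ and $\tau\in[0,1]$, the pseudodifferential operator $\mathrm{Op}_\tau(p):\mathcal S(\mathbb R^d)\to\mathcal S'(\mathbb R^d)$ is $$\mathrm{Op}_\tau(p)u(x)=\int_{\mathbb R^d_\omega}\int_{\mathbb R^d_y}e^{2\pi i(x-y)\cdot\omega}p\big((1-\tau)x+\tau y,\omega\big)u(y)\,dy\,d\omega,$$ where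 the integral is understood in the distribution sense. Operators are regarded in $\mathcal L(X)$ (bounded linear operators on $X$) via extension from $\mathcal S(\mathbb R^d)$. *)

theory Defs
  imports "HOL-Analysis.Analysis"
begin

section \<open>Schwartz functions and tempered distributions\<close>

text \<open>Iterated partial derivatives: the list contains basis vectors, the head is the direction
  in which one differentiates last.\<close>

primrec partials :: "('a::euclidean_space \<Rightarrow> complex) \<Rightarrow> 'a list \<Rightarrow> 'a \<Rightarrow> complex" where
  "partials f [] = f"
| "partials f (b # bs) = (\<lambda>x. frechet_derivative (partials f bs) (at x) b)"

definition schwartz :: "('a::euclidean_space \<Rightarrow> complex) set" where
  "schwartz = {f. \<forall>bs. set bs \<subseteq> Basis \<longrightarrow>
     (\<forall>x. partials f bs differentiable (at x)) \<and>
     (\<forall>n::nat. bounded (range (\<lambda>x. (1 + norm x) ^ n *\<^sub>R partials f bs x)))}"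

text \<open>An increasing sequence of norms generating the Frechet topology of the Schwartz space.
  Hence a linear map from it to a normed space is continuous iff its norm is bounded by a multiple
  of one of them.\<close>

definition schwartz_norm :: "nat \<Rightarrow> ('a::euclidean_space \<Rightarrow> complex) \<Rightarrow> real" where
  "schwartz_norm n f = (\<Sum>bs | set bs \<subseteq> Basis \<and> length bs \<le> n.
     SUP x. (1 + norm x) ^ n * cmod (partials f bs x))"

text \<open>A distribution acts bilinearly (no complex conjugation). It is a total function that we require
  to vanish outside the Schwartz space, so that equality of distributions is equality in HOL.\<close>

type_synonym 'a functional = "('a \<Rightarrow> complex) \<Rightarrow> complex"

definition tempered_distributions :: "'a::euclidean_space functional set" where
  "tempered_distributions = {T.
     (\<forall>f\<in>schwartz. \<forall>g\<in>schwartz. T (\<lambda>x. f x + g x) = T f + T g) \<and>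
     (\<forall>c. \<forall>f\<in>schwartz. T (\<lambda>x. c * f x) = c * T f) \<and>
     (\<exists>n K. \<forall>f\<in>schwartz. cmod (T f) \<le> K * schwartz_norm n f) \<and>
     (\<forall>f. f \<notin> schwartz \<longrightarrow> T f = 0)}"

definition fun_distr :: "('a::euclidean_space \<Rightarrow> complex) \<Rightarrow> 'a functional" where
  "fun_distr f = (\<lambda>\<phi>. if \<phi> \<in> schwartz then (LINT t|lebesgue. f t * \<phi> t) else 0)"

definition fourier :: "('a::euclidean_space \<Rightarrow> complex) \<Rightarrow> 'a \<Rightarrow> complex" where
  "fourier q \<theta> = (LINT z|lebesgue. q z * cis (- 2 * pi * (\<theta> \<bullet> z)))"


section \<open>Phase space\<close>

text \<open>Phase space of dimension 2d is \<open>real ^ ('d + 'd)\<close>: a point is a pair of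
  a position (the \<open>Inl\<close> coordinates) and a frequency (the \<open>Inr\<close> coordinates).\<close>

definition pos :: "real ^ ('d + 'd) \<Rightarrow> real ^ ('d::finite)" where
  "pos z = (\<chi> i. z $ Inl i)"

definition freq :: "real ^ ('d + 'd) \<Rightarrow> real ^ ('d::finite)" where
  "freq z = (\<chi> i. z $ Inr i)"

definition symplectic_J :: "real ^ ('d::finite + 'd) ^ ('d + 'd)" where
  "symplectic_J = (\<chi> i j. case (i, j) of
       (Inl a, Inr b) \<Rightarrow> if a = b then -1 else 0
     | (Inr a, Inl b) \<Rightarrow> if a = b then 1 else 0
     | _ \<Rightarrow> 0)"

definition int_lattice :: "(real ^ 'n::finite) set" where
  "int_lattice = {\<kappa>. \<forall>i. \<kappa> $ i \<in> \<int>}"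

definition inv_transpose :: "real ^ 'n ^ 'n \<Rightarrow> real ^ ('n::finite) ^ 'n" where
  "inv_transpose L = transpose (matrix_inv L)"

definition polynomial_weight :: "('a::real_normed_vector \<Rightarrow> real) \<Rightarrow> bool" where
  "polynomial_weight v \<longleftrightarrow> (\<exists>s\<ge>0. v = (\<lambda>z. (1 + norm z) powr s))"

definition translation :: "'a::euclidean_space \<Rightarrow> ('a \<Rightarrow> complex) \<Rightarrow> 'a \<Rightarrow> complex" where
  "translation x f = (\<lambda>t. f (t - x))"

definition modulation :: "'a::euclidean_space \<Rightarrow> ('a \<Rightarrow> complex) \<Rightarrow> 'a \<Rightarrow> complex" where
  "modulation \<omega> f = (\<lambda>t. cis (2 * pi * (\<omega> \<bullet> t)) * f t)"

text \<open>The extensions to distributions by duality: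
  \<open>\<langle>T\<^sub>x u, \<phi>\<rangle> = \<langle>u, T\<^sub>-\<^sub>x \<phi>\<rangle>\<close> and \<open>\<langle>M\<^sub>\<omega> u, \<phi>\<rangle> = \<langle>u, M\<^sub>\<omega> \<phi>\<rangle>\<close>.\<close>

definition translation_distr :: "'a::euclidean_space \<Rightarrow> 'a functional \<Rightarrow> 'a functional" where
  "translation_distr x u = (\<lambda>\<phi>. u (translation (- x) \<phi>))"

definition modulation_distr :: "'a::euclidean_space \<Rightarrow> 'a functional \<Rightarrow> 'a functional" where
  "modulation_distr \<omega> u = (\<lambda>\<phi>. u (modulation \<omega> \<phi>))"

definition tf_shift ::
  "real ^ ('d + 'd) \<Rightarrow> (real ^ 'd::finite) functional \<Rightarrow> (real ^ 'd) functional" where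
  "tf_shift z u = modulation_distr (freq z) (translation_distr (pos z) u)"


section \<open>Banach spaces of distributions\<close>

class complex_banach = banach +
  fixes scaleC :: "complex \<Rightarrow> 'a \<Rightarrow> 'a"  (infixr "*\<^sub>C" 75)
  assumes scaleC_add_right: "c *\<^sub>C (x + y) = c *\<^sub>C x + c *\<^sub>C y"
    and scaleC_add_left: "(c + d) *\<^sub>C x = c *\<^sub>C x + d *\<^sub>C x"
    and scaleC_scaleC: "c *\<^sub>C d *\<^sub>C x = (c * d) *\<^sub>C x"
    and scaleR_scaleC: "r *\<^sub>R x = complex_of_real r *\<^sub>C x"
    and norm_scaleC: "norm (c *\<^sub>C x) = cmod c * norm x"

text \<open>The Banach space X is a type, identified with a space of tempered distributions by the
  embedding \<open>\<iota>\<close>. The clauses say that \<open>\<iota>\<close> is injective, complex linear and continuous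
  for the weak-* topology, that the image of \<open>\<iota>\<close> contains the Schwartz functions,
  which embed continuously, and that these are dense in X. (By the uniform boundedness principle
  and the fact that the Schwartz space is barrelled, weak-* and strong
  continuity of \<open>\<iota>\<close> are equivalent.)\<close>

definition banach_distribution_space :: "('x::complex_banach \<Rightarrow> 'a::euclidean_space functional) \<Rightarrow> bool" where
  "banach_distribution_space \<iota> \<longleftrightarrow>
     range \<iota> \<subseteq> tempered_distributions \<and> inj \<iota> \<and>
     (\<forall>u w. \<iota> (u + w) = (\<lambda>\<phi>. \<iota> u \<phi> + \<iota> w \<phi>)) \<and>
     (\<forall>c u. \<iota> (c *\<^sub>C u) = (\<lambda>\<phi>. c * \<iota> u \<phi>)) \<and>
     (\<forall>\<phi>\<in>schwartz. \<exists>K. \<forall>u. cmod (\<iota> u \<phi>) \<le> K * norm u) \<and>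
     fun_distr ` schwartz \<subseteq> range \<iota> \<and>
     (\<exists>n K. \<forall>f\<in>schwartz. \<forall>u. \<iota> u = fun_distr f \<longrightarrow> norm u \<le> K * schwartz_norm n f) \<and>
     closure {u. \<iota> u \<in> fun_distr ` schwartz} = UNIV"

definition tf_shifts_invariant ::
  "('x::complex_banach \<Rightarrow> (real ^ 'd::finite) functional) \<Rightarrow> (real ^ ('d + 'd) \<Rightarrow> real) \<Rightarrow> real \<Rightarrow> bool" where
  "tf_shifts_invariant \<iota> v C \<longleftrightarrow>
     banach_distribution_space \<iota> \<and> polynomial_weight v \<and> C > 0 \<and>
     (\<forall>u z. \<exists>w. \<iota> w = tf_shift z (\<iota> u) \<and> norm w \<le> C * v z * norm u)"

text \<open>\<open>blinfun\<close> only provides real linearity. The operator norm is the same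
  over the reals and over the complex numbers.\<close>

definition complex_linear :: "('x::complex_banach \<Rightarrow>\<^sub>L 'x) \<Rightarrow> bool" where
  "complex_linear A \<longleftrightarrow> (\<forall>c u. blinfun_apply A (c *\<^sub>C u) = c *\<^sub>C blinfun_apply A u)"

text \<open>\<open>A\<close> is the bounded operator on X which extends \<open>P\<close>, defined on Schwartz functions; it is unique
  because these are dense in X.\<close>

definition bounded_extension ::
  "('x::complex_banach \<Rightarrow> 'a::euclidean_space functional) \<Rightarrow>
   (('a \<Rightarrow> complex) \<Rightarrow> 'a functional) \<Rightarrow> ('x \<Rightarrow>\<^sub>L 'x) \<Rightarrow> bool" where
  "bounded_extension \<iota> P A \<longleftrightarrow>
     complex_linear A \<and>
     (\<forall>f\<in>schwartz. \<forall>u. \<iota> u = fun_distr f \<longrightarrow> \<iota> (blinfun_apply A u) = P f)"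


section \<open>Pseudodifferential operators with periodized symbols\<close>

text \<open>Testing the formal integral
  \<open>\<integral>\<integral> e^(2\<pi>i(x-y)\<cdot>\<omega>) p((1-\<tau>)x + \<tau>y, \<omega>) u(y) dy d\<omega>\<close> against \<open>\<phi>(x)\<close> and substituting
  \<open>x = x' + \<tau>t\<close>, \<open>y = x' - (1-\<tau>)t\<close> (Jacobian 1, \<open>x - y = t\<close>, \<open>(1-\<tau>)x + \<tau>y = x'\<close>) gives the
  integral of \<open>p(x', \<omega>)\<close> against the Schwartz function \<open>wigner_tau \<tau> u \<phi>\<close>
  of \<open>(x', \<omega>)\<close>. This is the meaning of the integral for a distribution \<open>p\<close>.\<close>

definition wigner_tau ::
  "real \<Rightarrow> (real ^ 'd::finite \<Rightarrow> complex) \<Rightarrow> (real ^ 'd \<Rightarrow> complex) \<Rightarrow> real ^ ('d + 'd) \<Rightarrow> complex" where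
  "wigner_tau \<tau> u \<phi> z = (LINT t|lebesgue.
     cis (2 * pi * (t \<bullet> freq z)) * u (pos z - (1 - \<tau>) *\<^sub>R t) * \<phi> (pos z + \<tau> *\<^sub>R t))"

definition Op_tau ::
  "real \<Rightarrow> (real ^ ('d::finite + 'd)) functional \<Rightarrow> (real ^ 'd \<Rightarrow> complex) \<Rightarrow> (real ^ 'd) functional" where
  "Op_tau \<tau> p u = (\<lambda>\<phi>. if \<phi> \<in> schwartz then p (wigner_tau \<tau> u \<phi>) else 0)"

definition periodization :: "real ^ 'n ^ 'n \<Rightarrow> (real ^ 'n::finite \<Rightarrow> complex) \<Rightarrow> real ^ 'n \<Rightarrow> complex" where
  "periodization L q z = (\<Sum>\<^sub>\<infinity>\<kappa>\<in>int_lattice. q (z + L *v \<kappa>))"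

definition sigma0 :: "(real ^ 'n::finite \<Rightarrow> complex) \<Rightarrow> real" where
  "sigma0 q = cmod (LINT z|lebesgue. q z)"

definition sigma_term ::
  "real ^ ('d::finite + 'd) ^ ('d + 'd) \<Rightarrow> (real ^ ('d + 'd) \<Rightarrow> real) \<Rightarrow>
   (real ^ ('d + 'd) \<Rightarrow> complex) \<Rightarrow> real ^ ('d + 'd) \<Rightarrow> real" where
  "sigma_term L v q \<kappa> =
     v (symplectic_J *v (inv_transpose L *v \<kappa>)) * cmod (fourier q (inv_transpose L *v \<kappa>))"

definition sigma_Lv ::
  "real ^ ('d::finite + 'd) ^ ('d + 'd) \<Rightarrow> (real ^ ('d + 'd) \<Rightarrow> real) \<Rightarrow>
   (real ^ ('d + 'd) \<Rightarrow> complex) \<Rightarrow> real" where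
  "sigma_Lv L v q = (\<Sum>\<^sub>\<infinity>\<kappa>\<in>int_lattice. sigma_term L v q \<kappa>)"

end

theory Submission
  imports Defs "HOL-Probability.Characteristic_Functions" "HOL-Probability.Sinc_Integral"
begin

text \<open>The periodized symbol \<open>q\<^sub>L\<close> is a Fourier series
\<open>\<bar>det L\<bar>\<^sup>-\<^sup>1 \<Sum>\<kappa>. fourier q \<theta> e(\<theta>, \<cdot>)\<close>, where \<open>\<theta> = L\<^sup>-\<^sup>T \<kappa>\<close> runs through the dual lattice and
\<open>e(\<theta>, z) = exp (2\<pi>i \<theta> \<bullet> z)\<close>. The operator whose symbol is one exponential \<open>e(\<theta>, \<cdot>)\<close> is the
time-frequency shift by \<open>J \<theta>\<close> times the phase \<open>exp (2\<pi>i \<tau> a \<bullet> b)\<close>, \<open>\<theta> = (a, b)\<close>. Hence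
\<open>Op\<^sub>\<tau>(q\<^sub>L)\<close> is a series of time-frequency shifts, which the weighted summability of the
coefficients makes absolutely convergent in operator norm. Its term at \<open>\<kappa> = 0\<close> is the scalar
\<open>\<bar>det L\<bar>\<^sup>-\<^sup>1 \<integral>q\<close>, and the hypothesis says that the remaining terms have a smaller norm than
this scalar; a fixed point argument (\<open>perturbed_scalar_inverse\<close>) then gives the inverse and the bound.

The analytic content is the identification of the series with the operator, and it is tested on
Schwartz functions \<open>u\<close> and \<open>\<phi>\<close>: the operator is the integral of \<open>q\<^sub>L\<close> against
\<open>W = wigner_tau \<tau> u \<phi>\<close>.

\<^item> \<open>W\<close> is a Schwartz function (\<open>wigner_tau_schwartz\<close>), because it is the Fourier transform of a
  Schwartz function of two variables in the second variable. Schwartz functions are handled by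
  coinduction (\<open>schwartz_coinduct\<close>).

\<^item> The integral of \<open>e(\<theta>, \<cdot>) W\<close> is the matrix coefficient of a time-frequency shift
  (\<open>integral_exponential_wigner_tau\<close>). This is Fourier inversion in the frequency variable.

\<^item> The integral of \<open>q\<^sub>L W\<close> is the sum of the integrals of the terms of the Fourier series
  (\<open>has_sum_integral_periodization\<close>). Unfolding the periodization moves the sum over the lattice from \<open>q\<close> to
  \<open>W\<close>, which gives the integral of \<open>q\<close> against a continuous periodic function; for such a function the
  claim follows from the case of an exponential, since trigonometric polynomials are uniformly
  dense (\<open>trig_dense\<close>).\<close>


section \<open>Schwartz functions\<close>

abbreviation wave :: "'a::real_inner \<Rightarrow> 'a \<Rightarrow> complex" where
  "wave \<omega> t \<equiv> cis (2 * pi * (\<omega> \<bullet> t))"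

definition rapidly_decreasing :: "('a::euclidean_space \<Rightarrow> complex) \<Rightarrow> bool" where
  "rapidly_decreasing f \<longleftrightarrow> (\<forall>n. \<exists>K. \<forall>x. (1 + norm x) ^ n * cmod (f x) \<le> K)"

lemma rapidly_decreasingI:
  assumes "\<And>n. \<exists>K. \<forall>x. (1 + norm x) ^ n * cmod (f x) \<le> K"
  shows "rapidly_decreasing f"
  using assms by (simp add: rapidly_decreasing_def)

lemma rapidly_decreasingE:
  assumes "rapidly_decreasing f"
  obtains K where "K \<ge> 0" "\<And>x. cmod (f x) \<le> K / (1 + norm x) ^ n"
proof -
  obtain K where K: "\<And>x. (1 + norm x) ^ n * cmod (f x) \<le> K"
    using assms unfolding rapidly_decreasing_def by blast
  have "0 \<le> (1 + norm (0::'a)) ^ n * cmod (f 0)"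
    by simp
  also have "\<dots> \<le> K"
    by (rule K)
  finally have "K \<ge> 0" .
  moreover have "cmod (f x) \<le> K / (1 + norm x) ^ n" for x
  proof -
    have "(1 + norm x) ^ n > 0"
      by (intro zero_less_power add_pos_nonneg) auto
    with K[of x] show ?thesis
      by (simp add: field_simps)
  qed
  ultimately show ?thesis
    using that by blast
qed

lemma rapidly_decreasing_mono:
  assumes "rapidly_decreasing f" and "\<And>x. cmod (g x) \<le> c * (1 + norm x) ^ k * cmod (f x)" "c \<ge> 0"
  shows "rapidly_decreasing g"
proof (rule rapidly_decreasingI)
  fix n
  obtain K where K: "\<And>x. (1 + norm x) ^ (n + k) * cmod (f x) \<le> K"
    using assms(1) unfolding rapidly_decreasing_def by blast
  have "(1 + norm x) ^ n * cmod (g x) \<le> c * K" for x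
  proof -
    have "(1 + norm x) ^ n * cmod (g x) \<le> (1 + norm x) ^ n * (c * (1 + norm x) ^ k * cmod (f x))"
      by (intro mult_left_mono assms) auto
    also have "\<dots> = c * ((1 + norm x) ^ (n + k) * cmod (f x))"
      by (simp add: power_add mult_ac)
    also have "\<dots> \<le> c * K"
      by (intro mult_left_mono K assms)
    finally show ?thesis .
  qed
  thus "\<exists>K. \<forall>x. (1 + norm x) ^ n * cmod (g x) \<le> K"
    by blast
qed

lemma rapidly_decreasing_add:
  assumes "rapidly_decreasing f" "rapidly_decreasing g"
  shows "rapidly_decreasing (\<lambda>x. f x + g x)"
proof (rule rapidly_decreasingI)
  fix n
  obtain K1 where K1: "\<And>x. (1 + norm x) ^ n * cmod (f x) \<le> K1"
    using assms(1) unfolding rapidly_decreasing_def by blast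
  obtain K2 where K2: "\<And>x. (1 + norm x) ^ n * cmod (g x) \<le> K2"
    using assms(2) unfolding rapidly_decreasing_def by blast
  have "(1 + norm x) ^ n * cmod (f x + g x) \<le> K1 + K2" for x
  proof -
    have "(1 + norm x) ^ n * cmod (f x + g x) \<le> (1 + norm x) ^ n * (cmod (f x) + cmod (g x))"
      by (intro mult_left_mono norm_triangle_ineq) auto
    also have "\<dots> = (1 + norm x) ^ n * cmod (f x) + (1 + norm x) ^ n * cmod (g x)"
      by (simp add: algebra_simps)
    also have "\<dots> \<le> K1 + K2"
      by (intro add_mono K1 K2)
    finally show ?thesis .
  qed
  thus "\<exists>K. \<forall>x. (1 + norm x) ^ n * cmod (f x + g x) \<le> K"
    by blast
qed

text \<open>The Schwartz space is the largest class of rapidly decreasing, everywhere differentiable functions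
that is stable under partial derivatives. So a function is shown to be Schwartz by exhibiting such
a class that contains it; all closure properties below are obtained in this way.\<close>

lemma schwartz_coinduct:
  assumes "\<And>f x. f \<in> W \<Longrightarrow> f differentiable (at x)"
    and "\<And>f b. f \<in> W \<Longrightarrow> b \<in> Basis \<Longrightarrow> (\<lambda>x. frechet_derivative f (at x) b) \<in> W"
    and "\<And>f. f \<in> W \<Longrightarrow> rapidly_decreasing f"
  shows "W \<subseteq> (schwartz :: ('a::euclidean_space \<Rightarrow> complex) set)"
proof
  fix f assume f: "f \<in> W"
  have W: "set bs \<subseteq> Basis \<Longrightarrow> partials f bs \<in> W" for bs
    by (induction bs) (auto intro: assms(2) f)
  have "bounded (range (\<lambda>x. (1 + norm x) ^ n *\<^sub>R partials f bs x))"
    if bs: "set bs \<subseteq> Basis" for bs n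
  proof -
    obtain K where "\<And>x. (1 + norm x) ^ n * cmod (partials f bs x) \<le> K"
      using assms(3)[of "partials f bs"] W[OF bs] unfolding rapidly_decreasing_def by blast
    thus ?thesis
      by (intro boundedI[of _ K]) auto
  qed
  thus "f \<in> schwartz"
    unfolding schwartz_def using W assms(1) by blast
qed

lemma schwartz_differentiable: "f \<in> schwartz \<Longrightarrow> f differentiable (at x)"
  unfolding schwartz_def by (auto dest: spec[of _ "[]"])

lemma schwartz_has_derivative:
  "f \<in> schwartz \<Longrightarrow> (f has_derivative frechet_derivative f (at x)) (at x)"
  using schwartz_differentiable frechet_derivative_works by blast

lemma schwartz_continuous: "f \<in> schwartz \<Longrightarrow> continuous_on UNIV f"
  by (meson continuous_at_imp_continuous_on differentiable_imp_continuous_within schwartz_differentiable)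

lemma schwartz_rapidly_decreasing:
  assumes "f \<in> schwartz" shows "rapidly_decreasing f"
proof (rule rapidly_decreasingI)
  fix n
  have "bounded (range (\<lambda>x. (1 + norm x) ^ n *\<^sub>R partials f [] x))"
    using assms unfolding schwartz_def by (auto simp del: partials.simps)
  then obtain K where "\<forall>y\<in>range (\<lambda>x. (1 + norm x) ^ n *\<^sub>R partials f [] x). norm y \<le> K"
    unfolding bounded_iff by blast
  thus "\<exists>K. \<forall>x. (1 + norm x) ^ n * cmod (f x) \<le> K"
    by (intro exI[of _ K]) auto
qed

lemma partials_append: "partials f (bs @ cs) = partials (partials f cs) bs"
  by (induction bs) auto

lemma schwartz_partial:
  assumes "f \<in> schwartz" "b \<in> Basis"
  shows "(\<lambda>x. frechet_derivative f (at x) b) \<in> schwartz"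
proof -
  have "partials (\<lambda>x. frechet_derivative f (at x) b) bs = partials f (bs @ [b])" for bs
    by (simp add: partials_append)
  thus ?thesis
    using assms unfolding schwartz_def by simp
qed

lemma schwartz_add:
  assumes "f \<in> schwartz" "g \<in> schwartz"
  shows "(\<lambda>x. f x + g x) \<in> schwartz"
proof -
  define W where "W = {\<lambda>x. f x + g x |f g :: 'a \<Rightarrow> complex. f \<in> schwartz \<and> g \<in> schwartz}"
  have WI: "(\<lambda>x. f x + g x) \<in> W" if "f \<in> schwartz" "g \<in> schwartz" for f g
    unfolding W_def by (intro CollectI exI conjI) (rule refl that)+
  have "W \<subseteq> schwartz"
  proof (rule schwartz_coinduct)
    fix h assume "h \<in> W"
    then obtain f g where h: "h = (\<lambda>x. f x + g x)" and fg: "f \<in> schwartz" "g \<in> schwartz"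
      unfolding W_def by blast
    have D: "(h has_derivative (\<lambda>v. frechet_derivative f (at x) v + frechet_derivative g (at x) v)) (at x)" for x
      unfolding h by (intro derivative_intros schwartz_has_derivative fg)
    show "h differentiable (at x)" for x
      using D differentiable_def by blast
    show "rapidly_decreasing h"
      unfolding h by (intro rapidly_decreasing_add schwartz_rapidly_decreasing fg)
    show "(\<lambda>x. frechet_derivative h (at x) b) \<in> W" if "b \<in> Basis" for b
      unfolding frechet_derivative_at[OF D, symmetric] by (intro WI schwartz_partial fg that)
  qed
  thus ?thesis
    using WI[OF assms] by blast
qed

lemma schwartz_cmult:
  assumes "f \<in> schwartz"
  shows "(\<lambda>x. c * f x) \<in> schwartz"
proof -
  define W where "W = {\<lambda>x. c * f x |f :: 'a \<Rightarrow> complex. f \<in> schwartz}"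
  have WI: "(\<lambda>x. c * f x) \<in> W" if "f \<in> schwartz" for f
    unfolding W_def by (intro CollectI exI conjI) (rule refl that)+
  have "W \<subseteq> schwartz"
  proof (rule schwartz_coinduct)
    fix h assume "h \<in> W"
    then obtain f where h: "h = (\<lambda>x. c * f x)" and f: "f \<in> schwartz"
      unfolding W_def by blast
    have D: "(h has_derivative (\<lambda>v. c * frechet_derivative f (at x) v)) (at x)" for x
      unfolding h by (intro derivative_intros schwartz_has_derivative f)
    show "h differentiable (at x)" for x
      using D differentiable_def by blast
    show "rapidly_decreasing h"
      by (rule rapidly_decreasing_mono[OF schwartz_rapidly_decreasing[OF f], of _ "cmod c" 0])
        (auto simp: h norm_mult)
    show "(\<lambda>x. frechet_derivative h (at x) b) \<in> W" if "b \<in> Basis" for b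
      unfolding frechet_derivative_at[OF D, symmetric] by (intro WI schwartz_partial f that)
  qed
  thus ?thesis
    using WI[OF assms] by blast
qed

lemma zero_schwartz: "(\<lambda>x. 0) \<in> schwartz"
proof -
  have "{\<lambda>x::'a. 0::complex} \<subseteq> schwartz"
    by (rule schwartz_coinduct) (auto simp: rapidly_decreasing_def frechet_derivative_const)
  thus ?thesis
    by simp
qed

lemma schwartz_sum:
  assumes "\<And>i. i \<in> I \<Longrightarrow> f i \<in> schwartz"
  shows "(\<lambda>x. \<Sum>i\<in>I. f i x) \<in> schwartz"
  using assms by (induction I rule: infinite_finite_induct) (auto intro: schwartz_add zero_schwartz)

lemma frechet_derivative_basis_sum:
  fixes f :: "'a::euclidean_space \<Rightarrow> complex"
  assumes "f differentiable (at x)"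
  shows "frechet_derivative f (at x) v =
    (\<Sum>b\<in>Basis. complex_of_real (v \<bullet> b) * frechet_derivative f (at x) b)"
proof -
  have "linear (frechet_derivative f (at x))"
    using assms linear_frechet_derivative by blast
  hence "frechet_derivative f (at x) (\<Sum>b\<in>Basis. (v \<bullet> b) *\<^sub>R b) =
    (\<Sum>b\<in>Basis. (v \<bullet> b) *\<^sub>R frechet_derivative f (at x) b)"
    by (simp add: linear_sum linear_cmul)
  thus ?thesis
    by (simp add: euclidean_representation scaleR_conv_of_real)
qed

lemma schwartz_derivative:
  assumes "f \<in> schwartz"
  shows "(\<lambda>x. frechet_derivative f (at x) v) \<in> schwartz"
proof -
  have "(\<lambda>x. frechet_derivative f (at x) v) =
    (\<lambda>x. \<Sum>b\<in>Basis. complex_of_real (v \<bullet> b) * frechet_derivative f (at x) b)"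
    using frechet_derivative_basis_sum[OF schwartz_differentiable[OF assms]] by (intro ext)
  thus ?thesis
    using assms by (auto intro!: schwartz_sum schwartz_cmult schwartz_partial)
qed

lemma schwartz_derivative_bound:
  assumes "f \<in> schwartz"
  obtains K where "K \<ge> 0" "\<And>x v. cmod (frechet_derivative f (at x) v) \<le> K / (1 + norm x) ^ n * norm v"
proof -
  have "\<exists>K\<ge>0. \<forall>x. cmod (frechet_derivative f (at x) b) \<le> K / (1 + norm x) ^ n" for b
    using rapidly_decreasingE[OF schwartz_rapidly_decreasing[OF schwartz_derivative[OF assms]]] by metis
  then obtain K where K: "\<And>b. K b \<ge> 0"
    "\<And>b x. cmod (frechet_derivative f (at x) b) \<le> K b / (1 + norm x) ^ n"
    by metis
  show ?thesis
  proof (rule that[of "sum K Basis"])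
    show "0 \<le> sum K Basis"
      by (intro sum_nonneg K)
    fix x v
    have "cmod (frechet_derivative f (at x) v) \<le>
      (\<Sum>b\<in>Basis. cmod (complex_of_real (v \<bullet> b) * frechet_derivative f (at x) b))"
      by (subst frechet_derivative_basis_sum[OF schwartz_differentiable[OF assms]]) (rule norm_sum)
    also have "\<dots> \<le> (\<Sum>b\<in>Basis. norm v * (K b / (1 + norm x) ^ n))"
      unfolding norm_mult norm_of_real
      by (intro sum_mono mult_mono K Basis_le_norm) auto
    also have "\<dots> = sum K Basis / (1 + norm x) ^ n * norm v"
      by (simp add: sum_distrib_left sum_divide_distrib mult_ac)
    finally show "cmod (frechet_derivative f (at x) v) \<le> sum K Basis / (1 + norm x) ^ n * norm v" .
  qed
qed

lemma schwartz_coordinate_mult: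
  assumes "f \<in> schwartz"
  shows "(\<lambda>x. complex_of_real (x \<bullet> a) * f x) \<in> schwartz"
proof -
  \<comment> \<open>The summand \<open>g\<close> absorbs the term in which the coordinate itself is differentiated.\<close>
  define W where "W = {\<lambda>x. complex_of_real (x \<bullet> a) * f x + g x |f g :: 'a \<Rightarrow> complex. f \<in> schwartz \<and> g \<in> schwartz}"
  have WI: "(\<lambda>x. complex_of_real (x \<bullet> a) * f x + g x) \<in> W" if "f \<in> schwartz" "g \<in> schwartz" for f g
    unfolding W_def by (intro CollectI exI conjI) (rule refl that)+
  have "W \<subseteq> schwartz"
  proof (rule schwartz_coinduct)
    fix h assume "h \<in> W"
    then obtain f g where h: "h = (\<lambda>x. complex_of_real (x \<bullet> a) * f x + g x)"
      and fg: "f \<in> schwartz" "g \<in> schwartz"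
      unfolding W_def by blast
    have D: "(h has_derivative (\<lambda>v. (complex_of_real (x \<bullet> a) * frechet_derivative f (at x) v
        + complex_of_real (v \<bullet> a) * f x) + frechet_derivative g (at x) v)) (at x)" for x
      unfolding h by (intro derivative_intros schwartz_has_derivative fg)
    show "h differentiable (at x)" for x
      using D differentiable_def by blast
    have bound: "cmod (complex_of_real (x \<bullet> a) * f x) \<le> norm a * (1 + norm x) ^ 1 * cmod (f x)" for x
    proof -
      have "\<bar>x \<bullet> a\<bar> \<le> norm x * norm a"
        by (rule Cauchy_Schwarz_ineq2)
      also have "\<dots> \<le> norm a * (1 + norm x)"
        by (simp add: algebra_simps)
      finally show ?thesis
        by (simp add: norm_mult mult_right_mono)
    qed
    have "rapidly_decreasing (\<lambda>x. complex_of_real (x \<bullet> a) * f x)"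
      by (rule rapidly_decreasing_mono[OF schwartz_rapidly_decreasing[OF fg(1)] bound norm_ge_zero])
    thus "rapidly_decreasing h"
      unfolding h by (rule rapidly_decreasing_add[OF _ schwartz_rapidly_decreasing[OF fg(2)]])
    show "(\<lambda>x. frechet_derivative h (at x) b) \<in> W" if "b \<in> Basis" for b
    proof -
      have "(\<lambda>x. frechet_derivative h (at x) b) = (\<lambda>x. complex_of_real (x \<bullet> a) * frechet_derivative f (at x) b
          + (complex_of_real (b \<bullet> a) * f x + frechet_derivative g (at x) b))"
        unfolding frechet_derivative_at[OF D, symmetric] by (simp add: algebra_simps)
      also have "\<dots> \<in> W"
        by (intro WI schwartz_add schwartz_cmult schwartz_partial fg that)
      finally show ?thesis .
    qed
  qed
  with WI[OF assms zero_schwartz] have "(\<lambda>x. complex_of_real (x \<bullet> a) * f x + 0) \<in> schwartz"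
    by blast
  thus ?thesis
    by simp
qed

lemma has_derivative_cis_inner:
  "((\<lambda>t. wave \<omega> t) has_derivative
    (\<lambda>v. (2 * pi * (\<omega> \<bullet> v)) *\<^sub>R (\<i> * wave \<omega> t))) (at t)"
  by (rule derivative_eq_intros refl | simp)+

lemma schwartz_modulation:
  assumes "f \<in> schwartz"
  shows "modulation \<omega> f \<in> schwartz"
proof -
  have "modulation \<omega> ` schwartz \<subseteq> schwartz"
  proof (rule schwartz_coinduct)
    fix h assume "h \<in> modulation \<omega> ` schwartz"
    then obtain f where h: "h = (\<lambda>t. wave \<omega> t * f t)" and f: "f \<in> schwartz"
      unfolding modulation_def by blast
    have D: "(h has_derivative (\<lambda>v. wave \<omega> x * frechet_derivative f (at x) v
      + (2 * pi * (\<omega> \<bullet> v)) *\<^sub>R (\<i> * wave \<omega> x) * f x)) (at x)" for x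
      unfolding h by (intro derivative_intros has_derivative_cis_inner schwartz_has_derivative f)
    show "h differentiable (at x)" for x
      using D differentiable_def by blast
    show "rapidly_decreasing h"
      by (rule rapidly_decreasing_mono[OF schwartz_rapidly_decreasing[OF f], of _ 1 0])
        (auto simp: h norm_mult)
    show "(\<lambda>x. frechet_derivative h (at x) b) \<in> modulation \<omega> ` schwartz" if "b \<in> Basis" for b
    proof -
      have "(\<lambda>x. frechet_derivative h (at x) b) =
        modulation \<omega> (\<lambda>x. frechet_derivative f (at x) b + (2 * pi * (\<omega> \<bullet> b) * \<i>) * f x)"
        unfolding frechet_derivative_at[OF D, symmetric] modulation_def
        by (simp add: algebra_simps scaleR_conv_of_real)
      moreover have "(\<lambda>x. frechet_derivative f (at x) b + (2 * pi * (\<omega> \<bullet> b) * \<i>) * f x) \<in> schwartz"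
        by (intro schwartz_add schwartz_cmult schwartz_partial f that)
      ultimately show ?thesis
        by blast
    qed
  qed
  thus ?thesis
    using assms by blast
qed

lemma one_plus_norm_mult_le:
  fixes y z :: "'a::real_normed_vector"
  assumes "norm z \<le> norm x + norm y"
  shows "1 + norm z \<le> (1 + norm x) * (1 + norm y)"
proof -
  have "1 + norm z + norm x * norm y \<le> (1 + norm x) * (1 + norm y)"
    using assms by (simp add: algebra_simps)
  moreover have "0 \<le> norm x * norm y"
    by simp
  ultimately show ?thesis
    by linarith
qed

text \<open>The class for the coinduction below: sums are needed because the product rule turns one tensor
product into two.\<close>

inductive_set tensor_span :: "('c \<Rightarrow> 'a::euclidean_space) \<Rightarrow> ('c \<Rightarrow> 'b::euclidean_space) \<Rightarrow> ('c \<Rightarrow> complex) set"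
  for A B where
  tensor: "f \<in> schwartz \<Longrightarrow> g \<in> schwartz \<Longrightarrow> (\<lambda>z. f (A z) * g (B z)) \<in> tensor_span A B"
| tensor_add: "h \<in> tensor_span A B \<Longrightarrow> k \<in> tensor_span A B \<Longrightarrow> (\<lambda>z. h z + k z) \<in> tensor_span A B"

lemma rapidly_decreasing_tensor:
  assumes inj: "\<And>z. norm z \<le> c * (norm (A z) + norm (B z))" and c: "c \<ge> 0"
    and f: "rapidly_decreasing f" and g: "rapidly_decreasing g"
  shows "rapidly_decreasing (\<lambda>z. f (A z) * g (B z))"
proof (rule rapidly_decreasingI)
  fix n
  obtain K1 where K1: "K1 \<ge> 0" "\<And>x. cmod (f x) \<le> K1 / (1 + norm x) ^ n"
    using rapidly_decreasingE[OF f, where n = n] by blast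
  obtain K2 where K2: "K2 \<ge> 0" "\<And>x. cmod (g x) \<le> K2 / (1 + norm x) ^ n"
    using rapidly_decreasingE[OF g, where n = n] by blast
  have "(1 + norm z) ^ n * cmod (f (A z) * g (B z)) \<le> (1 + c) ^ n * (K1 * K2)" for z
  proof -
    let ?a = "1 + norm (A z)" and ?b = "1 + norm (B z)"
    have pos: "?a > 0" "?b > 0"
      by (auto intro: add_pos_nonneg)
    have "1 + norm z \<le> 1 + c * (norm (A z) + norm (B z))"
      using inj[of z] by simp
    also have "\<dots> \<le> (1 + c) * (1 + (norm (A z) + norm (B z)))"
      using c by (simp add: algebra_simps)
    also have "\<dots> \<le> (1 + c) * (?a * ?b)"
      by (intro mult_left_mono) (use c in \<open>auto simp: algebra_simps\<close>)
    finally have "(1 + norm z) ^ n * cmod (f (A z) * g (B z))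
        \<le> ((1 + c) * (?a * ?b)) ^ n * (K1 / ?a ^ n * (K2 / ?b ^ n))"
      unfolding norm_mult using K1 K2 pos c by (intro mult_mono power_mono) auto
    also have "\<dots> = (1 + c) ^ n * (K1 * K2)"
      using pos by (simp add: power_mult_distrib)
    finally show ?thesis .
  qed
  thus "\<exists>K. \<forall>z. (1 + norm z) ^ n * cmod (f (A z) * g (B z)) \<le> K"
    by blast
qed

text \<open>The pull-back of \<open>f \<otimes> g\<close> along the linear map \<open>(A, B)\<close>. The lower bound on \<open>(A, B)\<close> turns the decay
of \<open>f\<close> in \<open>A z\<close> and of \<open>g\<close> in \<open>B z\<close> into decay in \<open>z\<close>.\<close>

lemma schwartz_tensor_linear:
  fixes A :: "'c::euclidean_space \<Rightarrow> 'a::euclidean_space" and B :: "'c \<Rightarrow> 'b::euclidean_space"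
  assumes A: "bounded_linear A" and B: "bounded_linear B"
    and inj: "\<And>z. norm z \<le> c * (norm (A z) + norm (B z))" and c: "c \<ge> 0"
    and "f \<in> schwartz" "g \<in> schwartz"
  shows "(\<lambda>z. f (A z) * g (B z)) \<in> schwartz"
proof -
  have deriv: "\<exists>h'. (\<forall>z. (h has_derivative h' z) (at z)) \<and> (\<forall>v. (\<lambda>z. h' z v) \<in> tensor_span A B)"
    if "h \<in> tensor_span A B" for h
    using that
  proof induction
    case (tensor f g)
    let ?h' = "\<lambda>z v. f (A z) * frechet_derivative g (at (B z)) (B v) + frechet_derivative f (at (A z)) (A v) * g (B z)"
    have "((\<lambda>z. f (A z) * g (B z)) has_derivative ?h' z) (at z)" for z
      by (intro derivative_intros has_derivative_compose[OF bounded_linear_imp_has_derivative[OF A]]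
          has_derivative_compose[OF bounded_linear_imp_has_derivative[OF B]] schwartz_has_derivative tensor)
    moreover have "(\<lambda>z. ?h' z v) \<in> tensor_span A B" for v
      by (intro tensor_span.intros schwartz_derivative tensor)
    ultimately show ?case
      by (intro exI[of _ ?h']) blast
  next
    case (tensor_add h k)
    then obtain h' k' where *: "\<And>z. (h has_derivative h' z) (at z)" "\<And>v. (\<lambda>z. h' z v) \<in> tensor_span A B"
      "\<And>z. (k has_derivative k' z) (at z)" "\<And>v. (\<lambda>z. k' z v) \<in> tensor_span A B"
      by blast
    show ?case
      by (rule exI[of _ "\<lambda>z v. h' z v + k' z v"]) (intro conjI allI has_derivative_add tensor_span.tensor_add *)
  qed
  have "tensor_span A B \<subseteq> schwartz"
  proof (rule schwartz_coinduct)
    fix h assume h: "h \<in> tensor_span A B"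
    obtain h' where h': "\<And>z. (h has_derivative h' z) (at z)" "\<And>v. (\<lambda>z. h' z v) \<in> tensor_span A B"
      using deriv[OF h] by blast
    show "h differentiable (at z)" for z
      using h'(1) differentiable_def by blast
    show "(\<lambda>z. frechet_derivative h (at z) b) \<in> tensor_span A B" for b
      unfolding frechet_derivative_at[OF h'(1), symmetric] by (rule h'(2))
    show "rapidly_decreasing h"
      using h
    proof induction
      case (tensor f g)
      show ?case
        by (rule rapidly_decreasing_tensor[OF inj c]) (intro schwartz_rapidly_decreasing tensor)+
    qed (rule rapidly_decreasing_add)
  qed
  thus ?thesis
    using tensor[OF assms(5,6)] by blast
qed

lemma schwartz_translation:
  assumes "f \<in> schwartz"
  shows "translation y f \<in> schwartz"
proof -
  have "translation y ` schwartz \<subseteq> schwartz"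
  proof (rule schwartz_coinduct)
    fix h assume "h \<in> translation y ` schwartz"
    then obtain f where h: "h = (\<lambda>t. f (t - y))" and f: "f \<in> schwartz"
      unfolding translation_def by blast
    have 1: "((\<lambda>t. t - y) has_derivative (\<lambda>v. v)) (at x)" for x
      by (rule derivative_eq_intros refl | simp)+
    have D: "(h has_derivative (\<lambda>v. frechet_derivative f (at (x - y)) v)) (at x)" for x
      unfolding h by (rule has_derivative_compose[OF 1 schwartz_has_derivative[OF f]])
    show "h differentiable (at x)" for x
      using D differentiable_def by blast
    show "rapidly_decreasing h"
    proof (rule rapidly_decreasingI)
      fix n
      obtain K where K: "K \<ge> 0" "\<And>x. cmod (f x) \<le> K / (1 + norm x) ^ n"
        using rapidly_decreasingE[OF schwartz_rapidly_decreasing[OF f], where n = n] by blast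
      have "(1 + norm x) ^ n * cmod (h x) \<le> (1 + norm y) ^ n * K" for x
      proof -
        have pos: "1 + norm (x - y) > 0"
          by (auto intro: add_pos_nonneg)
        have "1 + norm x \<le> (1 + norm y) * (1 + norm (x - y))"
          using norm_triangle_sub[of x y] by (intro one_plus_norm_mult_le) auto
        hence "(1 + norm x) ^ n * cmod (h x) \<le>
            ((1 + norm y) * (1 + norm (x - y))) ^ n * (K / (1 + norm (x - y)) ^ n)"
          unfolding h using K by (intro mult_mono power_mono) auto
        also have "\<dots> = (1 + norm y) ^ n * K"
          using pos by (simp add: power_mult_distrib)
        finally show ?thesis .
      qed
      thus "\<exists>K. \<forall>x. (1 + norm x) ^ n * cmod (h x) \<le> K"
        by blast
    qed
    show "(\<lambda>x. frechet_derivative h (at x) b) \<in> translation y ` schwartz" if "b \<in> Basis" for b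
      unfolding frechet_derivative_at[OF D, symmetric]
      using schwartz_partial[OF f that] by (auto simp: translation_def)
  qed
  thus ?thesis
    using assms by blast
qed


section \<open>Integrals\<close>

lemma lborel_prod_coordinates:
  fixes f :: "'a::euclidean_space \<Rightarrow> real \<Rightarrow> 'b::{real_normed_field,banach,second_countable_topology}"
  assumes "\<And>b. b \<in> Basis \<Longrightarrow> integrable lborel (f b)"
  shows integrable_lborel_prod: "integrable lborel (\<lambda>x. \<Prod>b\<in>Basis. f b (x \<bullet> b))"
    and integral_lborel_prod: "(LINT x|lborel. (\<Prod>b\<in>Basis. f b (x \<bullet> b))) = (\<Prod>b\<in>Basis. (LINT r|lborel. f b r))"
proof -
  interpret product_sigma_finite "\<lambda>_::'a. lborel :: real measure" ..
  have [measurable]: "f b \<in> borel_measurable borel" if "b \<in> Basis" for b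
    using borel_measurable_integrable[OF assms[OF that]] by simp
  have meas: "(\<lambda>x. \<Prod>b\<in>Basis. f b (x \<bullet> b)) \<in> borel_measurable borel"
    by measurable
  have eq: "(\<Prod>b\<in>Basis. f b ((\<Sum>b\<in>Basis. x b *\<^sub>R b) \<bullet> b)) = (\<Prod>b\<in>Basis. f b (x b))"
    for x :: "'a \<Rightarrow> real"
    by (intro prod.cong) (auto simp: inner_sum_left inner_Basis if_distrib sum.delta cong: if_cong)
  have T: "(\<lambda>f. \<Sum>b\<in>Basis. f b *\<^sub>R b) \<in> (\<Pi>\<^sub>M b\<in>Basis. lborel) \<rightarrow>\<^sub>M (borel :: 'a measure)"
    by measurable
  show "integrable lborel (\<lambda>x. \<Prod>b\<in>Basis. f b (x \<bullet> b))"
    by (subst lborel_eq, subst integrable_distr_eq[OF T meas])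
      (unfold eq, intro product_integrable_prod assms, auto)
  show "(LINT x|lborel. (\<Prod>b\<in>Basis. f b (x \<bullet> b))) = (\<Prod>b\<in>Basis. (LINT r|lborel. f b r))"
    by (subst lborel_eq, subst integral_distr[OF T meas])
      (unfold eq, intro product_integral_prod assms, auto)
qed

text \<open>The power \<open>(1 + \<bar>x\<bar>)\<^sup>2\<^sup>d\<close> dominates the product of the \<open>d\<close> factors \<open>1 + x\<^sub>b\<^sup>2\<close>, and the reciprocal of
this product is integrable by Fubini.\<close>

lemma integrable_inverse_power_norm:
  "integrable lborel (\<lambda>x::'a::euclidean_space. 1 / (1 + norm x) ^ (2 * DIM('a)))"
proof (rule Bochner_Integration.integrable_bound)
  have "set_integrable lborel UNIV (\<lambda>x::real. inverse (1 + x\<^sup>2))"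
    using integrable_inverse_1_plus_square by simp
  hence "integrable lborel (\<lambda>x::real. inverse (1 + x\<^sup>2))"
    by (simp add: set_integrable_def)
  thus "integrable lborel (\<lambda>x::'a. \<Prod>b\<in>Basis. inverse (1 + (x \<bullet> b)\<^sup>2))"
    by (intro integrable_lborel_prod)
  show "AE x::'a in lborel. norm (1 / (1 + norm x) ^ (2 * DIM('a))) \<le> norm (\<Prod>b\<in>Basis. inverse (1 + (x \<bullet> b)\<^sup>2) :: real)"
  proof (intro AE_I2)
    fix x :: 'a
    have "(\<Prod>b\<in>(Basis :: 'a set). inverse ((1 + norm x)\<^sup>2)) \<le> (\<Prod>b\<in>Basis. inverse (1 + (x \<bullet> b)\<^sup>2))"
    proof (rule prod_mono)
      fix b :: 'a assume b: "b \<in> Basis"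
      have "(x \<bullet> b)\<^sup>2 \<le> (norm x)\<^sup>2"
        using power_mono[OF Basis_le_norm[OF b, of x], of 2] by simp
      also have "1 + (norm x)\<^sup>2 \<le> (1 + norm x)\<^sup>2"
        by (simp add: power2_eq_square algebra_simps)
      finally have "1 + (x \<bullet> b)\<^sup>2 \<le> (1 + norm x)\<^sup>2"
        by simp
      moreover have "1 + (x \<bullet> b)\<^sup>2 > 0"
        by (simp add: add_pos_nonneg)
      ultimately show "0 \<le> inverse ((1 + norm x)\<^sup>2) \<and> inverse ((1 + norm x)\<^sup>2) \<le> inverse (1 + (x \<bullet> b)\<^sup>2)"
        using le_imp_inverse_le by auto
    qed
    moreover have "(\<Prod>b\<in>Basis. inverse (1 + (x \<bullet> b)\<^sup>2)) \<ge> 0"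
      by (intro prod_nonneg) auto
    ultimately show "norm (1 / (1 + norm x) ^ (2 * DIM('a))) \<le> norm (\<Prod>b\<in>Basis. inverse (1 + (x \<bullet> b)\<^sup>2) :: real)"
      by (simp add: power_mult inverse_eq_divide power_one_over)
  qed
qed auto

lemma integrable_rapidly_decreasing:
  fixes f :: "'a::euclidean_space \<Rightarrow> complex"
  assumes "f \<in> borel_measurable borel" "rapidly_decreasing f"
  shows "integrable lborel f"
proof -
  obtain K where K: "\<And>x. cmod (f x) \<le> K / (1 + norm x) ^ (2 * DIM('a))" "K \<ge> 0"
    using rapidly_decreasingE[OF assms(2), where n = "2 * DIM('a)"] by metis
  have "integrable lborel (\<lambda>x::'a. K * (1 / (1 + norm x) ^ (2 * DIM('a))))"
    by (intro integrable_mult_right integrable_inverse_power_norm)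
  thus ?thesis
    by (rule Bochner_Integration.integrable_bound) (use assms K in auto)
qed

lemma schwartz_measurable: "f \<in> schwartz \<Longrightarrow> f \<in> borel_measurable borel"
  by (intro borel_measurable_continuous_onI schwartz_continuous)

lemma schwartz_integrable: "f \<in> schwartz \<Longrightarrow> integrable lborel f"
  by (intro integrable_rapidly_decreasing schwartz_measurable schwartz_rapidly_decreasing)

lemma lborel_translate:
  fixes f :: "'a::euclidean_space \<Rightarrow> 'b::{banach,second_countable_topology}"
  assumes "f \<in> borel_measurable borel"
  shows integrable_lborel_translate: "integrable lborel (\<lambda>t. f (t + a)) \<longleftrightarrow> integrable lborel f"
    and integral_lborel_translate: "(LINT t|lborel. f (t + a)) = (LINT t|lborel. f t)"
proof -
  have "integrable (distr lborel borel ((+) a)) f \<longleftrightarrow> integrable lborel (\<lambda>t. f (a + t))"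
    by (rule integrable_distr_eq) (use assms in auto)
  thus "integrable lborel (\<lambda>t. f (t + a)) \<longleftrightarrow> integrable lborel f"
    by (simp add: lborel_distr_plus add.commute)
  have "integral\<^sup>L (distr lborel borel ((+) a)) f = (LINT t|lborel. f (a + t))"
    by (rule integral_distr) (use assms in auto)
  thus "(LINT t|lborel. f (t + a)) = (LINT t|lborel. f t)"
    by (simp add: lborel_distr_plus add.commute)
qed

text \<open>Differentiation under the integral sign for total derivatives. By the mean value inequality the
difference quotients along any sequence that tends to \<open>z0\<close> are dominated by \<open>2 D\<close>, so dominated
convergence applies.\<close>

lemma has_derivative_integral:
  fixes K :: "'a::euclidean_space \<Rightarrow> 'b \<Rightarrow> complex" and z0 :: 'a
  assumes int: "\<And>z. integrable M (K z)"
    and deriv: "\<And>z t. z \<in> ball z0 1 \<Longrightarrow> ((\<lambda>z. K z t) has_derivative K' z t) (at z)"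
    and meas: "\<And>v. (\<lambda>t. K' z0 t v) \<in> borel_measurable M"
    and bound: "\<And>z t v. z \<in> ball z0 1 \<Longrightarrow> cmod (K' z t v) \<le> D t * norm v"
    and D: "integrable M D"
  shows "((\<lambda>z. LINT t|M. K z t) has_derivative (\<lambda>v. LINT t|M. K' z0 t v)) (at z0)"
  unfolding has_derivative_iff_norm
proof
  have lin: "linear (K' z0 t)" for t
    using deriv[of z0 t] has_derivative_linear by force
  have intK': "integrable M (\<lambda>t. K' z0 t v)" for v
  proof (rule Bochner_Integration.integrable_bound)
    show "integrable M (\<lambda>t. D t * norm v)"
      using D by simp
    have "D t * norm v \<ge> 0" for t
      using order_trans[OF norm_ge_zero bound[of z0 t v]] by simp
    thus "AE t in M. cmod (K' z0 t v) \<le> norm (D t * norm v)"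
      using bound[of z0 _ v] by (intro AE_I2) (simp add: abs_of_nonneg del: abs_mult)
  qed (rule meas)
  have "norm (LINT t|M. K' z0 t v) \<le> norm v * (LINT t|M. D t)" for v
  proof -
    have "norm (LINT t|M. K' z0 t v) \<le> (LINT t|M. norm (K' z0 t v))"
      by (rule integral_norm_bound)
    also have "\<dots> \<le> (LINT t|M. D t * norm v)"
      by (rule integral_mono) (use D bound intK' in auto)
    finally have "norm (LINT t|M. K' z0 t v) \<le> (LINT t|M. D t * norm v)" .
    thus ?thesis
      by (simp add: mult.commute)
  qed
  thus "bounded_linear (\<lambda>v. LINT t|M. K' z0 t v)"
    by (intro bounded_linear_intro[where K = "LINT t|M. D t"])
      (simp_all add: linear_add[OF lin] linear_scale[OF lin] intK')
  let ?Q = "\<lambda>y. norm ((LINT t|M. K y t) - (LINT t|M. K z0 t) - (LINT t|M. K' z0 t (y - z0))) / norm (y - z0)"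
  show "(?Q \<longlongrightarrow> 0) (at z0)"
    unfolding tendsto_at_iff_sequentially
  proof (intro allI impI)
    fix X assume X: "\<forall>i. X i \<in> UNIV - {z0}" "X \<longlonglongrightarrow> z0"
    have "\<forall>\<^sub>F n in sequentially. X n \<in> ball z0 1"
      by (rule topological_tendstoD[OF X(2)]) auto
    then obtain N where N: "\<And>n. n \<ge> N \<Longrightarrow> X n \<in> ball z0 1"
      unfolding eventually_sequentially by blast
    define Y where "Y n = X (n + N)" for n
    have Y: "Y n \<in> ball z0 1" "Y n \<noteq> z0" "Y \<longlonglongrightarrow> z0" for n
      using N X unfolding Y_def by (auto intro: LIMSEQ_ignore_initial_segment)
    define R where "R n t = (K (Y n) t - K z0 t - K' z0 t (Y n - z0)) /\<^sub>R norm (Y n - z0)" for n t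
    have "(\<lambda>n. LINT t|M. R n t) \<longlonglongrightarrow> (LINT t|M. 0)"
    proof (rule integral_dominated_convergence)
      show "integrable M (\<lambda>t. 2 * D t)"
        using D by simp
      show "R n \<in> borel_measurable M" for n
        unfolding R_def using borel_measurable_integrable[OF int] meas by measurable
      show "AE t in M. cmod (R n t) \<le> 2 * D t" for n
      proof (intro AE_I2)
        fix t
        have "norm (K (Y n) t - K z0 t) \<le> D t * norm (Y n - z0)"
        proof (rule differentiable_bound[of "ball z0 1" "\<lambda>z. K z t" "\<lambda>z. K' z t"])
          show "((\<lambda>z. K z t) has_derivative K' z t) (at z within ball z0 1)" if "z \<in> ball z0 1" for z
            using deriv[OF that] has_derivative_at_withinI by blast
          show "onorm (K' z t) \<le> D t" if "z \<in> ball z0 1" for z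
          proof (rule onorm_bound)
            obtain b :: 'a where b: "b \<in> Basis"
              using nonempty_Basis by blast
            show "0 \<le> D t"
              using order_trans[OF norm_ge_zero bound[OF that, of t b]] b by simp
          qed (rule bound[OF that])
        qed (use Y in auto)
        moreover have "norm (K' z0 t (Y n - z0)) \<le> D t * norm (Y n - z0)"
          by (rule bound) auto
        ultimately have "norm (K (Y n) t - K z0 t - K' z0 t (Y n - z0)) \<le> 2 * D t * norm (Y n - z0)"
          using norm_triangle_ineq4[of "K (Y n) t - K z0 t" "K' z0 t (Y n - z0)"] by simp
        thus "cmod (R n t) \<le> 2 * D t"
          unfolding R_def norm_scaleR using Y(2)[of n]
          by (subst mult.commute) (simp add: pos_divide_le_eq flip: divide_inverse)
      qed
      show "AE t in M. (\<lambda>n. R n t) \<longlonglongrightarrow> 0"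
      proof (intro AE_I2)
        fix t
        have "((\<lambda>y. norm (K y t - K z0 t - K' z0 t (y - z0)) / norm (y - z0)) \<longlongrightarrow> 0) (at z0)"
          using deriv[of z0 t] unfolding has_derivative_iff_norm by simp
        hence "(\<lambda>n. norm (K (Y n) t - K z0 t - K' z0 t (Y n - z0)) / norm (Y n - z0)) \<longlonglongrightarrow> 0"
          unfolding tendsto_at_iff_sequentially using Y by (auto simp: o_def)
        hence "(\<lambda>n. norm (R n t)) \<longlonglongrightarrow> 0"
          unfolding R_def by (simp add: divide_inverse mult.commute)
        thus "(\<lambda>n. R n t) \<longlonglongrightarrow> 0"
          by (rule tendsto_norm_zero_cancel)
      qed
    qed auto
    hence "(\<lambda>n. norm (LINT t|M. R n t)) \<longlonglongrightarrow> 0"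
      by (simp add: tendsto_norm_zero)
    moreover have "norm (LINT t|M. R n t) = ?Q (Y n)" for n
      unfolding R_def using int intK' by (simp add: divide_inverse mult.commute)
    ultimately have "(\<lambda>n. ?Q (X (n + N))) \<longlonglongrightarrow> 0"
      by (simp add: Y_def)
    thus "(?Q \<circ> X) \<longlonglongrightarrow> 0"
      unfolding o_def by (rule LIMSEQ_offset)
  qed
qed

text \<open>The vanishing of boundary terms in an integration by parts: the integral of \<open>F (x + z)\<close> over \<open>x\<close> does not
depend on \<open>z\<close>, and its derivative at \<open>z = 0\<close> is the integral in question.\<close>

lemma integral_directional_derivative:
  fixes F :: "'a::euclidean_space \<Rightarrow> complex"
  assumes deriv: "\<And>x. (F has_derivative F' x) (at x)"
    and bound: "\<And>x v. cmod (F' x v) \<le> K / (1 + norm x) ^ (2 * DIM('a)) * norm v"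
    and int: "integrable lborel F"
    and meas: "\<And>v. (\<lambda>x. F' x v) \<in> borel_measurable borel"
  shows "(LINT x|lborel. F' x v) = 0"
proof -
  have F: "F \<in> borel_measurable borel"
    using borel_measurable_integrable[OF int] by simp
  obtain b :: 'a where b: "b \<in> Basis"
    using nonempty_Basis by blast
  have K: "K \<ge> 0"
    using order_trans[OF norm_ge_zero bound[of 0 b]] b by simp
  have "((\<lambda>z. LINT t|lborel. F (t + z)) has_derivative (\<lambda>v. LINT t|lborel. F' (t + 0) v)) (at 0)"
  proof (rule has_derivative_integral)
    show "integrable lborel (\<lambda>t. F (t + z))" for z
      using int F by (simp add: integrable_lborel_translate)
    show "((\<lambda>z. F (t + z)) has_derivative F' (t + z)) (at z)" for t z
    proof -
      have "((\<lambda>z. t + z) has_derivative (\<lambda>v. v)) (at z)"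
        by (rule derivative_eq_intros refl | simp)+
      thus ?thesis
        by (rule has_derivative_compose[OF _ deriv])
    qed
    show "(\<lambda>t. F' (t + 0) v) \<in> borel_measurable lborel" for v
      using meas by simp
    show "integrable lborel (\<lambda>t::'a. 2 ^ (2 * DIM('a)) * K * (1 / (1 + norm t) ^ (2 * DIM('a))))"
      by (intro integrable_mult_right integrable_inverse_power_norm)
    show "cmod (F' (t + z) v) \<le> 2 ^ (2 * DIM('a)) * K * (1 / (1 + norm t) ^ (2 * DIM('a))) * norm v"
      if z: "z \<in> ball 0 1" for t z v
    proof -
      have pos: "1 + norm t > 0" "1 + norm (t + z) > 0"
        by (auto intro: add_pos_nonneg)
      have "1 + norm t \<le> 2 * (1 + norm (t + z))"
        using z norm_triangle_ineq4[of "t + z" z] norm_ge_zero[of "t + z"] by (simp, linarith)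
      hence "(1 + norm t) ^ (2 * DIM('a)) \<le> 2 ^ (2 * DIM('a)) * (1 + norm (t + z)) ^ (2 * DIM('a))"
        unfolding power_mult_distrib[symmetric] by (rule power_mono) auto
      hence "1 / (1 + norm (t + z)) ^ (2 * DIM('a)) \<le> 2 ^ (2 * DIM('a)) * (1 / (1 + norm t) ^ (2 * DIM('a)))"
        using pos by (simp add: field_simps)
      hence "K * (1 / (1 + norm (t + z)) ^ (2 * DIM('a))) * norm v
        \<le> K * (2 ^ (2 * DIM('a)) * (1 / (1 + norm t) ^ (2 * DIM('a)))) * norm v"
        using K by (intro mult_right_mono mult_left_mono) auto
      with bound[of "t + z" v] show ?thesis
        by (simp add: mult_ac)
    qed
  qed
  moreover have "((\<lambda>z. LINT t|lborel. F (t + z)) has_derivative (\<lambda>v. 0)) (at 0)"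
    by (simp add: integral_lborel_translate[OF F])
  ultimately have "(\<lambda>v. LINT t|lborel. F' (t + 0) v) = (\<lambda>v. 0)"
    by (rule has_derivative_unique)
  thus ?thesis
    by (metis (no_types, lifting) Bochner_Integration.integral_cong add.right_neutral)
qed


section \<open>Phase space coordinates\<close>

text \<open>The inverse of \<open>z \<mapsto> (pos z, freq z)\<close>; it identifies phase space with a product, also as a measure space.\<close>

definition phase_point :: "real ^ 'd::finite \<Rightarrow> real ^ 'd \<Rightarrow> real ^ ('d + 'd)" where
  "phase_point x t = (\<chi> i. case i of Inl a \<Rightarrow> x $ a | Inr a \<Rightarrow> t $ a)"

lemma pos_phase_point [simp]: "pos (phase_point x t) = x" and freq_phase_point [simp]: "freq (phase_point x t) = t"
  by (simp_all add: pos_def freq_def phase_point_def vec_eq_iff)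

lemma phase_point_pos_freq [simp]: "phase_point (pos z) (freq z) = z"
  by (simp add: pos_def freq_def phase_point_def vec_eq_iff split: sum.split)

lemma sum_UNIV_Plus: "(\<Sum>i\<in>UNIV. f i) = (\<Sum>a\<in>UNIV. f (Inl a)) + (\<Sum>a\<in>UNIV. f (Inr a))"
  for f :: "'c::finite + 'd::finite \<Rightarrow> 'e::comm_monoid_add"
  unfolding UNIV_Plus_UNIV[symmetric] by (subst sum.Plus) (auto simp: o_def)

lemma inner_pos_freq: "z \<bullet> w = pos z \<bullet> pos w + freq z \<bullet> freq w"
  for z w :: "real ^ ('d::finite + 'd)"
  by (simp add: inner_vec_def sum_UNIV_Plus pos_def freq_def)

lemma bounded_linear_pos: "bounded_linear pos"
  by (intro linear_conv_bounded_linear[THEN iffD1] linearI) (auto simp: pos_def vec_eq_iff)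

lemma bounded_linear_freq: "bounded_linear freq"
  by (intro linear_conv_bounded_linear[THEN iffD1] linearI) (auto simp: freq_def vec_eq_iff)

lemma phase_point_add: "phase_point (x + y) (s + t) = phase_point x s + phase_point y t"
  by (simp add: phase_point_def vec_eq_iff split: sum.split)

lemma phase_point_scaleR: "phase_point (c *\<^sub>R x) (c *\<^sub>R t) = c *\<^sub>R phase_point x t"
  by (simp add: phase_point_def vec_eq_iff split: sum.split)

lemma bounded_linear_phase_point: "bounded_linear (\<lambda>p. phase_point (fst p) (snd p))"
  by (intro linear_conv_bounded_linear[THEN iffD1] linearI) (auto simp: phase_point_add phase_point_scaleR)

lemma norm_pos_le: "norm (pos z) \<le> norm z" and norm_freq_le: "norm (freq z) \<le> norm z"
  by (auto simp: norm_eq_sqrt_inner inner_pos_freq)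

lemma norm_phase_point_le: "norm (phase_point x t) \<le> norm x + norm t"
  unfolding norm_eq_sqrt_inner inner_pos_freq pos_phase_point freq_phase_point
  by (rule sqrt_add_le_add_sqrt) auto

lemma norm_le_phase_point_right: "norm t \<le> norm (phase_point x t)"
  using norm_freq_le[of "phase_point x t"] by simp

lemma prod_Basis_cart: "(\<Prod>b\<in>Basis. f b) = (\<Prod>i\<in>UNIV. f (axis i 1))"
  for f :: "real ^ 'n::finite \<Rightarrow> 'e::comm_monoid_mult"
proof -
  have "(Basis :: (real ^ 'n) set) = range (\<lambda>i. axis i 1)"
    by (auto simp: Basis_vec_def)
  thus ?thesis
    by (metis (no_types, lifting) axis_eq_axis injI o_apply prod.cong prod.reindex zero_neq_one)
qed

lemma prod_UNIV_Plus: "(\<Prod>i\<in>UNIV. f i) = (\<Prod>a\<in>UNIV. f (Inl a)) * (\<Prod>a\<in>UNIV. f (Inr a))"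
  for f :: "'c::finite + 'd::finite \<Rightarrow> 'e::comm_monoid_mult"
  unfolding UNIV_Plus_UNIV[symmetric] by (subst prod.Plus) (auto simp: o_def)

lemma continuous_on_phase_point [continuous_intros]:
  assumes "continuous_on S f" "continuous_on S g"
  shows "continuous_on S (\<lambda>x. phase_point (f x) (g x))"
  using bounded_linear.continuous_on[OF bounded_linear_phase_point continuous_on_Pair[OF assms]] by simp

lemma continuous_on_pos [continuous_intros]:
  "continuous_on S f \<Longrightarrow> continuous_on S (\<lambda>x. pos (f x))"
  by (rule bounded_linear.continuous_on[OF bounded_linear_pos])

lemma continuous_on_freq [continuous_intros]:
  "continuous_on S f \<Longrightarrow> continuous_on S (\<lambda>x. freq (f x))"
  by (rule bounded_linear.continuous_on[OF bounded_linear_freq])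

lemma phase_point_measurable: "(\<lambda>p. phase_point (fst p) (snd p)) \<in> borel_measurable borel"
  by (intro borel_measurable_continuous_onI continuous_intros)

lemma lborel_phase_point:
  "distr (lborel \<Otimes>\<^sub>M lborel) borel (\<lambda>p. phase_point (fst p) (snd p)) = (lborel :: (real ^ ('d::finite + 'd)) measure)"
proof (rule lborel_eqI[symmetric])
  fix l u :: "real ^ ('d + 'd)"
  assume le: "\<And>b. b \<in> Basis \<Longrightarrow> l \<bullet> b \<le> u \<bullet> b"
  have le': "l $ i \<le> u $ i" for i
    using le[of "axis i 1"] by (simp add: inner_axis axis_in_Basis_iff)
  have vim: "(\<lambda>p. phase_point (fst p) (snd p)) -` box l u = box (pos l) (pos u) \<times> box (freq l) (freq u)"
    by (auto simp: mem_box_cart pos_def freq_def phase_point_def split: sum.split_asm sum.split)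
  have "emeasure (distr (lborel \<Otimes>\<^sub>M lborel) borel (\<lambda>p. phase_point (fst p) (snd p))) (box l u) =
     emeasure (lborel \<Otimes>\<^sub>M lborel) (box (pos l) (pos u) \<times> box (freq l) (freq u))"
    using phase_point_measurable by (subst emeasure_distr) (auto simp: lborel_prod vim)
  also have "\<dots> = emeasure lborel (box (pos l) (pos u)) * emeasure lborel (box (freq l) (freq u))"
    by (rule lborel.emeasure_pair_measure_Times) auto
  also have "emeasure lborel (box (pos l) (pos u)) = (\<Prod>b\<in>Basis. (pos u - pos l) \<bullet> b)"
    by (subst emeasure_lborel_box) (auto simp: pos_def Basis_vec_def inner_axis le')
  also have "emeasure lborel (box (freq l) (freq u)) = (\<Prod>b\<in>Basis. (freq u - freq l) \<bullet> b)"
    by (subst emeasure_lborel_box) (auto simp: freq_def Basis_vec_def inner_axis le')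
  finally show "emeasure (distr (lborel \<Otimes>\<^sub>M lborel) borel (\<lambda>p. phase_point (fst p) (snd p))) (box l u) = (\<Prod>b\<in>Basis. (u - l) \<bullet> b)"
    by (simp add: prod_Basis_cart prod_UNIV_Plus inner_axis pos_def freq_def ennreal_mult prod_nonneg le')
qed auto

lemma integral_phase_point:
  fixes f :: "real ^ ('d::finite + 'd) \<Rightarrow> 'b::{banach,second_countable_topology}"
  assumes "integrable lborel f"
  shows "(LINT z|lborel. f z) = (LINT x|lborel. (LINT t|lborel. f (phase_point x t)))"
proof -
  have meas: "f \<in> borel_measurable borel"
    using borel_measurable_integrable[OF assms] by simp
  have m: "(\<lambda>p. phase_point (fst p) (snd p)) \<in> (lborel :: (real ^ 'd) measure) \<Otimes>\<^sub>M lborel \<rightarrow>\<^sub>M borel"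
    using phase_point_measurable by (simp add: lborel_prod)
  have "integrable (lborel \<Otimes>\<^sub>M lborel) (\<lambda>p. f (phase_point (fst p) (snd p)))"
    using assms by (subst integrable_distr_eq[OF m meas, symmetric]) (simp add: lborel_phase_point)
  hence "(LINT x|lborel. (LINT t|lborel. f (phase_point x t))) = (LINT p|(lborel \<Otimes>\<^sub>M lborel). f (phase_point (fst p) (snd p)))"
    using lborel_pair.integral_fst'[of "\<lambda>p. f (phase_point (fst p) (snd p))"] by simp
  also have "\<dots> = (LINT z|lborel. f z)"
    by (subst integral_distr[OF m meas, symmetric]) (simp add: lborel_phase_point)
  finally show ?thesis ..
qed

section \<open>The partial Fourier transform\<close>

text \<open>The (inverse) Fourier transform in the second variable of a function \<open>H(x, t)\<close>. The sign is the one that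
occurs in \<open>wigner_tau\<close>.\<close>

definition partial_fourier :: "(real ^ ('d::finite + 'd) \<Rightarrow> complex) \<Rightarrow> real ^ ('d + 'd) \<Rightarrow> complex" where
  "partial_fourier H z = (LINT t|lborel. wave (freq z) t * H (phase_point (pos z) t))"

lemma partial_fourier_kernel_integrable:
  assumes "H \<in> schwartz"
  shows "integrable lborel (\<lambda>t. wave \<omega> t * H (phase_point x t))"
proof (rule integrable_rapidly_decreasing)
  show "(\<lambda>t. wave \<omega> t * H (phase_point x t)) \<in> borel_measurable borel"
    by (intro borel_measurable_continuous_onI continuous_intros
        continuous_on_compose2[OF schwartz_continuous[OF assms]]) auto
  show "rapidly_decreasing (\<lambda>t. wave \<omega> t * H (phase_point x t))"
  proof (rule rapidly_decreasingI)
    fix n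
    obtain K where K: "\<And>z. (1 + norm z) ^ n * cmod (H z) \<le> K"
      using schwartz_rapidly_decreasing[OF assms] unfolding rapidly_decreasing_def by blast
    have "(1 + norm t) ^ n * cmod (wave \<omega> t * H (phase_point x t)) \<le> K" for t
    proof -
      have "(1 + norm t) ^ n * cmod (H (phase_point x t)) \<le> (1 + norm (phase_point x t)) ^ n * cmod (H (phase_point x t))"
        using norm_le_phase_point_right[of t x] by (intro mult_right_mono power_mono) auto
      also have "\<dots> \<le> K"
        by (rule K)
      finally show ?thesis
        by (simp add: norm_mult)
    qed
    thus "\<exists>K. \<forall>t. (1 + norm t) ^ n * cmod (wave \<omega> t * H (phase_point x t)) \<le> K"
      by blast
  qed
qed

lemma partial_fourier_add:
  assumes "H \<in> schwartz" "G \<in> schwartz"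
  shows "partial_fourier (\<lambda>w. H w + G w) z = partial_fourier H z + partial_fourier G z"
  unfolding partial_fourier_def
  using assms by (simp add: ring_distribs partial_fourier_kernel_integrable)

lemma partial_fourier_bounded:
  assumes "H \<in> schwartz"
  obtains K where "\<And>z. cmod (partial_fourier H z) \<le> K"
proof -
  let ?m = "2 * DIM(real ^ 'a)"
  obtain K where K: "K \<ge> 0" "\<And>z. cmod (H z) \<le> K / (1 + norm z) ^ ?m"
    using rapidly_decreasingE[OF schwartz_rapidly_decreasing[OF assms], where n = ?m] by metis
  have "cmod (partial_fourier H z) \<le> (LINT t::real^'a|lborel. K * (1 / (1 + norm t) ^ ?m))" for z
  proof -
    have "cmod (partial_fourier H z) \<le> (LINT t|lborel. cmod (wave (freq z) t * H (phase_point (pos z) t)))"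
      unfolding partial_fourier_def by (rule integral_norm_bound)
    also have "\<dots> \<le> (LINT t::real^'a|lborel. K * (1 / (1 + norm t) ^ ?m))"
    proof (rule integral_mono)
      fix t :: "real ^ 'a"
      have "cmod (H (phase_point (pos z) t)) \<le> K / (1 + norm (phase_point (pos z) t)) ^ ?m"
        by (rule K)
      also have "\<dots> \<le> K / (1 + norm t) ^ ?m"
        using norm_le_phase_point_right[of t "pos z"] K
        by (intro divide_left_mono power_mono mult_pos_pos zero_less_power add_pos_nonneg) auto
      finally show "cmod (wave (freq z) t * H (phase_point (pos z) t)) \<le> K * (1 / (1 + norm t) ^ ?m)"
        by (simp add: norm_mult)
    qed (intro integrable_norm partial_fourier_kernel_integrable assms integrable_mult_right integrable_inverse_power_norm)+
    finally show ?thesis .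
  qed
  thus ?thesis
    using that by blast
qed

lemma has_derivative_phase_point_left: "((\<lambda>z. phase_point (pos z) t) has_derivative (\<lambda>v. phase_point (pos v) 0)) (at z)"
proof -
  have eq: "phase_point (pos z) t = phase_point (pos z) 0 + phase_point 0 t" for z
    using phase_point_add[of "pos z" 0 0 t] by simp
  have "bounded_linear (\<lambda>z. phase_point (pos z) 0)"
    using bounded_linear_compose[OF bounded_linear_phase_point bounded_linear_Pair[OF bounded_linear_pos bounded_linear_zero]] by simp
  thus ?thesis
    by (subst eq) (auto intro!: derivative_eq_intros bounded_linear_imp_has_derivative)
qed

lemma has_derivative_phase_point_right: "((\<lambda>t. phase_point x t) has_derivative (\<lambda>v. phase_point 0 v)) (at t)"
proof -
  have eq: "phase_point x t = phase_point 0 t + phase_point x 0" for t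
    using phase_point_add[of 0 x t 0] by simp
  have "bounded_linear (\<lambda>t. phase_point 0 t)"
    using bounded_linear_compose[OF bounded_linear_phase_point bounded_linear_Pair[OF bounded_linear_zero bounded_linear_ident]] by simp
  thus ?thesis
    by (subst eq) (auto intro!: derivative_eq_intros bounded_linear_imp_has_derivative)
qed

lemma has_derivative_cis_freq:
  "((\<lambda>z. wave (freq z) t) has_derivative
    (\<lambda>v. (2 * pi * (freq v \<bullet> t)) *\<^sub>R (\<i> * wave (freq z) t))) (at z)"
  by (rule derivative_eq_intros bounded_linear_imp_has_derivative[OF bounded_linear_freq] refl | simp)+

text \<open>The derivatives of the kernel \<open>exp (2\<pi>i \<omega> \<bullet> t) H(x, t)\<close> with respect to \<open>(x, \<omega>)\<close> and with respect to \<open>t\<close>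
both have the shape estimated here. In the first one the exponential contributes a factor
\<open>\<bar>t\<bar>\<close>, hence the growth allowed for \<open>c\<close>.\<close>

lemma partial_fourier_kernel_derivative_bound:
  fixes H :: "real ^ ('d::finite + 'd) \<Rightarrow> complex"
  assumes "H \<in> schwartz"
  obtains K where "K \<ge> 0"
    "\<And>e x t p c a b. cmod e = 1 \<Longrightarrow> norm p \<le> b \<Longrightarrow> \<bar>c\<bar> \<le> a * (1 + norm t) \<Longrightarrow> a \<ge> 0 \<Longrightarrow>
      cmod (e * frechet_derivative H (at (phase_point x t)) p + (2 * pi * c) *\<^sub>R (\<i> * e) * H (phase_point x t))
        \<le> K * (a + b) / (1 + norm t) ^ (2 * CARD('d))"
proof -
  let ?m = "2 * CARD('d)"
  obtain K1 where K1: "K1 \<ge> 0" "\<And>z. cmod (H z) \<le> K1 / (1 + norm z) ^ Suc ?m"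
    using rapidly_decreasingE[OF schwartz_rapidly_decreasing[OF assms], where n = "Suc ?m"] by metis
  obtain K2 where K2: "K2 \<ge> 0" "\<And>z v. cmod (frechet_derivative H (at z) v) \<le> K2 / (1 + norm z) ^ ?m * norm v"
    using schwartz_derivative_bound[OF assms, where n = ?m] by metis
  have "cmod (e * frechet_derivative H (at (phase_point x t)) p + (2 * pi * c) *\<^sub>R (\<i> * e) * H (phase_point x t))
      \<le> (K2 + 2 * pi * K1) * (a + b) / (1 + norm t) ^ ?m"
    if e: "cmod e = 1" and p: "norm p \<le> b" and c: "\<bar>c\<bar> \<le> a * (1 + norm t)" and a: "a \<ge> 0" for e x t p c a b
  proof -
    let ?w = "phase_point x t"
    have tw: "norm t \<le> norm ?w"
      by (rule norm_le_phase_point_right)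
    have pos: "1 + norm t > 0"
      by (auto intro: add_pos_nonneg)
    have b: "b \<ge> 0"
      using p norm_ge_zero order_trans by blast
    have decay: "k / (1 + norm ?w) ^ n \<le> k / (1 + norm t) ^ n" if "k \<ge> 0" for k n
      using tw that by (intro divide_left_mono power_mono mult_pos_pos zero_less_power add_pos_nonneg) auto
    have "cmod (frechet_derivative H (at ?w) p) \<le> K2 / (1 + norm t) ^ ?m * b"
      using K2 b by (intro order_trans[OF K2(2)] mult_mono decay p) auto
    moreover have "\<bar>c\<bar> * cmod (H ?w) \<le> a * (1 + norm t) * (K1 / (1 + norm t) ^ Suc ?m)"
      using a pos by (intro mult_mono c order_trans[OF K1(2)] decay K1(1)) auto
    hence "\<bar>c\<bar> * cmod (H ?w) \<le> K1 / (1 + norm t) ^ ?m * a"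
      using pos by (simp add: mult_ac)
    ultimately have "cmod (frechet_derivative H (at ?w) p) + 2 * pi * (\<bar>c\<bar> * cmod (H ?w))
        \<le> K2 / (1 + norm t) ^ ?m * b + 2 * pi * (K1 / (1 + norm t) ^ ?m * a)"
      by (intro add_mono mult_left_mono) auto
    also have "\<dots> \<le> K2 / (1 + norm t) ^ ?m * (a + b) + 2 * pi * (K1 / (1 + norm t) ^ ?m * (a + b))"
      using a b K1(1) K2(1) pos by (intro add_mono mult_left_mono) auto
    also have "\<dots> = (K2 + 2 * pi * K1) * (a + b) / (1 + norm t) ^ ?m"
      by (simp add: add_divide_distrib ring_distribs mult_ac)
    finally show ?thesis
      by (intro order_trans[OF norm_triangle_ineq]) (simp add: norm_mult abs_mult e)
  qed
  thus ?thesis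
    using that[of "K2 + 2 * pi * K1"] K1(1) K2(1) by simp
qed

text \<open>The derivative is again the partial transform of a Schwartz function: a position derivative falls on \<open>H\<close>, a
frequency derivative multiplies \<open>H\<close> by a coordinate of \<open>t\<close>.\<close>

lemma partial_fourier_has_derivative:
  assumes "H \<in> schwartz"
  shows "(partial_fourier H has_derivative
     (\<lambda>v. partial_fourier (\<lambda>w. (2 * pi * \<i>) * (complex_of_real (w \<bullet> phase_point 0 (freq v)) * H w)
        + frechet_derivative H (at w) (phase_point (pos v) 0)) z)) (at z)"
proof -
  define K' where "K' = (\<lambda>(z::real^('a+'a)) t v. wave (freq z) t *
      frechet_derivative H (at (phase_point (pos z) t)) (phase_point (pos v) 0) +
      (2 * pi * (freq v \<bullet> t)) *\<^sub>R (\<i> * wave (freq z) t) * H (phase_point (pos z) t))"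
  obtain K where K: "K \<ge> 0"
    "\<And>e x t p c a b. cmod e = 1 \<Longrightarrow> norm p \<le> b \<Longrightarrow> \<bar>c\<bar> \<le> a * (1 + norm t) \<Longrightarrow> a \<ge> 0 \<Longrightarrow>
      cmod (e * frechet_derivative H (at (phase_point x t)) p + (2 * pi * c) *\<^sub>R (\<i> * e) * H (phase_point x t))
        \<le> K * (a + b) / (1 + norm t) ^ (2 * CARD('a))"
    using partial_fourier_kernel_derivative_bound[OF assms] by blast
  have eq: "K' z t v = wave (freq z) t * ((2 * pi * \<i>) * (complex_of_real (phase_point (pos z) t \<bullet> phase_point 0 (freq v)) * H (phase_point (pos z) t))
        + frechet_derivative H (at (phase_point (pos z) t)) (phase_point (pos v) 0))" for z t v
    unfolding K'_def inner_pos_freq pos_phase_point freq_phase_point by (simp add: algebra_simps scaleR_conv_of_real inner_commute)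
  have "((\<lambda>z. LINT t|lborel. wave (freq z) t * H (phase_point (pos z) t)) has_derivative
      (\<lambda>v. LINT t|lborel. K' z t v)) (at z)"
  proof (rule has_derivative_integral)
    show "integrable lborel (\<lambda>t. wave (freq z) t * H (phase_point (pos z) t))" for z
      by (rule partial_fourier_kernel_integrable[OF assms])
    show "((\<lambda>z. wave (freq z) t * H (phase_point (pos z) t)) has_derivative K' z t) (at z)" for z t
      unfolding K'_def
      by (intro has_derivative_mult has_derivative_cis_freq
          has_derivative_compose[OF has_derivative_phase_point_left schwartz_has_derivative[OF assms]])
    have "(\<lambda>t. K' z t v) \<in> borel_measurable borel" for v
      unfolding K'_def
      by (intro borel_measurable_continuous_onI continuous_intros
          continuous_on_compose2[OF schwartz_continuous[OF assms]]
          continuous_on_compose2[OF schwartz_continuous[OF schwartz_derivative[OF assms]]]) auto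
    thus "(\<lambda>t. K' z t v) \<in> borel_measurable lborel" for v
      by simp
    have "integrable lborel (\<lambda>t::real^'a. 2 * K * (1 / (1 + norm t) ^ (2 * DIM(real ^ 'a))))"
      by (intro integrable_mult_right integrable_inverse_power_norm)
    thus "integrable lborel (\<lambda>t::real^'a. 2 * K / (1 + norm t) ^ (2 * CARD('a)))"
      by simp
    show "cmod (K' z t v) \<le> 2 * K / (1 + norm t) ^ (2 * CARD('a)) * norm v" for z t v
    proof -
      have "norm (phase_point (pos v) 0) \<le> norm v"
        using norm_phase_point_le[of "pos v" 0] norm_pos_le[of v] by simp
      moreover have "\<bar>freq v \<bullet> t\<bar> \<le> norm v * (1 + norm t)"
        by (rule order_trans[OF Cauchy_Schwarz_ineq2]) (intro mult_mono norm_freq_le, auto)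
      ultimately have "cmod (K' z t v) \<le> K * (norm v + norm v) / (1 + norm t) ^ (2 * CARD('a))"
        unfolding K'_def by (intro K(2)) auto
      thus ?thesis
        by (simp add: mult_ac)
    qed
  qed
  thus ?thesis
    unfolding partial_fourier_def[abs_def] eq .
qed

lemma partial_fourier_pos_mult:
  "complex_of_real (pos z \<bullet> y) * partial_fourier H z = partial_fourier (\<lambda>w. complex_of_real (w \<bullet> phase_point y 0) * H w) z"
proof -
  have "complex_of_real (pos z \<bullet> y) * partial_fourier H z =
    (LINT t|lborel. complex_of_real (pos z \<bullet> y) * (wave (freq z) t * H (phase_point (pos z) t)))"
    unfolding partial_fourier_def by simp
  thus ?thesis
    unfolding partial_fourier_def inner_pos_freq pos_phase_point freq_phase_point by (simp add: mult_ac)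
qed

text \<open>Integration by parts: the total derivative of the kernel in the direction \<open>y\<close> of the variable \<open>t\<close> integrates to
zero.\<close>

lemma partial_fourier_freq_mult:
  assumes "H \<in> schwartz"
  shows "complex_of_real (freq z \<bullet> y) * partial_fourier H z =
    partial_fourier (\<lambda>w. (\<i> / (2 * pi)) * frechet_derivative H (at w) (phase_point 0 y)) z"
proof -
  define x where "x = pos z"
  define \<omega> where "\<omega> = freq z"
  define F where "F = (\<lambda>t. wave \<omega> t * H (phase_point x t))"
  define F' where "F' = (\<lambda>t v. wave \<omega> t * frechet_derivative H (at (phase_point x t)) (phase_point 0 v) +
      (2 * pi * (\<omega> \<bullet> v)) *\<^sub>R (\<i> * wave \<omega> t) * H (phase_point x t))"
  obtain K where K: "K \<ge> 0"
    "\<And>e x t p c a b. cmod e = 1 \<Longrightarrow> norm p \<le> b \<Longrightarrow> \<bar>c\<bar> \<le> a * (1 + norm t) \<Longrightarrow> a \<ge> 0 \<Longrightarrow>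
      cmod (e * frechet_derivative H (at (phase_point x t)) p + (2 * pi * c) *\<^sub>R (\<i> * e) * H (phase_point x t))
        \<le> K * (a + b) / (1 + norm t) ^ (2 * CARD('a))"
    using partial_fourier_kernel_derivative_bound[OF assms] by blast
  have int: "integrable lborel (\<lambda>t. wave \<omega> t * G (phase_point x t))" if "G \<in> schwartz" for G
    by (rule partial_fourier_kernel_integrable[OF that])
  have "(LINT t|lborel. F' t y) = 0"
  proof (rule integral_directional_derivative)
    show "(F has_derivative F' t) (at t)" for t
      unfolding F_def F'_def
      by (intro has_derivative_mult has_derivative_cis_inner
          has_derivative_compose[OF has_derivative_phase_point_right schwartz_has_derivative[OF assms]])
    show "integrable lborel F"
      unfolding F_def by (rule int[OF assms])
    show "(\<lambda>t. F' t v) \<in> borel_measurable borel" for v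
      unfolding F'_def
      by (intro borel_measurable_continuous_onI continuous_intros
          continuous_on_compose2[OF schwartz_continuous[OF assms]]
          continuous_on_compose2[OF schwartz_continuous[OF schwartz_derivative[OF assms]]]) auto
    show "cmod (F' t v) \<le> K * (norm \<omega> + 1) / (1 + norm t) ^ (2 * DIM(real ^ 'a)) * norm v" for t v
    proof -
      have "norm (phase_point 0 v) \<le> norm v"
        using norm_phase_point_le[of 0 v] by simp
      moreover have "\<bar>\<omega> \<bullet> v\<bar> \<le> norm \<omega> * norm v * (1 + norm t)"
        by (rule order_trans[OF Cauchy_Schwarz_ineq2]) (simp add: distrib_left)
      ultimately have "cmod (F' t v) \<le> K * (norm \<omega> * norm v + norm v) / (1 + norm t) ^ (2 * CARD('a))"
        unfolding F'_def by (intro K(2)) auto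
      thus ?thesis
        by (simp add: algebra_simps add_divide_distrib)
    qed
  qed
  moreover have "(LINT t|lborel. F' t y) =
      (LINT t|lborel. wave \<omega> t * frechet_derivative H (at (phase_point x t)) (phase_point 0 y)) +
      (LINT t|lborel. (2 * pi * (\<omega> \<bullet> y) * \<i>) * (wave \<omega> t * H (phase_point x t)))"
    by (subst Bochner_Integration.integral_add[OF int[OF schwartz_derivative[OF assms]]
          integrable_mult_right[OF int[OF assms]], symmetric])
      (simp add: F'_def scaleR_conv_of_real mult_ac)
  ultimately have "(LINT t|lborel. wave \<omega> t * frechet_derivative H (at (phase_point x t)) (phase_point 0 y)) +
      (2 * pi * (\<omega> \<bullet> y) * \<i>) * (LINT t|lborel. wave \<omega> t * H (phase_point x t)) = 0"
    by simp
  moreover have "a + (2 * pi * (\<omega> \<bullet> y) * \<i>) * c = 0 \<Longrightarrow> complex_of_real (\<omega> \<bullet> y) * c = (\<i> / (2 * pi)) * a" for a c :: complex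
  proof -
    assume "a + (2 * pi * (\<omega> \<bullet> y) * \<i>) * c = 0"
    hence "a = - ((2 * pi * (\<omega> \<bullet> y) * \<i>) * c)"
      by (simp add: add_eq_0_iff)
    thus ?thesis
      by (simp add: mult.left_commute[of \<i> "complex_of_real _"])
  qed
  ultimately have "complex_of_real (\<omega> \<bullet> y) * (LINT t|lborel. wave \<omega> t * H (phase_point x t)) =
    (\<i> / (2 * pi)) * (LINT t|lborel. wave \<omega> t * frechet_derivative H (at (phase_point x t)) (phase_point 0 y))"
    by blast
  also have "\<dots> = (LINT t|lborel. (\<i> / (2 * pi)) * (wave \<omega> t * frechet_derivative H (at (phase_point x t)) (phase_point 0 y)))"
    by (rule integral_mult_right_zero[symmetric])
  finally show ?thesis
    unfolding partial_fourier_def x_def \<omega>_def by (simp add: mult_ac)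
qed

text \<open>Partial transforms of Schwartz functions are bounded, and they stay partial transforms of Schwartz
functions when they are multiplied by a coordinate. Since \<open>1 + \<bar>z\<bar> \<le> 1 + \<Sum>b. \<bar>z \<bullet> b\<bar>\<close>, each
such multiplication gains one power of decay.\<close>

lemma partial_fourier_rapidly_decreasing:
  assumes "H \<in> schwartz"
  shows "rapidly_decreasing (partial_fourier H)"
proof (rule rapidly_decreasingI)
  fix n
  have coord: "\<exists>G\<in>schwartz. \<forall>z. complex_of_real (z \<bullet> b) * partial_fourier H z = partial_fourier G z"
    if "H \<in> schwartz" for H and b :: "real ^ ('a + 'a)"
  proof
    let ?G1 = "\<lambda>w. complex_of_real (w \<bullet> phase_point (pos b) 0) * H w"
    let ?G2 = "\<lambda>w. (\<i> / (2 * pi)) * frechet_derivative H (at w) (phase_point 0 (freq b))"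
    have G: "?G1 \<in> schwartz" "?G2 \<in> schwartz"
      by (intro schwartz_coordinate_mult schwartz_cmult schwartz_derivative that)+
    thus "(\<lambda>w. ?G1 w + ?G2 w) \<in> schwartz"
      by (rule schwartz_add)
    show "\<forall>z. complex_of_real (z \<bullet> b) * partial_fourier H z = partial_fourier (\<lambda>w. ?G1 w + ?G2 w) z"
      unfolding partial_fourier_add[OF G] partial_fourier_pos_mult[symmetric]
        partial_fourier_freq_mult[OF that, symmetric] inner_pos_freq[of _ b] by (simp add: ring_distribs)
  qed
  show "\<exists>K. \<forall>z. (1 + norm z) ^ n * cmod (partial_fourier H z) \<le> K"
    using assms
  proof (induction n arbitrary: H)
    case 0
    then show ?case
      using partial_fourier_bounded by (metis mult_1 power_0)
  next
    case (Suc n)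
    obtain G where G: "\<And>b. G b \<in> schwartz"
      "\<And>b z. complex_of_real (z \<bullet> b) * partial_fourier H z = partial_fourier (G b) z"
      using coord[OF Suc.prems] by metis
    obtain K0 where K0: "\<And>z. (1 + norm z) ^ n * cmod (partial_fourier H z) \<le> K0"
      using Suc by blast
    obtain K where K: "\<And>b z. (1 + norm z) ^ n * cmod (partial_fourier (G b) z) \<le> K b"
      using Suc.IH[OF G(1)] by metis
    have "(1 + norm z) ^ Suc n * cmod (partial_fourier H z) \<le> K0 + sum K Basis" for z
    proof -
      have "(1 + norm z) ^ Suc n * cmod (partial_fourier H z) =
          (1 + norm z) * ((1 + norm z) ^ n * cmod (partial_fourier H z))"
        by simp
      also have "\<dots> \<le> (1 + (\<Sum>b\<in>Basis. \<bar>z \<bullet> b\<bar>)) * ((1 + norm z) ^ n * cmod (partial_fourier H z))"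
        using norm_le_l1[of z] by (intro mult_right_mono) auto
      also have "\<dots> = (1 + norm z) ^ n * cmod (partial_fourier H z) +
          (\<Sum>b\<in>Basis. (1 + norm z) ^ n * cmod (partial_fourier (G b) z))"
        unfolding G(2)[symmetric] norm_mult norm_of_real
        by (simp add: algebra_simps sum_distrib_left)
      also have "\<dots> \<le> K0 + sum K Basis"
        by (intro add_mono K0 sum_mono K)
      finally show ?thesis .
    qed
    then show ?case
      by blast
  qed
qed

lemma partial_fourier_schwartz:
  assumes "H \<in> schwartz"
  shows "partial_fourier H \<in> schwartz"
proof -
  have "partial_fourier ` schwartz \<subseteq> (schwartz :: (real ^ ('a + 'a) \<Rightarrow> complex) set)"
  proof (rule schwartz_coinduct)
    fix f :: "real ^ ('a + 'a) \<Rightarrow> complex"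
    assume "f \<in> partial_fourier ` schwartz"
    then obtain H where f: "f = partial_fourier H" and H: "H \<in> schwartz"
      by blast
    show "f differentiable (at z)" for z
      unfolding f using partial_fourier_has_derivative[OF H] differentiable_def by blast
    show "rapidly_decreasing f"
      unfolding f by (rule partial_fourier_rapidly_decreasing[OF H])
    show "(\<lambda>z. frechet_derivative f (at z) b) \<in> partial_fourier ` schwartz" for b
      unfolding f frechet_derivative_at[OF partial_fourier_has_derivative[OF H], symmetric]
      by (intro imageI schwartz_add schwartz_cmult schwartz_coordinate_mult schwartz_derivative H)
  qed
  thus ?thesis
    using assms by blast
qed


section \<open>Fourier inversion\<close>

lemma gaussian_integrable_real: "integrable lborel (\<lambda>r::real. complex_of_real (exp (- pi * r\<^sup>2)) * cis (2 * pi * (y * r)))"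
proof (rule Bochner_Integration.integrable_bound)
  have "integrable lborel std_normal_density"
    by (rule integrable_normal_density) simp
  hence "integrable lborel (\<lambda>r. sqrt (2 * pi) * std_normal_density (0 + sqrt (2 * pi) * r))"
    by (intro integrable_mult_right lborel_integrable_real_affine) auto
  moreover have eq: "sqrt (2 * pi) * std_normal_density (0 + sqrt (2 * pi) * r) = exp (- pi * r\<^sup>2)" for r
    by (simp add: std_normal_density_def power_mult_distrib)
  ultimately show "integrable lborel (\<lambda>r. exp (- pi * r\<^sup>2))"
    by (simp only: eq)
  have "(\<lambda>r::real. complex_of_real (exp (- pi * r\<^sup>2)) * cis (2 * pi * (y * r))) \<in> borel_measurable borel"
    by (intro borel_measurable_continuous_onI continuous_intros)
  thus "(\<lambda>r::real. complex_of_real (exp (- pi * r\<^sup>2)) * cis (2 * pi * (y * r))) \<in> borel_measurable lborel"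
    by simp
qed (auto simp: norm_mult)

text \<open>This is the characteristic function of the standard normal distribution at \<open>sqrt (2\<pi>) y\<close>, after the substitution
\<open>x = sqrt (2\<pi>) r\<close>.\<close>

lemma gaussian_fourier_real:
  "(LINT r|lborel. complex_of_real (exp (- pi * r\<^sup>2)) * cis (2 * pi * (y * r))) = complex_of_real (exp (- pi * y\<^sup>2))"
proof -
  let ?c = "sqrt (2 * pi)"
  have c: "?c * ?c = 2 * pi"
    by simp
  have "complex_of_real (exp (- pi * y\<^sup>2)) = char std_normal_distribution (?c * y)"
    unfolding char_std_normal_distribution by (simp add: power_mult_distrib)
  also have "\<dots> = (LINT x|lborel. std_normal_density x *\<^sub>R iexp (?c * y * x))"
    unfolding char_def by (subst integral_density) auto
  also have "\<dots> = \<bar>?c\<bar> *\<^sub>R (LINT r|lborel. std_normal_density (0 + ?c * r) *\<^sub>R iexp (?c * y * (0 + ?c * r)))"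
    by (rule lborel_integral_real_affine) simp
  also have "\<dots> = (LINT r|lborel. \<bar>?c\<bar> *\<^sub>R (std_normal_density (0 + ?c * r) *\<^sub>R iexp (?c * y * (0 + ?c * r))))"
    unfolding scaleR_conv_of_real by (rule integral_mult_right_zero[symmetric])
  also have "\<dots> = (LINT r|lborel. complex_of_real (exp (- pi * r\<^sup>2)) * cis (2 * pi * (y * r)))"
  proof (rule Bochner_Integration.integral_cong[OF refl])
    fix r
    have "?c * std_normal_density (?c * r) = exp (- pi * r\<^sup>2)"
      by (simp add: std_normal_density_def power_mult_distrib)
    moreover have e: "?c * y * (0 + ?c * r) = 2 * pi * (y * r)"
      using c by (simp add: mult_ac)
    ultimately show "\<bar>?c\<bar> *\<^sub>R (std_normal_density (0 + ?c * r) *\<^sub>R iexp (?c * y * (0 + ?c * r)))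
        = complex_of_real (exp (- pi * r\<^sup>2)) * cis (2 * pi * (y * r))"
      unfolding e scaleR_scaleR by (simp add: scaleR_conv_of_real cis_conv_exp del: of_real_mult)
  qed
  finally show ?thesis ..
qed

definition gaussian :: "'a::euclidean_space \<Rightarrow> complex" where
  "gaussian x = complex_of_real (exp (- pi * (norm x)\<^sup>2))"

lemma gaussian_cis_eq_prod:
  "gaussian t * wave y t =
    (\<Prod>b\<in>Basis. complex_of_real (exp (- pi * (t \<bullet> b)\<^sup>2)) * cis (2 * pi * ((y \<bullet> b) * (t \<bullet> b))))"
proof -
  have n: "(norm t)\<^sup>2 = (\<Sum>b\<in>Basis. (t \<bullet> b)\<^sup>2)"
    by (subst power2_norm_eq_inner, subst euclidean_inner) (simp add: power2_eq_square)
  have "gaussian t = (\<Prod>b\<in>Basis. complex_of_real (exp (- pi * (t \<bullet> b)\<^sup>2)))"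
    unfolding gaussian_def n sum_distrib_left exp_sum[OF finite_Basis] by simp
  moreover have "wave y t = (\<Prod>b\<in>Basis. cis (2 * pi * ((y \<bullet> b) * (t \<bullet> b))))"
    unfolding euclidean_inner[of y t] cis_conv_exp sum_distrib_left of_real_sum exp_sum[OF finite_Basis] by simp
  ultimately show ?thesis
    by (simp add: prod.distrib)
qed

lemma gaussian_fourier_integrable: "integrable lborel (\<lambda>t. gaussian t * wave y t)"
  unfolding gaussian_cis_eq_prod by (intro integrable_lborel_prod gaussian_integrable_real)

lemma gaussian_fourier: "(LINT t|lborel. gaussian t * wave y t) = gaussian y"
  unfolding gaussian_cis_eq_prod integral_lborel_prod[OF gaussian_integrable_real] gaussian_fourier_real
  using gaussian_cis_eq_prod[of y 0] by simp

lemma gaussian_integrable: "integrable lborel gaussian" and gaussian_integral: "integral\<^sup>L lborel gaussian = 1"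
  using gaussian_fourier_integrable[of 0] gaussian_fourier[of 0] by (simp_all add: gaussian_def[abs_def])

lemma gaussian_measurable [measurable]: "gaussian \<in> borel_measurable borel"
  unfolding gaussian_def[abs_def] by measurable

lemma norm_gaussian_le_1: "cmod (gaussian x) \<le> 1"
  by (simp add: gaussian_def)

lemma lborel_scaleR:
  fixes f :: "'a::euclidean_space \<Rightarrow> complex"
  assumes [measurable]: "f \<in> borel_measurable borel" and c: "c > 0"
  shows integral_lborel_scaleR: "(LINT x|lborel. f x) = c ^ DIM('a) *\<^sub>R (LINT x|lborel. f (c *\<^sub>R x))"
    and integrable_lborel_scaleR: "integrable lborel f \<Longrightarrow> integrable lborel (\<lambda>x. f (c *\<^sub>R x))"
proof -
  let ?D = "distr lborel borel (\<lambda>x::'a. 0 + c *\<^sub>R x)"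
  have lb: "lborel = density ?D (\<lambda>_. ennreal (c ^ DIM('a)))"
    using c lborel_affine[of c 0] by simp
  have T: "(\<lambda>x::'a. 0 + c *\<^sub>R x) \<in> lborel \<rightarrow>\<^sub>M borel"
    by simp
  have "(LINT x|lborel. f x) = (LINT x|density ?D (\<lambda>_. ennreal (c ^ DIM('a))). f x)"
    using lb by simp
  also have "\<dots> = (LINT x|?D. (c ^ DIM('a)) *\<^sub>R f x)"
    by (rule integral_density) (use c in auto)
  also have "\<dots> = (LINT x|lborel. (c ^ DIM('a)) *\<^sub>R f (0 + c *\<^sub>R x))"
    by (rule integral_distr[OF T]) auto
  finally show "(LINT x|lborel. f x) = c ^ DIM('a) *\<^sub>R (LINT x|lborel. f (c *\<^sub>R x))"
    by simp
  assume "integrable lborel f"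
  hence "integrable (density ?D (\<lambda>_. ennreal (c ^ DIM('a)))) f"
    using lb by simp
  hence "integrable ?D (\<lambda>x. (c ^ DIM('a)) *\<^sub>R f x)"
    by (subst (asm) integrable_density) (use c in auto)
  hence "integrable lborel (\<lambda>x. (c ^ DIM('a)) *\<^sub>R f (0 + c *\<^sub>R x))"
    by (subst (asm) integrable_distr_eq[OF T]) auto
  hence "integrable lborel (\<lambda>x. (1 / c ^ DIM('a)) *\<^sub>R ((c ^ DIM('a)) *\<^sub>R f (0 + c *\<^sub>R x)))"
    by (rule integrable_scaleR_right)
  thus "integrable lborel (\<lambda>x. f (c *\<^sub>R x))"
    using c by simp
qed

text \<open>Damp the outer integral by a Gaussian of width \<open>r\<close>. Fubini and the self-duality of the Gaussian turn the
damped integral into an average of \<open>h\<close> over a Gaussian of width \<open>1 / r\<close>, which tends to \<open>h 0\<close>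
as \<open>r \<rightarrow> \<infinity>\<close>.\<close>

lemma fourier_inversion_at_0:
  fixes h :: "'a::euclidean_space \<Rightarrow> complex"
  assumes cont: "continuous_on UNIV h" and bound: "\<And>x. cmod (h x) \<le> B" and int: "integrable lborel h"
    and int': "integrable lborel (\<lambda>\<omega>. LINT t|lborel. wave \<omega> t * h t)"
  shows "(LINT \<omega>|lborel. (LINT t|lborel. wave \<omega> t * h t)) = h 0"
proof -
  define G where "G = (\<lambda>\<omega>. LINT t|lborel. wave \<omega> t * h t)"
  have G: "integrable lborel G"
    using int' by (simp add: G_def)
  have hm [measurable]: "h \<in> borel_measurable borel"
    by (intro borel_measurable_continuous_onI cont)
  define r where "r n = real (Suc n)" for n
  have r: "r n > 0" for n
    by (simp add: r_def)
  have lim0: "(\<lambda>n. x /\<^sub>R r n) \<longlonglongrightarrow> 0" for x :: 'a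
    using tendsto_scaleR[OF LIMSEQ_inverse_real_of_nat tendsto_const[of x]] by (simp add: r_def)
  have g_cont: "continuous_on UNIV (gaussian :: 'a \<Rightarrow> complex)"
    unfolding gaussian_def[abs_def] by (intro continuous_intros)
  have g0: "gaussian (0::'a) = 1"
    by (simp add: gaussian_def)
  \<comment> \<open>The damping factor, which tends to 1 pointwise.\<close>
  define a where "a n \<omega> = gaussian (\<omega> /\<^sub>R r n)" for n and \<omega> :: 'a
  have a_meas [measurable]: "a n \<in> borel_measurable borel" for n
    unfolding a_def by measurable
  have a_int: "integrable lborel (a n)" for n
    unfolding a_def using r[of n]
    by (intro integrable_lborel_scaleR gaussian_integrable gaussian_measurable) auto
  have lim_a: "(\<lambda>n. a n \<omega>) \<longlonglongrightarrow> 1" for \<omega>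
    unfolding a_def g0[symmetric]
    by (rule continuous_on_tendsto_compose[OF g_cont lim0]) auto
  have 1: "(\<lambda>n. LINT \<omega>|lborel. a n \<omega> * G \<omega>) \<longlonglongrightarrow> (LINT \<omega>|lborel. 1 * G \<omega>)"
  proof (rule integral_dominated_convergence)
    show "integrable lborel (\<lambda>\<omega>. cmod (G \<omega>))"
      using G by (rule integrable_norm)
    show "(\<lambda>\<omega>. 1 * G \<omega>) \<in> borel_measurable lborel" "(\<lambda>\<omega>. a n \<omega> * G \<omega>) \<in> borel_measurable lborel" for n
      using borel_measurable_integrable[OF G] by simp_all
    show "AE \<omega> in lborel. (\<lambda>n. a n \<omega> * G \<omega>) \<longlonglongrightarrow> 1 * G \<omega>"
      by (intro AE_I2 tendsto_mult lim_a tendsto_const)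
    show "AE \<omega> in lborel. cmod (a n \<omega> * G \<omega>) \<le> cmod (G \<omega>)" for n
      by (intro AE_I2) (auto simp: norm_mult a_def intro!: mult_left_le_one_le norm_gaussian_le_1)
  qed
  have 2: "(LINT \<omega>|lborel. a n \<omega> * G \<omega>) = (LINT u|lborel. h (u /\<^sub>R r n) * gaussian u)" for n
  proof -
    have "integrable (lborel \<Otimes>\<^sub>M lborel) (\<lambda>(\<omega>, t). a n \<omega> * (wave \<omega> t * h t))"
    proof (rule lborel_pair.Fubini_integrable)
      have "(\<lambda>p. wave (fst p) (snd p)) \<in> borel_measurable (borel :: ('a \<times> 'a) measure)"
        by (intro borel_measurable_continuous_onI continuous_intros)
      hence [measurable]: "(\<lambda>p. wave (fst p) (snd p)) \<in> borel_measurable (borel \<Otimes>\<^sub>M borel :: ('a \<times> 'a) measure)"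
        by (simp add: borel_prod)
      have "(\<lambda>p. a n (fst p) * (wave (fst p) (snd p) * h (snd p))) \<in> borel_measurable (borel \<Otimes>\<^sub>M borel)"
        by measurable
      thus "(\<lambda>(\<omega>, t). a n \<omega> * (wave \<omega> t * h t)) \<in> borel_measurable (lborel \<Otimes>\<^sub>M lborel)"
        by (simp add: split_beta')
      have "integrable lborel (\<lambda>\<omega>. cmod (a n \<omega>) * (LINT t|lborel. cmod (h t)))"
        by (intro integrable_mult_left integrable_norm a_int)
      thus "integrable lborel (\<lambda>\<omega>. LINT t|lborel. norm (case (\<omega>, t) of (\<omega>, t) \<Rightarrow> a n \<omega> * (wave \<omega> t * h t)))"
        by (simp add: norm_mult)
      show "AE \<omega> in lborel. integrable lborel (\<lambda>t. case (\<omega>, t) of (\<omega>, t) \<Rightarrow> a n \<omega> * (wave \<omega> t * h t))"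
      proof (intro AE_I2)
        fix \<omega> :: 'a
        have [measurable]: "(\<lambda>t. wave \<omega> t) \<in> borel_measurable borel"
          by (intro borel_measurable_continuous_onI continuous_intros)
        have "integrable lborel (\<lambda>t. wave \<omega> t * h t)"
          by (rule Bochner_Integration.integrable_bound[OF int]) (auto simp: norm_mult)
        thus "integrable lborel (\<lambda>t. case (\<omega>, t) of (\<omega>, t) \<Rightarrow> a n \<omega> * (wave \<omega> t * h t))"
          by simp
      qed
    qed
    hence "(LINT \<omega>|lborel. (LINT t|lborel. a n \<omega> * (wave \<omega> t * h t))) =
      (LINT t|lborel. (LINT \<omega>|lborel. a n \<omega> * (wave \<omega> t * h t)))"
      by (rule lborel_pair.Fubini_integral[symmetric])
    moreover have "(LINT \<omega>|lborel. a n \<omega> * (wave \<omega> t * h t)) = r n ^ DIM('a) *\<^sub>R (h t * gaussian (r n *\<^sub>R t))" for t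
    proof -
      have [measurable]: "(\<lambda>\<omega>. wave t \<omega>) \<in> borel_measurable borel"
        by (intro borel_measurable_continuous_onI continuous_intros)
      have "(LINT \<omega>|lborel. a n \<omega> * (wave \<omega> t * h t)) =
          (LINT \<omega>|lborel. (a n \<omega> * wave t \<omega>) * h t)"
        by (simp add: mult_ac inner_commute)
      also have "\<dots> = (LINT \<omega>|lborel. a n \<omega> * wave t \<omega>) * h t"
        by (rule integral_mult_left_zero)
      also have "(LINT \<omega>|lborel. a n \<omega> * wave t \<omega>) =
          r n ^ DIM('a) *\<^sub>R (LINT \<omega>|lborel. a n (r n *\<^sub>R \<omega>) * wave t (r n *\<^sub>R \<omega>))"
        by (rule integral_lborel_scaleR) (use r in auto)
      also have "(LINT \<omega>|lborel. a n (r n *\<^sub>R \<omega>) * wave t (r n *\<^sub>R \<omega>)) =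
          (LINT \<omega>|lborel. gaussian \<omega> * wave (r n *\<^sub>R t) \<omega>)"
        using r[of n] by (simp add: a_def)
      also have "\<dots> = gaussian (r n *\<^sub>R t)"
        by (rule gaussian_fourier)
      finally show ?thesis
        by simp
    qed
    ultimately have "(LINT \<omega>|lborel. a n \<omega> * G \<omega>) = r n ^ DIM('a) *\<^sub>R (LINT t|lborel. h t * gaussian (r n *\<^sub>R t))"
      by (simp add: G_def)
    also have "(LINT t|lborel. h t * gaussian (r n *\<^sub>R t)) = (LINT t|lborel. h ((r n *\<^sub>R t) /\<^sub>R r n) * gaussian (r n *\<^sub>R t))"
      using r[of n] by simp
    also have "r n ^ DIM('a) *\<^sub>R \<dots> = (LINT u|lborel. h (u /\<^sub>R r n) * gaussian u)"
      by (rule integral_lborel_scaleR[symmetric]) (use r in auto)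
    finally show ?thesis .
  qed
  have 3: "(\<lambda>n. LINT u|lborel. h (u /\<^sub>R r n) * gaussian u) \<longlonglongrightarrow> (LINT u::'a|lborel. h 0 * gaussian u)"
  proof (rule integral_dominated_convergence)
    show "integrable lborel (\<lambda>u::'a. B * cmod (gaussian u))"
      by (intro integrable_mult_right integrable_norm gaussian_integrable)
    show "(\<lambda>u::'a. h 0 * gaussian u) \<in> borel_measurable lborel" "(\<lambda>u. h (u /\<^sub>R r n) * gaussian u) \<in> borel_measurable lborel" for n
      by simp_all
    show "AE u in lborel. (\<lambda>n. h (u /\<^sub>R r n) * gaussian u) \<longlonglongrightarrow> h 0 * gaussian u"
      by (intro AE_I2 tendsto_mult tendsto_const continuous_on_tendsto_compose[OF cont lim0]) auto
    show "AE u in lborel. cmod (h (u /\<^sub>R r n) * gaussian u) \<le> B * cmod (gaussian u)" for n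
      by (intro AE_I2) (auto simp: norm_mult intro!: mult_right_mono bound)
  qed
  have "(LINT \<omega>|lborel. 1 * G \<omega>) = (LINT u::'a|lborel. h 0 * gaussian u)"
    using LIMSEQ_unique[OF 1[unfolded 2] 3] .
  thus ?thesis
    by (simp add: gaussian_integral G_def)
qed

lemma cis_mult_left: "cis a * (cis b * x) = cis (a + b) * x"
  by (simp only: mult.assoc[symmetric] cis_mult)

lemma fourier_inversion:
  fixes g :: "'a::euclidean_space \<Rightarrow> complex"
  assumes cont: "continuous_on UNIV g" and bound: "\<And>x. cmod (g x) \<le> B" and int: "integrable lborel g"
    and int': "integrable lborel (\<lambda>\<omega>. LINT t|lborel. wave \<omega> t * g t)"
  shows "(LINT \<omega>|lborel. cis (- 2 * pi * (\<omega> \<bullet> s)) * (LINT t|lborel. wave \<omega> t * g t)) = g s"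
proof -
  have gm [measurable]: "g \<in> borel_measurable borel"
    by (intro borel_measurable_continuous_onI cont)
  have cis_meas [measurable]: "(\<lambda>t::'a. cis (c * (\<omega> \<bullet> t))) \<in> borel_measurable borel" for c \<omega>
    by (intro borel_measurable_continuous_onI continuous_intros)
  have cis_meas' [measurable]: "(\<lambda>t::'a. cis (c * (t \<bullet> \<omega>))) \<in> borel_measurable borel" for c \<omega>
    by (intro borel_measurable_continuous_onI continuous_intros)
  have shift: "(LINT t|lborel. wave \<omega> t * g (t + s)) =
    cis (- 2 * pi * (\<omega> \<bullet> s)) * (LINT t|lborel. wave \<omega> t * g t)" for \<omega>
  proof -
    have "(LINT t|lborel. wave \<omega> t * g (t + s)) =
        (LINT t|lborel. cis (- 2 * pi * (\<omega> \<bullet> s)) * (wave \<omega> (t + s) * g (t + s)))"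
      by (simp add: cis_mult_left inner_add_right ring_distribs)
    also have "\<dots> = cis (- 2 * pi * (\<omega> \<bullet> s)) * (LINT t|lborel. wave \<omega> (t + s) * g (t + s))"
      by (rule integral_mult_right_zero)
    also have "(LINT t|lborel. wave \<omega> (t + s) * g (t + s)) = (LINT t|lborel. wave \<omega> t * g t)"
      by (rule integral_lborel_translate) measurable
    finally show ?thesis .
  qed
  have "(LINT \<omega>|lborel. (LINT t|lborel. wave \<omega> t * g (t + s))) = g (0 + s)"
  proof (rule fourier_inversion_at_0)
    show "continuous_on UNIV (\<lambda>t. g (t + s))"
      by (intro continuous_on_compose2[OF cont] continuous_intros) auto
    show "integrable lborel (\<lambda>t. g (t + s))"
      using int by (simp add: integrable_lborel_translate)
    show "integrable lborel (\<lambda>\<omega>. LINT t|lborel. wave \<omega> t * g (t + s))"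
      unfolding shift
    proof (rule Bochner_Integration.integrable_bound[OF int'])
      have [measurable]: "(\<lambda>\<omega>. LINT t|lborel. wave \<omega> t * g t) \<in> borel_measurable borel"
        using borel_measurable_integrable[OF int'] by simp
      show "(\<lambda>\<omega>. cis (- 2 * pi * (\<omega> \<bullet> s)) * (LINT t|lborel. wave \<omega> t * g t)) \<in> borel_measurable lborel"
        unfolding measurable_lborel1 by (intro borel_measurable_times cis_meas') measurable
    qed (auto simp: norm_mult)
  qed (rule bound)
  thus ?thesis
    by (simp add: shift)
qed

lemma schwartz_bounded: "f \<in> schwartz \<Longrightarrow> \<exists>B. \<forall>x. cmod (f x) \<le> B"
  using rapidly_decreasingE[OF schwartz_rapidly_decreasing, where n = 0] by (metis div_by_1 power_0)

lemma schwartz_integrable_fibre: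
  "H \<in> schwartz \<Longrightarrow> integrable lborel (\<lambda>t. H (phase_point x t))"
  using partial_fourier_kernel_integrable[of H 0 x] by simp

text \<open>Integrate over the frequency first: the exponential in the frequency undoes the partial transform and
evaluates \<open>H\<close> at \<open>- freq \<theta>\<close>.\<close>

lemma integral_exponential_partial_fourier:
  assumes "H \<in> schwartz"
  shows "(LINT z|lborel. wave \<theta> z * partial_fourier H z) =
    (LINT x|lborel. wave (pos \<theta>) x * H (phase_point x (- freq \<theta>)))"
proof -
  have "modulation \<theta> (partial_fourier H) \<in> schwartz"
    by (intro schwartz_modulation partial_fourier_schwartz assms)
  hence "integrable lborel (\<lambda>z. wave \<theta> z * partial_fourier H z)"
    using schwartz_integrable unfolding modulation_def by blast
  hence "(LINT z|lborel. wave \<theta> z * partial_fourier H z) =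
    (LINT x|lborel. (LINT \<omega>|lborel. wave \<theta> (phase_point x \<omega>) * partial_fourier H (phase_point x \<omega>)))"
    by (rule integral_phase_point)
  also have "\<dots> = (LINT x|lborel. wave (pos \<theta>) x * H (phase_point x (- freq \<theta>)))"
  proof (rule Bochner_Integration.integral_cong[OF refl])
    fix x
    have PF: "partial_fourier H (phase_point x \<omega>) = (LINT t|lborel. wave \<omega> t * H (phase_point x t))" for \<omega>
      by (simp add: partial_fourier_def)
    obtain B where B: "\<And>x. cmod (H x) \<le> B"
      using schwartz_bounded[OF assms] by blast
    have "(LINT \<omega>|lborel. wave \<theta> (phase_point x \<omega>) * partial_fourier H (phase_point x \<omega>)) =
      (LINT \<omega>|lborel. wave (pos \<theta>) x * (cis (- 2 * pi * (\<omega> \<bullet> - freq \<theta>)) * partial_fourier H (phase_point x \<omega>)))"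
      unfolding cis_mult_left inner_pos_freq pos_phase_point freq_phase_point
      by (simp add: ring_distribs inner_commute)
    also have "\<dots> = wave (pos \<theta>) x * (LINT \<omega>|lborel. cis (- 2 * pi * (\<omega> \<bullet> - freq \<theta>)) * partial_fourier H (phase_point x \<omega>))"
      by (rule integral_mult_right_zero)
    also have "(LINT \<omega>|lborel. cis (- 2 * pi * (\<omega> \<bullet> - freq \<theta>)) * partial_fourier H (phase_point x \<omega>)) = H (phase_point x (- freq \<theta>))"
      unfolding PF
    proof (rule fourier_inversion)
      show "continuous_on UNIV (\<lambda>t. H (phase_point x t))"
        by (intro continuous_on_compose2[OF schwartz_continuous[OF assms]] continuous_intros) auto
      show "integrable lborel (\<lambda>t. H (phase_point x t))"
        by (rule schwartz_integrable_fibre[OF assms])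
      show "integrable lborel (\<lambda>\<omega>. LINT t|lborel. wave \<omega> t * H (phase_point x t))"
        unfolding PF[symmetric] by (intro schwartz_integrable_fibre partial_fourier_schwartz assms)
    qed (rule B)
    finally show "(LINT \<omega>|lborel. wave \<theta> (phase_point x \<omega>) * partial_fourier H (phase_point x \<omega>)) =
      wave (pos \<theta>) x * H (phase_point x (- freq \<theta>))" .
  qed
  finally show ?thesis .
qed

section \<open>The Wigner transform\<close>

text \<open>The function of \<open>(x, t)\<close> whose partial Fourier transform is \<open>wigner_tau \<tau> u \<phi>\<close>.\<close>

definition wigner_kernel ::
  "real \<Rightarrow> (real ^ 'd::finite \<Rightarrow> complex) \<Rightarrow> (real ^ 'd \<Rightarrow> complex) \<Rightarrow> real ^ ('d + 'd) \<Rightarrow> complex" where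
  "wigner_kernel \<tau> u \<phi> z = u (pos z - (1 - \<tau>) *\<^sub>R freq z) * \<phi> (pos z + \<tau> *\<^sub>R freq z)"

text \<open>Both arguments together determine the point: their difference is \<open>freq z\<close>, and the convex combination with
weights \<open>\<tau>\<close>, \<open>1 - \<tau>\<close> is \<open>pos z\<close>. This is where \<open>\<tau>\<close> between 0 and 1 enters.\<close>

lemma wigner_kernel_schwartz:
  assumes "u \<in> schwartz" "\<phi> \<in> schwartz" "\<tau> \<in> {0..1}"
  shows "wigner_kernel \<tau> u \<phi> \<in> schwartz"
  unfolding wigner_kernel_def[abs_def]
proof (rule schwartz_tensor_linear[where c = 2 and f = u and g = \<phi>
      and A = "\<lambda>z. pos z - (1 - \<tau>) *\<^sub>R freq z" and B = "\<lambda>z. pos z + \<tau> *\<^sub>R freq z"])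
  show "bounded_linear (\<lambda>z::real ^ ('a + 'a). pos z - (1 - \<tau>) *\<^sub>R freq z)"
    "bounded_linear (\<lambda>z::real ^ ('a + 'a). pos z + \<tau> *\<^sub>R freq z)"
    by (intro bounded_linear_sub bounded_linear_add bounded_linear_pos
        bounded_linear_const_scaleR bounded_linear_freq)+
  fix z :: "real ^ ('a + 'a)"
  let ?a = "pos z - (1 - \<tau>) *\<^sub>R freq z" and ?b = "pos z + \<tau> *\<^sub>R freq z"
  have "freq z = ?b - ?a"
    by (simp add: algebra_simps)
  hence f: "norm (freq z) \<le> norm ?a + norm ?b"
    using norm_triangle_ineq4[of ?b ?a] by simp
  have "pos z = \<tau> *\<^sub>R ?a + (1 - \<tau>) *\<^sub>R ?b"
    by (simp add: algebra_simps)
  hence "norm (pos z) \<le> norm (\<tau> *\<^sub>R ?a) + norm ((1 - \<tau>) *\<^sub>R ?b)"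
    by (metis norm_triangle_ineq)
  also have "\<dots> \<le> norm ?a + norm ?b"
    using assms(3) by (intro add_mono) (auto intro!: mult_left_le_one_le)
  finally show "norm z \<le> 2 * (norm ?a + norm ?b)"
    using f norm_phase_point_le[of "pos z" "freq z"] by simp
qed (use assms in auto)

lemma wigner_tau_eq_partial_fourier:
  assumes "u \<in> schwartz" "\<phi> \<in> schwartz" "\<tau> \<in> {0..1}"
  shows "wigner_tau \<tau> u \<phi> = partial_fourier (wigner_kernel \<tau> u \<phi>)"
proof
  fix z
  have "(\<lambda>t. wave t (freq z) * u (pos z - (1 - \<tau>) *\<^sub>R t) * \<phi> (pos z + \<tau> *\<^sub>R t)) \<in> borel_measurable borel"
    by (intro borel_measurable_continuous_onI continuous_intros
        continuous_on_compose2[OF schwartz_continuous[OF assms(1)]]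
        continuous_on_compose2[OF schwartz_continuous[OF assms(2)]]) auto
  thus "wigner_tau \<tau> u \<phi> z = partial_fourier (wigner_kernel \<tau> u \<phi>) z"
    unfolding wigner_tau_def partial_fourier_def wigner_kernel_def
    by (subst integral_completion) (simp_all add: inner_commute mult_ac)
qed

lemma wigner_tau_schwartz:
  "u \<in> schwartz \<Longrightarrow> \<phi> \<in> schwartz \<Longrightarrow> \<tau> \<in> {0..1} \<Longrightarrow> wigner_tau \<tau> u \<phi> \<in> schwartz"
  by (simp add: wigner_tau_eq_partial_fourier partial_fourier_schwartz wigner_kernel_schwartz)

text \<open>The operator whose symbol is the exponential of frequency \<open>\<theta>\<close> shifts the argument of \<open>u\<close> by \<open>freq \<theta>\<close>,
modulates by \<open>pos \<theta>\<close> and multiplies by a phase; only the phase depends on \<open>\<tau>\<close>. It comes from centering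
the position integral by the translation \<open>t \<mapsto> t + \<tau> freq \<theta>\<close>.\<close>

lemma integral_exponential_wigner_tau:
  assumes "u \<in> schwartz" "\<phi> \<in> schwartz" "\<tau> \<in> {0..1}"
  shows "(LINT z|lborel. wave \<theta> z * wigner_tau \<tau> u \<phi> z) =
    cis (2 * pi * \<tau> * (pos \<theta> \<bullet> freq \<theta>)) * (LINT t|lborel. u (t + freq \<theta>) * (wave (pos \<theta>) t * \<phi> t))"
proof -
  let ?a = "pos \<theta>" and ?b = "freq \<theta>"
  let ?f = "\<lambda>x. wave ?a x * (u (x + (1 - \<tau>) *\<^sub>R ?b) * \<phi> (x - \<tau> *\<^sub>R ?b))"
  have "?f \<in> borel_measurable borel"
    by (intro borel_measurable_continuous_onI continuous_intros
        continuous_on_compose2[OF schwartz_continuous[OF assms(1)]]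
        continuous_on_compose2[OF schwartz_continuous[OF assms(2)]]) auto
  hence "(LINT t|lborel. ?f t) = (LINT t|lborel. ?f (t + \<tau> *\<^sub>R ?b))"
    by (rule integral_lborel_translate[symmetric])
  also have "\<dots> = (LINT t|lborel. cis (2 * pi * \<tau> * (?a \<bullet> ?b)) * (u (t + ?b) * (wave ?a t * \<phi> t)))"
  proof (rule Bochner_Integration.integral_cong[OF refl])
    fix t
    have "t + \<tau> *\<^sub>R ?b + (1 - \<tau>) *\<^sub>R ?b = t + ?b"
      by (simp add: algebra_simps)
    moreover have "wave ?a (t + \<tau> *\<^sub>R ?b) = cis (2 * pi * \<tau> * (?a \<bullet> ?b)) * wave ?a t"
      by (simp add: cis_mult inner_add_right algebra_simps)
    ultimately show "?f (t + \<tau> *\<^sub>R ?b) = cis (2 * pi * \<tau> * (?a \<bullet> ?b)) * (u (t + ?b) * (wave ?a t * \<phi> t))"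
      by (simp only: add_diff_cancel_right' mult.assoc mult.left_commute)
  qed
  also have "\<dots> = cis (2 * pi * \<tau> * (?a \<bullet> ?b)) * (LINT t|lborel. u (t + ?b) * (wave ?a t * \<phi> t))"
    by (rule integral_mult_right_zero)
  finally show ?thesis
    unfolding wigner_tau_eq_partial_fourier[OF assms] integral_exponential_partial_fourier[OF wigner_kernel_schwartz[OF assms]]
    by (simp add: wigner_kernel_def)
qed


section \<open>Linear changes of variables\<close>

text \<open>The transformation law of Lebesgue measure under \<open>f\<close>. Stated for all nonnegative functions it is stable
under composition, so it needs to be checked for elementary matrices only.\<close>

definition scales_lborel :: "(real ^ 'n \<Rightarrow> real ^ 'n::finite) \<Rightarrow> bool" where
  "scales_lborel f \<longleftrightarrow> (\<forall>g\<in>borel_measurable borel.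
     (\<integral>\<^sup>+x. g x \<partial>lborel) = ennreal \<bar>det (matrix f)\<bar> * (\<integral>\<^sup>+x. g (f x) \<partial>lborel))"

lemma scales_lborelI_distr:
  assumes "lborel = density (distr lborel borel f) (\<lambda>_. ennreal \<bar>det (matrix f)\<bar>)" "f \<in> borel_measurable borel"
  shows "scales_lborel f"
  unfolding scales_lborel_def
proof
  fix g :: "real ^ 'a \<Rightarrow> ennreal" assume g: "g \<in> borel_measurable borel"
  have "(\<integral>\<^sup>+x. g x \<partial>lborel) = (\<integral>\<^sup>+x. g x \<partial>density (distr lborel borel f) (\<lambda>_. ennreal \<bar>det (matrix f)\<bar>))"
    using assms(1) by simp
  also have "\<dots> = (\<integral>\<^sup>+x. ennreal \<bar>det (matrix f)\<bar> * g x \<partial>distr lborel borel f)"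
    using g by (intro nn_integral_density) auto
  also have "\<dots> = (\<integral>\<^sup>+x. ennreal \<bar>det (matrix f)\<bar> * g (f x) \<partial>lborel)"
    using g assms(2) by (intro nn_integral_distr) auto
  also have "\<dots> = ennreal \<bar>det (matrix f)\<bar> * (\<integral>\<^sup>+x. g (f x) \<partial>lborel)"
    using g assms(2) by (intro nn_integral_cmult) auto
  finally show "(\<integral>\<^sup>+x. g x \<partial>lborel) = ennreal \<bar>det (matrix f)\<bar> * (\<integral>\<^sup>+x. g (f x) \<partial>lborel)" .
qed

lemma scales_lborel_stretch:
  fixes c :: "'n::finite \<Rightarrow> real"
  assumes "det (matrix (\<lambda>x::real^'n. \<chi> i. c i * x $ i)) \<noteq> 0"
  shows "scales_lborel (\<lambda>x::real^'n. \<chi> i. c i * x $ i)"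
proof (rule scales_lborelI_distr)
  let ?f = "\<lambda>x::real^'n. \<chi> i. c i * x $ i"
  have det: "det (matrix ?f) = prod c UNIV"
    by (simp add: axis_def matrix_def det_diagonal)
  define C :: "real ^ 'n" where "C = (\<chi> i. c i)"
  have c: "C \<bullet> j \<noteq> 0" if "j \<in> Basis" for j
    using that assms unfolding det C_def by (auto simp: Basis_vec_def inner_axis)
  have T: "0 + (\<Sum>j\<in>Basis. ((C \<bullet> j) * (x \<bullet> j)) *\<^sub>R j) = ?f x" for x
  proof (rule euclidean_eqI)
    fix b :: "real ^ 'n" assume b: "b \<in> Basis"
    have "(0 + (\<Sum>j\<in>Basis. ((C \<bullet> j) * (x \<bullet> j)) *\<^sub>R j)) \<bullet> b = (C \<bullet> b) * (x \<bullet> b)"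
      using b by simp
    also have "\<dots> = ?f x \<bullet> b"
      using b by (auto simp: Basis_vec_def inner_axis C_def)
    finally show "(0 + (\<Sum>j\<in>Basis. ((C \<bullet> j) * (x \<bullet> j)) *\<^sub>R j)) \<bullet> b = ?f x \<bullet> b" .
  qed
  have "(\<Prod>j\<in>Basis. \<bar>C \<bullet> j\<bar>) = \<bar>det (matrix ?f)\<bar>"
    unfolding prod_Basis_cart det abs_prod by (simp add: C_def inner_axis)
  thus "lborel = density (distr lborel borel ?f) (\<lambda>_. ennreal \<bar>det (matrix ?f)\<bar>)"
    using lborel_affine_euclidean[where c = "\<lambda>j. C \<bullet> j" and t = 0, OF c] unfolding T by simp
  show "?f \<in> borel_measurable borel"
    by (intro borel_measurable_continuous_onI continuous_intros)
qed

lemma scales_lborel_swap: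
  fixes m n :: "'n::finite"
  shows "scales_lborel (\<lambda>x::real^'n. \<chi> i. x $ Transposition.transpose m n i)"
proof (rule scales_lborelI_distr)
  let ?p = "Transposition.transpose m n"
  let ?h = "\<lambda>x::real^'n. \<chi> i. x $ ?p i"
  show meas: "?h \<in> borel_measurable borel"
    by (intro borel_measurable_continuous_onI continuous_intros)
  have perm: "?p permutes UNIV"
    by (rule permutes_swap_id) auto
  have "lborel = distr lborel borel ?h"
  proof (rule lborel_eqI)
    fix l u :: "real ^ 'n" assume le: "\<And>b. b \<in> Basis \<Longrightarrow> l \<bullet> b \<le> u \<bullet> b"
    have le': "l $ i \<le> u $ i" for i
      using le[of "axis i 1"] by (simp add: inner_axis axis_in_Basis_iff)
    have "?h -` box l u = box (?h l) (?h u)"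
      by (auto simp: mem_box_cart) (metis transpose_involutory)+
    hence "emeasure (distr lborel borel ?h) (box l u) = emeasure lborel (box (?h l) (?h u))"
      using meas by (subst emeasure_distr) auto
    also have "\<dots> = ennreal (\<Prod>b\<in>Basis. (?h u - ?h l) \<bullet> b)"
      by (rule emeasure_lborel_box) (auto simp: Basis_vec_def inner_axis le')
    also have "(\<Prod>b\<in>Basis. (?h u - ?h l) \<bullet> b) = (\<Prod>i\<in>UNIV. (u - l) $ ?p i)"
      by (simp add: prod_Basis_cart inner_axis)
    also have "\<dots> = (\<Prod>i\<in>UNIV. (u - l) $ i)"
      using prod.permute[OF perm, of "\<lambda>i. (u - l) $ i"] by (simp add: o_def)
    also have "\<dots> = (\<Prod>b\<in>Basis. (u - l) \<bullet> b)"
      by (simp add: prod_Basis_cart inner_axis)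
    finally show "emeasure (distr lborel borel ?h) (box l u) = (\<Prod>b\<in>Basis. (u - l) \<bullet> b)" .
  qed auto
  moreover have "\<bar>det (matrix ?h)\<bar> = 1"
  proof -
    have "(\<chi> i j. if ?p i = j then 1 else 0) = (\<chi> i j. if j = ?p i then 1 else (0::real))"
      by (auto intro!: Cart_lambda_cong)
    hence "matrix ?h = transpose (\<chi> i j. mat 1 $ i $ ?p j)"
      by (auto simp: transpose_def axis_def mat_def matrix_def)
    thus ?thesis
      by (simp add: det_permute_columns permutes_swap_id sign_swap_id abs_mult)
  qed
  ultimately show "lborel = density (distr lborel borel ?h) (\<lambda>_. ennreal \<bar>det (matrix ?h)\<bar>)"
    by (simp add: density_1)
qed

text \<open>By Fubini the coordinate \<open>m\<close> can be integrated first. The other coordinates are then fixed, and the shear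
acts on coordinate \<open>m\<close> as a translation.\<close>

lemma scales_lborel_shear:
  fixes m n :: "'n::finite"
  assumes "m \<noteq> n"
  shows "scales_lborel (\<lambda>x::real^'n. \<chi> i. if i = m then x $ m + x $ n else x $ i)"
  unfolding scales_lborel_def
proof
  let ?h = "\<lambda>x::real^'n. \<chi> i. if i = m then x $ m + x $ n else x $ i"
  fix g :: "real ^ 'n \<Rightarrow> ennreal" assume g [measurable]: "g \<in> borel_measurable borel"
  have "?h = (\<lambda>x. \<chi> i. x $ i + (if i = m then x $ n else 0))"
    by (auto simp: fun_eq_iff vec_eq_iff)
  moreover have "continuous_on UNIV (\<lambda>x::real^'n. \<chi> i. x $ i + (if i = m then x $ n else 0))"
  proof (intro continuous_on_vec_lambda)
    fix i show "continuous_on UNIV (\<lambda>x::real^'n. x $ i + (if i = m then x $ n else 0))"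
      by (cases "i = m") (auto intro!: continuous_intros)
  qed
  ultimately have h [measurable]: "?h \<in> borel_measurable borel"
    by (simp add: borel_measurable_continuous_onI)
  have "matrix ?h = (\<chi> k. if k = m then row m (mat 1) + 1 *s row n (mat 1) else row k (mat 1))"
    using assms by (auto simp: matrix_def mat_def row_def axis_def vec_eq_iff)
  hence det: "det (matrix ?h) = 1"
    using det_row_operation[OF assms, of "mat 1" 1] by simp
  interpret product_sigma_finite "\<lambda>_::real^'n. lborel :: real measure" ..
  let ?bm = "axis m 1 :: real ^ 'n" and ?bn = "axis n 1 :: real ^ 'n"
  let ?I = "Basis - {?bm}"
  let ?E = "\<lambda>f. \<Sum>b\<in>Basis. f b *\<^sub>R (b :: real ^ 'n)"
  have ins: "insert ?bm ?I = Basis"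
    by (auto simp: axis_in_Basis_iff)
  have bn: "?bn \<in> ?I" "?bn \<noteq> ?bm"
    using assms by (auto simp: axis_in_Basis_iff axis_eq_axis)
  have T [measurable]: "?E \<in> (\<Pi>\<^sub>M b\<in>Basis. lborel) \<rightarrow>\<^sub>M borel"
    by measurable
  have split: "(\<integral>\<^sup>+x. k x \<partial>lborel) = (\<integral>\<^sup>+x. (\<integral>\<^sup>+y. k (?E (x(?bm := y))) \<partial>lborel) \<partial>Pi\<^sub>M ?I (\<lambda>_. lborel))"
    if [measurable]: "k \<in> borel_measurable borel" for k :: "real ^ 'n \<Rightarrow> ennreal"
  proof -
    have "(\<integral>\<^sup>+x. k x \<partial>lborel) = (\<integral>\<^sup>+f. k (?E f) \<partial>Pi\<^sub>M (insert ?bm ?I) (\<lambda>_. lborel))"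
      unfolding ins by (subst lborel_eq, subst nn_integral_distr[OF T]) auto
    also have "\<dots> = (\<integral>\<^sup>+x. (\<integral>\<^sup>+y. k (?E (x(?bm := y))) \<partial>lborel) \<partial>Pi\<^sub>M ?I (\<lambda>_. lborel))"
      by (rule product_nn_integral_insert) (auto simp: ins)
    finally show ?thesis .
  qed
  have E: "?E f $ i = f (axis i 1)" for f i
  proof -
    have "?E f $ i = ?E f \<bullet> axis i 1"
      by (simp add: inner_axis)
    also have "\<dots> = f (axis i 1)"
      by (subst inner_sum_left) (simp add: inner_Basis axis_in_Basis_iff if_distrib sum.delta cong: if_cong)
    finally show ?thesis .
  qed
  have hE: "?h (?E (x(?bm := y))) = ?E (x(?bm := x ?bn + y))" for x y
  proof (rule vec_eq_iff[THEN iffD2], rule allI)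
    fix i
    show "?h (?E (x(?bm := y))) $ i = ?E (x(?bm := x ?bn + y)) $ i"
      unfolding vec_lambda_beta E using assms by (auto simp: axis_eq_axis)
  qed
  have upd: "(\<lambda>y. ?E (x(?bm := y))) \<in> borel_measurable borel" for x
  proof -
    have "(\<lambda>y. ?E (x(?bm := y))) = (\<lambda>y. \<chi> i. if i = m then y else x (axis i 1))"
      by (intro ext, rule vec_eq_iff[THEN iffD2], rule allI, unfold vec_lambda_beta E)
        (auto simp: axis_eq_axis)
    moreover have "continuous_on UNIV (\<lambda>y. \<chi> i. if i = m then y else x (axis i 1))"
    proof (intro continuous_on_vec_lambda)
      fix i show "continuous_on UNIV (\<lambda>y. if i = m then y else x (axis i 1))"
        by (cases "i = m") (auto intro!: continuous_intros)
    qed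
    ultimately show ?thesis
      by (simp add: borel_measurable_continuous_onI)
  qed
  have "(\<integral>\<^sup>+x. g (?h x) \<partial>lborel) =
      (\<integral>\<^sup>+x. (\<integral>\<^sup>+y. g (?E (x(?bm := x ?bn + y))) \<partial>lborel) \<partial>Pi\<^sub>M ?I (\<lambda>_. lborel))"
    by (subst split) (simp_all only: hE measurable_compose[OF h g])
  also have "\<dots> = (\<integral>\<^sup>+x. (\<integral>\<^sup>+y. g (?E (x(?bm := y))) \<partial>lborel) \<partial>Pi\<^sub>M ?I (\<lambda>_. lborel))"
  proof (rule nn_integral_cong)
    fix x
    show "(\<integral>\<^sup>+y. g (?E (x(?bm := x ?bn + y))) \<partial>lborel) = (\<integral>\<^sup>+y. g (?E (x(?bm := y))) \<partial>lborel)"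
      using nn_integral_real_affine[of "\<lambda>y. g (?E (x(?bm := y)))" 1 "x ?bn"] measurable_compose[OF upd g]
      by simp
  qed
  also have "\<dots> = (\<integral>\<^sup>+x. g x \<partial>lborel)"
    by (rule split[symmetric]) measurable
  finally show "(\<integral>\<^sup>+x. g x \<partial>lborel) = ennreal \<bar>det (matrix ?h)\<bar> * (\<integral>\<^sup>+x. g (?h x) \<partial>lborel)"
    by (simp add: det)
qed

lemma linear_imp_measurable: "linear f \<Longrightarrow> f \<in> borel_measurable borel"
  for f :: "'a::euclidean_space \<Rightarrow> 'b::euclidean_space"
  by (intro borel_measurable_continuous_onI linear_continuous_on linear_conv_bounded_linear[THEN iffD1])

lemma linear_scales_lborel:
  fixes f :: "real ^ 'n::finite \<Rightarrow> real ^ 'n"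
  assumes "linear f" "det (matrix f) \<noteq> 0"
  shows "scales_lborel f"
proof -
  have "linear f \<and> det (matrix f) \<noteq> 0 \<longrightarrow> scales_lborel f"
  proof (rule induct_linear_elementary[OF assms(1)])
    fix f g :: "real ^ 'n \<Rightarrow> real ^ 'n"
    assume lin: "linear f" "linear g" and f: "linear f \<and> det (matrix f) \<noteq> 0 \<longrightarrow> scales_lborel f"
      and g: "linear g \<and> det (matrix g) \<noteq> 0 \<longrightarrow> scales_lborel g"
    have det: "det (matrix (f \<circ> g)) = det (matrix f) * det (matrix g)"
      by (simp add: matrix_compose[OF lin(2,1)] det_mul)
    show "linear (f \<circ> g) \<and> det (matrix (f \<circ> g)) \<noteq> 0 \<longrightarrow> scales_lborel (f \<circ> g)"
    proof
      assume "linear (f \<circ> g) \<and> det (matrix (f \<circ> g)) \<noteq> 0"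
      hence sc: "scales_lborel f" "scales_lborel g"
        using f g lin by (auto simp: det)
      show "scales_lborel (f \<circ> g)"
        unfolding scales_lborel_def
      proof
        fix k :: "real ^ 'n \<Rightarrow> ennreal" assume k: "k \<in> borel_measurable borel"
        have "(\<lambda>x. k (f x)) \<in> borel_measurable borel"
          by (rule measurable_compose[OF linear_imp_measurable[OF lin(1)] k])
        hence "(\<integral>\<^sup>+x. k (f x) \<partial>lborel) = ennreal \<bar>det (matrix g)\<bar> * (\<integral>\<^sup>+x. k (f (g x)) \<partial>lborel)"
          using sc(2) unfolding scales_lborel_def by (rule bspec[rotated])
        moreover have "(\<integral>\<^sup>+x. k x \<partial>lborel) = ennreal \<bar>det (matrix f)\<bar> * (\<integral>\<^sup>+x. k (f x) \<partial>lborel)"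
          using sc(1) k unfolding scales_lborel_def by (rule bspec)
        ultimately show "(\<integral>\<^sup>+x. k x \<partial>lborel) = ennreal \<bar>det (matrix (f \<circ> g))\<bar> * (\<integral>\<^sup>+x. k ((f \<circ> g) x) \<partial>lborel)"
          by (simp add: det abs_mult ennreal_mult mult.assoc)
      qed
    qed
  next
    fix f :: "real ^ 'n \<Rightarrow> real ^ 'n" and i assume "linear f" "\<And>x. f x $ i = 0"
    hence "\<not> inj f"
      by (metis (full_types) linear_injective_imp_surjective one_neq_zero surjE vec_component)
    thus "linear f \<and> det (matrix f) \<noteq> 0 \<longrightarrow> scales_lborel f"
      using det_nz_iff_inj by blast
  next
    fix c show "linear (\<lambda>x::real^'n. \<chi> i. c i * x $ i) \<and> det (matrix (\<lambda>x::real^'n. \<chi> i. c i * x $ i)) \<noteq> 0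
        \<longrightarrow> scales_lborel (\<lambda>x::real^'n. \<chi> i. c i * x $ i)"
      using scales_lborel_stretch by blast
  qed (simp_all add: scales_lborel_swap scales_lborel_shear)
  thus ?thesis
    using assms by blast
qed

lemma integral_linear_change_of_variables:
  fixes g :: "real ^ 'n::finite \<Rightarrow> complex"
  assumes "linear f" "det (matrix f) \<noteq> 0" "g \<in> borel_measurable borel"
  shows "(LINT x|lborel. g x) = \<bar>det (matrix f)\<bar> * (LINT x|lborel. g (f x))"
proof -
  let ?D = "distr lborel borel f" and ?c = "\<bar>det (matrix f)\<bar>"
  have f [measurable]: "f \<in> borel_measurable borel"
    by (rule linear_imp_measurable[OF assms(1)])
  have sc: "scales_lborel f"
    by (rule linear_scales_lborel[OF assms(1,2)])
  have "lborel = density ?D (\<lambda>_. ennreal ?c)"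
  proof (rule measure_eqI)
    fix A :: "(real ^ 'n) set" assume "A \<in> sets lborel"
    hence A [measurable]: "A \<in> sets borel"
      by simp
    have "emeasure lborel A = (\<integral>\<^sup>+x. indicator A x \<partial>lborel)"
      by simp
    also have "\<dots> = ennreal ?c * (\<integral>\<^sup>+x. indicator A (f x) \<partial>lborel)"
      using sc unfolding scales_lborel_def by (rule bspec) measurable
    also have "\<dots> = ennreal ?c * (\<integral>\<^sup>+x. indicator A x \<partial>?D)"
      by (subst nn_integral_distr) auto
    also have "\<dots> = (\<integral>\<^sup>+x. ennreal ?c * indicator A x \<partial>?D)"
      by (rule nn_integral_cmult[symmetric]) auto
    also have "\<dots> = emeasure (density ?D (\<lambda>_. ennreal ?c)) A"
      by (rule emeasure_density[symmetric]) auto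
    finally show "emeasure lborel A = emeasure (density ?D (\<lambda>_. ennreal ?c)) A" .
  qed simp
  hence "(LINT x|lborel. g x) = (LINT x|density ?D (\<lambda>_. ennreal ?c). g x)"
    by simp
  also have "\<dots> = (LINT x|?D. ?c *\<^sub>R g x)"
    using assms(3) by (intro integral_density) auto
  also have "\<dots> = (LINT x|lborel. ?c *\<^sub>R g (f x))"
    using assms(3) by (intro integral_distr) auto
  finally show ?thesis
    by (simp add: scaleR_conv_of_real)
qed

section \<open>Sums and integrals\<close>

text \<open>This uses the completeness of Lebesgue measure. It makes pointwise sums measurable that converge only
almost everywhere and have the default value 0 elsewhere.\<close>

lemma borel_measurable_lebesgue_AE:
  fixes f g :: "'a::euclidean_space \<Rightarrow> complex"
  assumes "f \<in> borel_measurable lebesgue" "AE x in lebesgue. f x = g x"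
  shows "g \<in> borel_measurable lebesgue"
proof (rule borel_measurableI)
  fix S :: "complex set" assume "open S"
  hence "f -` S \<inter> space lebesgue \<in> sets lebesgue"
    using assms(1) by (intro measurable_sets) auto
  moreover have "AE x in lebesgue. x \<in> g -` S \<inter> space lebesgue \<longleftrightarrow> x \<in> f -` S \<inter> space lebesgue"
    using assms(2) by eventually_elim auto
  ultimately show "g -` S \<inter> space lebesgue \<in> sets lebesgue"
    by (intro completion.in_sets_AE[where A = "f -` S \<inter> space lebesgue" and B = "g -` S \<inter> space lebesgue"])
      (auto elim: eventually_mono)
qed

lemma has_sum_integral:
  fixes F :: "'i \<Rightarrow> 'a::euclidean_space \<Rightarrow> complex"
  assumes I: "countable I" "infinite I"
    and int: "\<And>i. i \<in> I \<Longrightarrow> integrable lebesgue (F i)"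
    and sum: "(\<lambda>i. LINT x|lebesgue. cmod (F i x)) summable_on I"
  shows "((\<lambda>i. LINT x|lebesgue. F i x) has_sum (LINT x|lebesgue. (\<Sum>\<^sub>\<infinity>i\<in>I. F i x))) I"
proof -
  define e where "e = from_nat_into I"
  have e: "bij_betw e UNIV I"
    unfolding e_def using I by (simp add: bij_betw_from_nat_into)
  hence eI: "e n \<in> I" for n
    by (auto simp: bij_betw_def)
  let ?G = "\<lambda>n. F (e n)"
  have intG: "integrable lebesgue (?G n)" for n
    by (intro int eI)
  have sumG: "summable (\<lambda>n. LINT x|lebesgue. cmod (?G n x))"
    using sum summable_on_reindex_bij_betw[OF e, of "\<lambda>i. LINT x|lebesgue. cmod (F i x)"]
    by (intro summable_on_imp_summable) simp
  have AE: "AE x in lebesgue. summable (\<lambda>n. cmod (?G n x))"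
  proof -
    have meas [measurable]: "(\<lambda>x. ennreal (cmod (?G n x))) \<in> borel_measurable lebesgue" for n
      by (intro measurable_compose[OF _ measurable_ennreal] borel_measurable_integrable integrable_norm intG)
    have "(\<integral>\<^sup>+x. (\<Sum>n. ennreal (cmod (?G n x))) \<partial>lebesgue) = (\<Sum>n. \<integral>\<^sup>+x. ennreal (cmod (?G n x)) \<partial>lebesgue)"
      by (rule nn_integral_suminf[OF meas])
    also have "\<dots> = (\<Sum>n. ennreal (LINT x|lebesgue. cmod (?G n x)))"
      using intG by (simp add: nn_integral_eq_integral)
    also have "\<dots> \<noteq> \<infinity>"
      using sumG by (simp add: suminf_ennreal2)
    finally have "AE x in lebesgue. (\<Sum>n. ennreal (cmod (?G n x))) \<noteq> \<infinity>"
      by (intro nn_integral_PInf_AE) auto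
    thus ?thesis
      by eventually_elim (auto intro: summable_suminf_not_top)
  qed
  have eq: "AE x in lebesgue. (\<Sum>n. ?G n x) = (\<Sum>\<^sub>\<infinity>i\<in>I. F i x)"
    using AE
  proof eventually_elim
    case (elim x)
    have "((\<lambda>n. ?G n x) has_sum (\<Sum>n. ?G n x)) UNIV"
      using elim summable_norm_cancel[OF elim] by (intro norm_summable_imp_has_sum) auto
    hence "infsum (\<lambda>n. ?G n x) UNIV = (\<Sum>n. ?G n x)"
      by (rule infsumI)
    thus ?case
      using infsum_reindex_bij_betw[OF e, of "\<lambda>i. F i x"] by simp
  qed
  have suminf_int: "integrable lebesgue (\<lambda>x. \<Sum>n. ?G n x)"
    by (rule integrable_suminf[OF intG AE sumG])
  have "(LINT x|lebesgue. (\<Sum>n. ?G n x)) = (LINT x|lebesgue. (\<Sum>\<^sub>\<infinity>i\<in>I. F i x))"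
    by (rule integral_cong_AE)
      (use eq borel_measurable_integrable[OF suminf_int] borel_measurable_lebesgue_AE in auto)
  moreover have "(\<lambda>n. LINT x|lebesgue. ?G n x) sums (LINT x|lebesgue. (\<Sum>n. ?G n x))"
    by (rule sums_integral[OF intG AE sumG])
  moreover have "summable (\<lambda>n. norm (LINT x|lebesgue. ?G n x))"
    by (rule summable_comparison_test'[OF sumG, of 0]) (auto intro: integral_norm_bound)
  ultimately have "((\<lambda>n. LINT x|lebesgue. ?G n x) has_sum (LINT x|lebesgue. (\<Sum>\<^sub>\<infinity>i\<in>I. F i x))) UNIV"
    by (intro norm_summable_imp_has_sum) auto
  thus ?thesis
    using has_sum_reindex_bij_betw[OF e, of "\<lambda>i. LINT x|lebesgue. F i x"] by simp
qed

lemma lebesgue_translate: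
  fixes f :: "'a::euclidean_space \<Rightarrow> 'b::{banach,second_countable_topology}"
  assumes "integrable lebesgue f"
  shows integrable_lebesgue_translate: "integrable lebesgue (\<lambda>x. f (x + a))"
    and integral_lebesgue_translate: "(LINT x|lebesgue. f (x + a)) = (LINT x|lebesgue. f x)"
proof -
  have T: "(\<lambda>x. a + (\<Sum>j\<in>Basis. (1 * (x \<bullet> j)) *\<^sub>R j)) = (\<lambda>x. x + a)"
    by (simp add: euclidean_representation add.commute)
  have meas: "(\<lambda>x. x + a) \<in> lebesgue \<rightarrow>\<^sub>M lebesgue"
    using lebesgue_affine_measurable[where c = "\<lambda>_. 1" and t = a] unfolding T by simp
  have "lebesgue = density (distr lebesgue lebesgue (\<lambda>x. x + a)) (\<lambda>_. 1)"
    using lebesgue_affine_euclidean[where c = "\<lambda>_. 1" and t = a] unfolding T by simp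
  hence D: "distr lebesgue lebesgue (\<lambda>x. x + a) = lebesgue"
    by (simp add: density_1)
  show "integrable lebesgue (\<lambda>x. f (x + a))"
    using assms integrable_distr[OF meas, of f] D by simp
  show "(LINT x|lebesgue. f (x + a)) = (LINT x|lebesgue. f x)"
    using integral_distr[OF meas, of f] borel_measurable_integrable[OF assms] D by simp
qed

text \<open>Unfolding: translation invariance moves a sum over translates from one factor of a product to the other.
It is used twice, to replace the periodization of \<open>q\<close> by that of a test function, and, with the indicator
of a unit cell as \<open>g\<close>, to write an integral over the whole space as the integral of a periodization over the cell.\<close>

lemma integral_unfolding:
  fixes f g :: "'a::euclidean_space \<Rightarrow> complex"
  assumes I: "countable I" "infinite I"
    and f: "integrable lebesgue f"
    and g: "g \<in> borel_measurable borel"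
    and bound: "\<And>x F. finite F \<Longrightarrow> F \<subseteq> I \<Longrightarrow> (\<Sum>i\<in>F. cmod (g (x - a i))) \<le> B"
  shows "(LINT x|lebesgue. (\<Sum>\<^sub>\<infinity>i\<in>I. f (x + a i)) * g x) = (LINT x|lebesgue. f x * (\<Sum>\<^sub>\<infinity>i\<in>I. g (x - a i)))"
proof -
  obtain i0 where i0: "i0 \<in> I"
    using I by (metis finite.emptyI ex_in_conv)
  have gB: "cmod (g x) \<le> B" for x
    using bound[of "{i0}" "x + a i0"] i0 by simp
  have g_leb: "(\<lambda>x. g (x - b)) \<in> borel_measurable lebesgue" for b
    using measurable_compose[of "\<lambda>x. x - b" borel borel g borel] g by (intro measurable_completion) simp
  have G: "integrable lebesgue (\<lambda>x. f x * g (x - a i))" for i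
  proof (rule Bochner_Integration.integrable_bound)
    show "integrable lebesgue (\<lambda>x. B * cmod (f x))"
      using f by simp
    show "(\<lambda>x. f x * g (x - a i)) \<in> borel_measurable lebesgue"
      using f g_leb by (intro borel_measurable_times) auto
    have "cmod (f x * g (x - a i)) \<le> B * cmod (f x)" for x
      using mult_left_mono[OF gB[of "x - a i"], of "cmod (f x)"] by (simp add: norm_mult mult.commute)
    thus "AE x in lebesgue. cmod (f x * g (x - a i)) \<le> norm (B * cmod (f x))"
      by (intro AE_I2) (smt (verit) real_norm_def)
  qed
  have F: "integrable lebesgue (\<lambda>x. f (x + a i) * g x)" for i
    using integrable_lebesgue_translate[OF G[of i], of "a i"] by simp
  have eq: "(LINT x|lebesgue. f (x + a i) * g x) = (LINT x|lebesgue. f x * g (x - a i))" for i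
    using integral_lebesgue_translate[OF G[of i], of "a i"] by simp
  have eqn: "(LINT x|lebesgue. cmod (f (x + a i) * g x)) = (LINT x|lebesgue. cmod (f x * g (x - a i)))" for i
    using integral_lebesgue_translate[OF integrable_norm[OF G[of i]], of "a i"] by simp
  have sum: "(\<lambda>i. LINT x|lebesgue. cmod (f x * g (x - a i))) summable_on I"
  proof (rule nonneg_bdd_above_summable_on)
    have "(\<Sum>i\<in>F. LINT x|lebesgue. cmod (f x * g (x - a i))) \<le> B * (LINT x|lebesgue. cmod (f x))"
      if "finite F" "F \<subseteq> I" for F
    proof -
      have "(\<Sum>i\<in>F. LINT x|lebesgue. cmod (f x * g (x - a i))) = (LINT x|lebesgue. (\<Sum>i\<in>F. cmod (f x * g (x - a i))))"
        using G by (intro Bochner_Integration.integral_sum[symmetric] integrable_norm)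
      also have "\<dots> \<le> (LINT x|lebesgue. B * cmod (f x))"
      proof (rule integral_mono)
        show "integrable lebesgue (\<lambda>x. \<Sum>i\<in>F. cmod (f x * g (x - a i)))"
          using G by (intro Bochner_Integration.integrable_sum integrable_norm)
        show "integrable lebesgue (\<lambda>x. B * cmod (f x))"
          using f by simp
        show "(\<Sum>i\<in>F. cmod (f x * g (x - a i))) \<le> B * cmod (f x)" for x
          using mult_left_mono[OF bound[OF that, of x], of "cmod (f x)"]
          by (simp add: norm_mult sum_distrib_left mult.commute)
      qed
      finally show ?thesis
        by simp
    qed
    thus "bdd_above (sum (\<lambda>i. LINT x|lebesgue. cmod (f x * g (x - a i))) ` {F. F \<subseteq> I \<and> finite F})"
      by (intro bdd_aboveI[of _ "B * (LINT x|lebesgue. cmod (f x))"]) auto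
  qed simp
  have "((\<lambda>i. LINT x|lebesgue. f x * g (x - a i)) has_sum (LINT x|lebesgue. (\<Sum>\<^sub>\<infinity>i\<in>I. f x * g (x - a i)))) I"
    by (rule has_sum_integral[OF I G sum])
  moreover have "((\<lambda>i. LINT x|lebesgue. f (x + a i) * g x) has_sum (LINT x|lebesgue. (\<Sum>\<^sub>\<infinity>i\<in>I. f (x + a i) * g x))) I"
    by (rule has_sum_integral[OF I F]) (use sum eqn in simp)
  ultimately have "(LINT x|lebesgue. (\<Sum>\<^sub>\<infinity>i\<in>I. f (x + a i) * g x)) = (LINT x|lebesgue. (\<Sum>\<^sub>\<infinity>i\<in>I. f x * g (x - a i)))"
    unfolding eq by (rule has_sum_unique[rotated])
  thus ?thesis
    unfolding infsum_cmult_left' infsum_cmult_right' .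
qed


section \<open>The integer lattice and trigonometric polynomials\<close>

lemma int_lattice_add: "j \<in> int_lattice \<Longrightarrow> k \<in> int_lattice \<Longrightarrow> j + k \<in> int_lattice"
  and int_lattice_diff: "j \<in> int_lattice \<Longrightarrow> k \<in> int_lattice \<Longrightarrow> j - k \<in> int_lattice"
  and int_lattice_uminus: "k \<in> int_lattice \<Longrightarrow> - k \<in> int_lattice"
  and zero_int_lattice: "0 \<in> int_lattice"
  and int_lattice_axis: "axis i 1 \<in> int_lattice"
  by (auto simp: int_lattice_def axis_def)

lemma inner_int_lattice: "j \<in> int_lattice \<Longrightarrow> k \<in> int_lattice \<Longrightarrow> j \<bullet> k \<in> \<int>"
  by (auto simp: int_lattice_def inner_vec_def)

lemma countable_int_lattice: "countable (int_lattice :: (real ^ 'n::finite) set)"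
proof -
  have "k \<in> range (\<lambda>f :: 'n \<Rightarrow> int. \<chi> i. of_int (f i))" if "k \<in> int_lattice" for k :: "real ^ 'n"
    using that by (intro image_eqI[of _ _ "\<lambda>i. \<lfloor>k $ i\<rfloor>"]) (auto simp: int_lattice_def vec_eq_iff elim!: Ints_cases)
  hence "int_lattice \<subseteq> range (\<lambda>f :: 'n \<Rightarrow> int. (\<chi> i. of_int (f i)) :: real ^ 'n)"
    by blast
  thus ?thesis
    by (rule countable_subset) simp
qed

lemma infinite_int_lattice: "infinite (int_lattice :: (real ^ 'n::finite) set)"
proof
  assume "finite (int_lattice :: (real ^ 'n) set)"
  moreover have "range (\<lambda>m::nat. \<chi> i. real m) \<subseteq> (int_lattice :: (real ^ 'n) set)"
    by (auto simp: int_lattice_def)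
  ultimately have "finite (range (\<lambda>m::nat. (\<chi> i. real m) :: real ^ 'n))"
    by (rule rev_finite_subset)
  moreover have "inj (\<lambda>m::nat. (\<chi> i. real m) :: real ^ 'n)"
    by (auto simp: inj_on_def vec_eq_iff)
  ultimately show False
    using finite_imageD by blast
qed

lemma bij_betw_uminus_int_lattice: "bij_betw uminus int_lattice int_lattice"
  by (rule bij_betwI[where g = uminus]) (auto intro: int_lattice_uminus)

lemma bij_betw_add_int_lattice: "k \<in> int_lattice \<Longrightarrow> bij_betw (\<lambda>j. j + k) int_lattice int_lattice"
  by (rule bij_betwI[where g = "\<lambda>j. j - k"]) (auto intro: int_lattice_add int_lattice_diff)

definition unit_cell :: "(real ^ 'n::finite) set" where
  "unit_cell = {x. \<forall>i. 0 \<le> x $ i \<and> x $ i < 1}"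

lemma diff_floor_unit_cell: "x - (\<chi> i. of_int \<lfloor>x $ i\<rfloor>) \<in> unit_cell"
  and floor_int_lattice: "(\<chi> i. of_int \<lfloor>x $ i\<rfloor>) \<in> int_lattice"
  unfolding unit_cell_def int_lattice_def by (auto, linarith+)

lemma unit_cell_unique:
  assumes "k \<in> int_lattice" "x - k \<in> unit_cell"
  shows "k = (\<chi> i. of_int \<lfloor>x $ i\<rfloor>)"
proof (rule vec_eq_iff[THEN iffD2], rule allI)
  fix i
  obtain n where n: "k $ i = of_int n"
    using assms(1) by (auto simp: int_lattice_def elim: Ints_cases)
  have "0 \<le> x $ i - k $ i" "x $ i - k $ i < 1"
    using assms(2) by (auto simp: unit_cell_def)
  hence "\<lfloor>x $ i\<rfloor> = n"
    unfolding n by linarith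
  thus "k $ i = (\<chi> i. of_int \<lfloor>x $ i\<rfloor>) $ i"
    by (simp add: n)
qed

lemma sets_unit_cell [measurable]: "unit_cell \<in> sets borel"
proof -
  have "unit_cell = (\<Inter>i. {x :: real ^ 'a. 0 \<le> x $ i} \<inter> {x. x $ i < 1})"
    by (auto simp: unit_cell_def)
  moreover have "{x :: real ^ 'a. 0 \<le> x $ i} \<inter> {x. x $ i < 1} \<in> sets borel" for i
    by (intro sets.Int borel_closed borel_open closed_Collect_le open_Collect_less continuous_intros)
  ultimately show ?thesis
    by (metis (no_types, lifting) UNIV_not_empty finite sets.finite_INT)
qed

lemma norm_unit_cell_le: "x \<in> unit_cell \<Longrightarrow> norm x \<le> real CARD('n)" for x :: "real ^ 'n::finite"
proof -
  assume x: "x \<in> unit_cell"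
  have "norm x \<le> (\<Sum>i\<in>UNIV. \<bar>x $ i\<bar>)"
    by (rule norm_le_l1_cart)
  also have "\<dots> \<le> (\<Sum>i\<in>(UNIV :: 'n set). 1)"
    using x by (intro sum_mono) (auto simp: unit_cell_def less_imp_le)
  finally show ?thesis
    by simp
qed

lemma sum_indicator_unit_cell:
  assumes "finite F" "F \<subseteq> int_lattice"
  shows "(\<Sum>k\<in>F. indicator unit_cell (x - k)) \<le> (1::real)"
proof -
  let ?k = "(\<chi> i. of_int \<lfloor>x $ i\<rfloor>) :: real ^ 'a"
  have "(\<Sum>k\<in>F. indicator unit_cell (x - k) :: real) \<le> (\<Sum>k\<in>F. if k = ?k then 1 else 0)"
    using assms unit_cell_unique[of _ x] by (intro sum_mono) (auto simp: indicator_def)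
  also have "\<dots> \<le> 1"
    using assms by (simp add: sum.delta)
  finally show ?thesis .
qed

lemma infsum_indicator_unit_cell:
  "(\<Sum>\<^sub>\<infinity>k\<in>int_lattice. indicator unit_cell (x - k)) = (1::complex)"
proof -
  let ?k = "(\<chi> i. of_int \<lfloor>x $ i\<rfloor>) :: real ^ 'a"
  have "(\<Sum>\<^sub>\<infinity>k\<in>int_lattice. indicator unit_cell (x - k)) = (\<Sum>\<^sub>\<infinity>k\<in>{?k}. 1 :: complex)"
  proof (rule infsum_cong_neutral)
    fix k assume "k \<in> int_lattice - {?k}"
    hence "x - k \<notin> unit_cell"
      using unit_cell_unique[of k x] by blast
    thus "indicator unit_cell (x - k) = (0 :: complex)"
      by simp
  qed (use diff_floor_unit_cell[of x] floor_int_lattice[of x] in simp_all)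
  thus ?thesis
    by simp
qed

text \<open>The exponential again, now as an opaque constant: products and periods are governed by the lemmas below
and are not rewritten inside the argument of \<open>cis\<close>.\<close>

definition character :: "real ^ 'n::finite \<Rightarrow> real ^ 'n \<Rightarrow> complex" where
  "character k x = wave k x"

lemma norm_character [simp]: "cmod (character k x) = 1"
  by (simp add: character_def)

lemma character_mult: "character j x * character k x = character (j + k) x"
  by (simp add: character_def cis_mult inner_add_left algebra_simps)

lemma character_periodic:
  assumes "k \<in> int_lattice" "j \<in> int_lattice"
  shows "character k (x + j) = character k x"
proof -
  have "character k (x + j) = wave k x * wave k j"
    unfolding character_def cis_mult by (simp add: inner_add_right algebra_simps)
  also have "wave k j = 1"
    using inner_int_lattice[OF assms] by (rule cis_multiple_2pi)
  finally show ?thesis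
    by (simp add: character_def)
qed

lemma continuous_character [continuous_intros]: "continuous_on S (character k)"
  unfolding character_def[abs_def] by (intro continuous_intros)

lemma measurable_character [measurable]: "character k \<in> borel_measurable borel"
  by (intro borel_measurable_continuous_onI continuous_intros)

text \<open>The half-open interval is the one whose integer translates are disjoint; for the fundamental theorem of
calculus it is replaced by the closed one.\<close>

lemma character_integral_real:
  assumes "m \<in> \<int>"
  shows "integrable lborel (\<lambda>r. indicator {0..<1::real} r * cis (2 * pi * (m * r)))"
    and "(LINT r|lborel. indicator {0..<1::real} r * cis (2 * pi * (m * r))) = (if m = 0 then 1 else 0)"
proof -
  have meas: "(\<lambda>r. cis (2 * pi * (m * r))) \<in> borel_measurable borel"
    by (intro borel_measurable_continuous_onI continuous_intros)
  have i1: "integrable lborel (\<lambda>r. indicator {0..<1::real} r :: complex)"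
  proof -
    have "integrable lborel (\<lambda>r. complex_of_real (indicator {0..<1::real} r))"
      by (intro integrable_of_real integrable_real_indicator) auto
    thus ?thesis
      by (simp add: of_real_indicator)
  qed
  show "integrable lborel (\<lambda>r. indicator {0..<1::real} r * cis (2 * pi * (m * r)))"
    by (rule Bochner_Integration.integrable_bound[OF i1]) (use meas in \<open>auto simp: norm_mult\<close>)
  show "(LINT r|lborel. indicator {0..<1::real} r * cis (2 * pi * (m * r))) = (if m = 0 then 1 else 0)"
  proof (cases "m = 0")
    case True
    have "(LINT r|lborel. complex_of_real (indicator {0..<1::real} r)) = 1"
      by (subst integral_complex_of_real) simp
    with True show ?thesis
      by (simp add: of_real_indicator)
  next
    case False
    let ?F = "\<lambda>r. cis (2 * pi * (m * r)) / (2 * pi * m * \<i>)"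
    have "(LINT r|lborel. indicator {0..<1::real} r * cis (2 * pi * (m * r))) =
        (LINT r|lborel. indicator {0..1::real} r *\<^sub>R cis (2 * pi * (m * r)))"
    proof (rule integral_cong_AE)
      show "AE r in lborel. indicator {0..<1::real} r * cis (2 * pi * (m * r)) = indicator {0..1} r *\<^sub>R cis (2 * pi * (m * r))"
        using AE_lborel_singleton[of "1::real"] by eventually_elim (auto simp: indicator_def)
    qed (use meas in auto)
    also have "\<dots> = ?F 1 - ?F 0"
    proof (rule integral_FTC_atLeastAtMost)
      fix r :: real
      have "((\<lambda>r. cis (2 * pi * (m * r))) has_vector_derivative (2 * pi * m) *\<^sub>R (\<i> * cis (2 * pi * (m * r)))) (at r within {0..1})"
        unfolding has_vector_derivative_def
        by (rule derivative_eq_intros refl | simp add: algebra_simps)+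
      hence "(?F has_vector_derivative ((2 * pi * m) *\<^sub>R (\<i> * cis (2 * pi * (m * r)))) / (2 * pi * m * \<i>)) (at r within {0..1})"
        by (rule has_vector_derivative_divide)
      thus "(?F has_vector_derivative cis (2 * pi * (m * r))) (at r within {0..1})"
        using False by (simp add: scaleR_conv_of_real)
    qed (auto intro!: continuous_intros)
    also have "cis (2 * pi * (m * 1)) = 1"
      using cis_multiple_2pi[OF assms] by simp
    hence "?F 1 - ?F 0 = 0"
      by simp
    finally show ?thesis
      using False by simp
  qed
qed

lemma integral_character_unit_cell:
  fixes k :: "real ^ 'n::finite"
  assumes "k \<in> int_lattice"
  shows "integrable lborel (\<lambda>x. indicator unit_cell x * character k x)"
    and "(LINT x|lborel. indicator unit_cell x * character k x) = (if k = 0 then 1 else 0)"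
proof -
  let ?f = "\<lambda>b r. indicator {0..<1::real} r * cis (2 * pi * ((k \<bullet> b) * r))"
  have Z: "k \<bullet> b \<in> \<int>" if "b \<in> Basis" for b
    using that assms by (auto simp: Basis_vec_def inner_axis int_lattice_def)
  have eq: "indicator unit_cell x * character k x = (\<Prod>b\<in>Basis. ?f b (x \<bullet> b))" for x
  proof -
    have "(\<Prod>b\<in>Basis. indicator {0..<1} (x \<bullet> b)) = (indicator unit_cell x :: complex)"
      by (auto simp: prod_Basis_cart inner_axis unit_cell_def indicator_def)
    moreover have "(\<Prod>b\<in>Basis. cis (2 * pi * ((k \<bullet> b) * (x \<bullet> b)))) = character k x"
      unfolding character_def euclidean_inner[of k x] cis_conv_exp sum_distrib_left of_real_sum exp_sum[OF finite_Basis] by simp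
    ultimately show ?thesis
      by (simp add: prod.distrib)
  qed
  show "integrable lborel (\<lambda>x. indicator unit_cell x * character k x)"
    unfolding eq by (intro integrable_lborel_prod character_integral_real Z)
  have "(LINT x|lborel. indicator unit_cell x * character k x) = (\<Prod>b\<in>Basis. if k \<bullet> b = 0 then 1 else 0)"
    unfolding eq by (subst integral_lborel_prod) (auto intro!: prod.cong character_integral_real Z)
  also have "\<dots> = (if \<forall>b\<in>Basis. k \<bullet> b = 0 then 1 else 0)"
    by auto
  also have "(\<forall>b\<in>Basis. k \<bullet> b = 0) \<longleftrightarrow> k = 0"
    by (simp add: euclidean_all_zero_iff)
  finally show "(LINT x|lborel. indicator unit_cell x * character k x) = (if k = 0 then 1 else 0)" .
qed

inductive_set trig_polynomials :: "(real ^ 'n::finite \<Rightarrow> complex) set" where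
  trig_character: "k \<in> int_lattice \<Longrightarrow> character k \<in> trig_polynomials"
| trig_add: "f \<in> trig_polynomials \<Longrightarrow> g \<in> trig_polynomials \<Longrightarrow> (\<lambda>x. f x + g x) \<in> trig_polynomials"
| trig_cmult: "f \<in> trig_polynomials \<Longrightarrow> (\<lambda>x. c * f x) \<in> trig_polynomials"

lemma trig_const: "(\<lambda>x. c) \<in> trig_polynomials"
  using trig_cmult[OF trig_character[OF zero_int_lattice], of c] by (simp add: character_def)

lemma trig_sum: "(\<And>i. i \<in> I \<Longrightarrow> f i \<in> trig_polynomials) \<Longrightarrow> (\<lambda>x. \<Sum>i\<in>I. f i x) \<in> trig_polynomials"
  by (induction I rule: infinite_finite_induct) (auto intro: trig_add trig_const)

lemma trig_mult:
  assumes "f \<in> trig_polynomials" "g \<in> trig_polynomials"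
  shows "(\<lambda>x. f x * g x) \<in> trig_polynomials"
  using assms(1)
proof induction
  case (trig_character k)
  show ?case
    using assms(2)
  proof induction
    case (trig_character j)
    have "(\<lambda>x. character k x * character j x) = character (k + j)"
      by (simp add: character_mult)
    thus ?case
      using int_lattice_add[OF \<open>k \<in> int_lattice\<close> trig_character] by (simp add: trig_polynomials.trig_character)
  next
    case (trig_add f g)
    thus ?case
      by (simp add: distrib_left trig_polynomials.trig_add)
  next
    case (trig_cmult f c)
    thus ?case
      using trig_polynomials.trig_cmult[of "\<lambda>x. character k x * f x" c] by (simp add: mult_ac)
  qed
next
  case (trig_add f h)
  thus ?case
    by (simp add: distrib_right trig_polynomials.trig_add)
next
  case (trig_cmult f c)
  thus ?case
    using trig_polynomials.trig_cmult[of "\<lambda>x. f x * g x" c] by (simp add: mult_ac)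
qed

lemma trig_cos_sin:
  shows "(\<lambda>x. complex_of_real (cos (2 * pi * (x $ i)))) \<in> trig_polynomials"
    and "(\<lambda>x. complex_of_real (sin (2 * pi * (x $ i)))) \<in> trig_polynomials"
proof -
  have e: "character (axis i 1) x = cis (2 * pi * x $ i)" "character (- axis i 1) x = cis (- (2 * pi * x $ i))" for x
    by (simp_all add: character_def inner_axis')
  have t: "character (axis i 1) \<in> trig_polynomials" "character (- axis i 1) \<in> trig_polynomials"
    by (intro trig_character int_lattice_uminus int_lattice_axis)+
  have "(\<lambda>x. (1 / 2) * (character (axis i 1) x + character (- axis i 1) x)) \<in> trig_polynomials"
    by (intro trig_cmult trig_add t)
  moreover have "(1 / 2) * (character (axis i 1) x + character (- axis i 1) x) = complex_of_real (cos (2 * pi * (x $ i)))" for x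
    unfolding e by (simp add: complex_eq_iff)
  ultimately show "(\<lambda>x. complex_of_real (cos (2 * pi * (x $ i)))) \<in> trig_polynomials"
    by simp
  have "(\<lambda>x. (- \<i> / 2) * (character (axis i 1) x + (- 1) * character (- axis i 1) x)) \<in> trig_polynomials"
    by (intro trig_cmult trig_add t)
  moreover have "(- \<i> / 2) * (character (axis i 1) x + (- 1) * character (- axis i 1) x) = complex_of_real (sin (2 * pi * (x $ i)))" for x
    unfolding e by (simp add: complex_eq_iff)
  ultimately show "(\<lambda>x. complex_of_real (sin (2 * pi * (x $ i)))) \<in> trig_polynomials"
    by simp
qed

definition torus_embedding :: "real ^ 'n::finite \<Rightarrow> (real ^ 'n) \<times> (real ^ 'n)" where
  "torus_embedding x = (\<chi> i. cos (2 * pi * (x $ i)), \<chi> i. sin (2 * pi * (x $ i)))"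

lemma torus_embedding_eq_iff: "torus_embedding x = torus_embedding y \<longleftrightarrow> x - y \<in> int_lattice"
proof -
  have "cos (2 * pi * a) = cos (2 * pi * b) \<and> sin (2 * pi * a) = sin (2 * pi * b) \<longleftrightarrow> a - b \<in> \<int>" for a b :: real
  proof
    assume "cos (2 * pi * a) = cos (2 * pi * b) \<and> sin (2 * pi * a) = sin (2 * pi * b)"
    then obtain n :: int where "2 * pi * a = 2 * pi * b + 2 * pi * n"
      using sin_cos_eq_iff[of "2 * pi * a" "2 * pi * b"] by auto
    hence "2 * pi * (a - b) = 2 * pi * n"
      by (simp add: algebra_simps)
    thus "a - b \<in> \<int>"
      by simp
  next
    assume "a - b \<in> \<int>"
    then obtain n where "a - b = of_int n"
      by (rule Ints_cases)
    hence "2 * pi * a = 2 * pi * b + 2 * pi * n"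
      by (simp add: algebra_simps)
    thus "cos (2 * pi * a) = cos (2 * pi * b) \<and> sin (2 * pi * a) = sin (2 * pi * b)"
      using sin_cos_eq_iff[of "2 * pi * a" "2 * pi * b"] by blast
  qed
  thus ?thesis
    by (auto simp: torus_embedding_def vec_eq_iff int_lattice_def)
qed

lemma continuous_torus_embedding: "continuous_on S torus_embedding"
  unfolding torus_embedding_def[abs_def] by (intro continuous_intros)

text \<open>The linear functions on the ambient space of the torus are combinations of \<open>cos (2\<pi>x\<^sub>i)\<close> and
\<open>sin (2\<pi>x\<^sub>i)\<close>, and trigonometric polynomials form an algebra.\<close>

lemma trig_real_polynomial_function:
  assumes "real_polynomial_function p"
  shows "(\<lambda>x. complex_of_real (p (torus_embedding x))) \<in> trig_polynomials"
  using assms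
proof induction
  case (linear f)
  interpret f: bounded_linear f by fact
  have "complex_of_real (f (torus_embedding x)) =
      (\<Sum>i\<in>UNIV. complex_of_real (f (axis i 1, 0)) * complex_of_real (cos (2 * pi * (x $ i)))) +
      (\<Sum>i\<in>UNIV. complex_of_real (f (0, axis i 1)) * complex_of_real (sin (2 * pi * (x $ i))))" for x
  proof -
    have v: "v = (\<Sum>i\<in>UNIV. v $ i *\<^sub>R axis i 1)" for v :: "real ^ 'a"
      using basis_expansion[of v] by (simp add: scalar_mult_eq_scaleR)
    have 1: "f (v, 0) = (\<Sum>i\<in>UNIV. v $ i * f (axis i 1, 0))" for v
    proof -
      have "bounded_linear (\<lambda>v. f (v, 0))"
        by (intro bounded_linear_compose[OF linear(1)] bounded_linear_Pair bounded_linear_ident bounded_linear_zero)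
      then interpret g: bounded_linear "\<lambda>v. f (v, 0)" .
      show ?thesis
        by (subst v) (simp add: g.sum g.scaleR)
    qed
    have 2: "f (0, v) = (\<Sum>i\<in>UNIV. v $ i * f (0, axis i 1))" for v
    proof -
      have "bounded_linear (\<lambda>v. f (0, v))"
        by (intro bounded_linear_compose[OF linear(1)] bounded_linear_Pair bounded_linear_ident bounded_linear_zero)
      then interpret g: bounded_linear "\<lambda>v. f (0, v)" .
      show ?thesis
        by (subst v) (simp add: g.sum g.scaleR)
    qed
    have "f (torus_embedding x) = f (fst (torus_embedding x), 0) + f (0, snd (torus_embedding x))"
      by (simp add: f.add[symmetric])
    thus ?thesis
      unfolding 1[of "fst (torus_embedding x)"] 2[of "snd (torus_embedding x)"] by (simp add: torus_embedding_def mult.commute)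
  qed
  thus ?case
    by (auto intro!: trig_add trig_sum trig_cmult trig_cos_sin)
next
  case (const c)
  show ?case
    by (rule trig_const)
next
  case (add f g)
  thus ?case
    by (simp add: trig_add)
next
  case (mult f g)
  thus ?case
    by (simp add: trig_mult)
qed

text \<open>A continuous periodic function descends to a continuous function on the image of the torus embedding. This image
is compact, so that polynomials are dense by the Stone-Weierstrass theorem.\<close>

lemma trig_dense_real:
  fixes D :: "real ^ 'n::finite \<Rightarrow> real"
  assumes cont: "continuous_on UNIV D" and per: "\<And>x k. k \<in> int_lattice \<Longrightarrow> D (x + k) = D x" and "e > 0"
  obtains p where "p \<in> trig_polynomials" "\<And>x. cmod (complex_of_real (D x) - p x) < e"
proof -
  let ?Q = "cbox 0 1 :: (real ^ 'n) set"
  let ?K = "torus_embedding ` ?Q"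
  define D' where "D' y = D (SOME x. torus_embedding x = y)" for y
  have D': "D' (torus_embedding x) = D x" for x
  proof -
    have "torus_embedding (SOME z. torus_embedding z = torus_embedding x) = torus_embedding x"
      by (rule someI[of _ x]) simp
    hence "(SOME z. torus_embedding z = torus_embedding x) - x \<in> int_lattice"
      by (simp add: torus_embedding_eq_iff)
    from per[OF this, of x] show ?thesis
      by (simp add: D'_def)
  qed
  have compact: "compact ?K"
    by (intro compact_continuous_image continuous_torus_embedding compact_cbox)
  have "continuous_on ?K D'"
    unfolding continuous_on_closed_vimage[OF compact_imp_closed[OF compact]]
  proof (intro allI impI)
    fix B :: "real set" assume "closed B"
    hence "compact (?Q \<inter> D -` B)"
      by (intro compact_Int_closed compact_cbox closed_vimage cont)
    hence "closed (torus_embedding ` (?Q \<inter> D -` B))"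
      by (intro compact_imp_closed compact_continuous_image continuous_torus_embedding)
    moreover have "torus_embedding ` (?Q \<inter> D -` B) = D' -` B \<inter> ?K"
      using D' by auto
    ultimately show "closed (D' -` B \<inter> ?K)"
      by simp
  qed
  then obtain g where g: "real_polynomial_function g" "\<And>y. y \<in> ?K \<Longrightarrow> \<bar>D' y - g y\<bar> < e"
    using Stone_Weierstrass_real_polynomial_function[OF compact _ \<open>e > 0\<close>] by metis
  show ?thesis
  proof (rule that[OF trig_real_polynomial_function[OF g(1)]])
    fix x :: "real ^ 'n"
    let ?k = "(\<chi> i. of_int \<lfloor>x $ i\<rfloor>) :: real ^ 'n"
    have "x - ?k \<in> ?Q"
      using diff_floor_unit_cell[of x] by (auto simp: unit_cell_def mem_box_cart less_imp_le)
    moreover have eq: "torus_embedding (x - ?k) = torus_embedding x"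
      using int_lattice_uminus[OF floor_int_lattice[of x]] by (simp add: torus_embedding_eq_iff)
    ultimately have "torus_embedding x \<in> ?K"
      by (metis imageI)
    from g(2)[OF this] show "cmod (complex_of_real (D x) - complex_of_real (g (torus_embedding x))) < e"
      unfolding D' of_real_diff[symmetric] norm_of_real .
  qed
qed

lemma trig_dense:
  fixes D :: "real ^ 'n::finite \<Rightarrow> complex"
  assumes cont: "continuous_on UNIV D" and per: "\<And>x k. k \<in> int_lattice \<Longrightarrow> D (x + k) = D x" and "e > 0"
  obtains p where "p \<in> trig_polynomials" "\<And>x. cmod (D x - p x) < e"
proof -
  obtain p where p: "p \<in> trig_polynomials" "\<And>x. cmod (complex_of_real (Re (D x)) - p x) < e / 2"
    by (rule trig_dense_real[of "\<lambda>x. Re (D x)" "e / 2"])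
      (use assms in \<open>auto intro!: continuous_intros\<close>)
  obtain r where r: "r \<in> trig_polynomials" "\<And>x. cmod (complex_of_real (Im (D x)) - r x) < e / 2"
    by (rule trig_dense_real[of "\<lambda>x. Im (D x)" "e / 2"])
      (use assms in \<open>auto intro!: continuous_intros\<close>)
  show ?thesis
  proof (rule that)
    show "(\<lambda>x. p x + \<i> * r x) \<in> trig_polynomials"
      by (intro trig_add trig_cmult p r)
    fix x
    have "D x - (p x + \<i> * r x) = (complex_of_real (Re (D x)) - p x) + \<i> * (complex_of_real (Im (D x)) - r x)"
      by (subst complex_eq[of "D x"]) (simp add: algebra_simps)
    also have "cmod \<dots> \<le> cmod (complex_of_real (Re (D x)) - p x) + cmod (complex_of_real (Im (D x)) - r x)"
      by (rule order_trans[OF norm_triangle_ineq]) (simp add: norm_mult)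
    also have "\<dots> < e"
      using p(2)[of x] r(2)[of x] by linarith
    finally show "cmod (D x - (p x + \<i> * r x)) < e" .
  qed
qed


section \<open>Periodization and Fourier series\<close>

lemma unit_cell_indicator:
  shows integrable_indicator_unit_cell: "integrable lborel (indicator unit_cell :: real ^ 'n::finite \<Rightarrow> real)"
    and integral_indicator_unit_cell: "(LINT x::real^'n|lborel. indicator unit_cell x) = (1::real)"
proof -
  have c: "complex_of_real (indicator unit_cell x) = indicator unit_cell x * character 0 x" for x :: "real ^ 'n"
    by (simp add: character_def of_real_indicator)
  have int: "integrable lborel (\<lambda>x::real^'n. complex_of_real (indicator unit_cell x))"
    unfolding c by (rule integral_character_unit_cell[OF zero_int_lattice])
  have "integrable lborel (\<lambda>x::real^'n. cmod (complex_of_real (indicator unit_cell x)))"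
    by (rule integrable_norm[OF int])
  thus "integrable lborel (indicator unit_cell :: real ^ 'n \<Rightarrow> real)"
    by simp
  have "(LINT x::real^'n|lborel. complex_of_real (indicator unit_cell x)) = 1"
    unfolding c using integral_character_unit_cell(2)[OF zero_int_lattice] by simp
  thus "(LINT x::real^'n|lborel. indicator unit_cell x) = (1::real)"
    unfolding integral_complex_of_real by simp
qed

text \<open>The value at \<open>k\<close> is comparable to the values on the cell \<open>k + [0,1)\<^sup>n\<close>. As the cells are disjoint, the sum is
bounded by an integral over the whole space.\<close>

lemma lattice_summable:
  "(\<lambda>k::real^'n::finite. 1 / (1 + norm k) ^ (2 * CARD('n))) summable_on int_lattice"
proof (rule nonneg_bdd_above_summable_on)
  let ?m = "2 * CARD('n)"
  define h where "h k = 1 / (1 + norm k) ^ ?m" for k :: "real ^ 'n"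
  define N where "N = (1 + real CARD('n)) ^ ?m"
  have hint: "integrable lborel h"
    using integrable_inverse_power_norm[where 'a = "real ^ 'n"] by (simp add: h_def[abs_def])
  have "(\<Sum>k\<in>F. h k) \<le> N * (LINT x|lborel. h x)" if F: "finite F" "F \<subseteq> int_lattice" for F
  proof -
    have tr: "integrable lborel (\<lambda>z. indicator unit_cell (z - k) :: real)"
      "(LINT z|lborel. indicator unit_cell (z - k)) = (1::real)" for k :: "real ^ 'n"
      using lborel_translate[of "indicator unit_cell :: real ^ 'n \<Rightarrow> real" "- k"]
        integrable_indicator_unit_cell integral_indicator_unit_cell by simp_all
    have tr': "integrable lborel (\<lambda>z. h k * indicator unit_cell (z - k))" for k
      by (intro integrable_mult_right tr)
    have le: "h k * indicator unit_cell (z - k) \<le> N * h z * indicator unit_cell (z - k)" for k z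
    proof (cases "z - k \<in> unit_cell")
      case True
      have pos: "1 + norm z > 0" "1 + norm k > 0"
        by (auto intro: add_pos_nonneg)
      have "1 + norm z \<le> (1 + norm k) * (1 + norm (z - k))"
        using norm_triangle_sub[of z k] by (intro one_plus_norm_mult_le) simp
      also have "\<dots> \<le> (1 + norm k) * (1 + real CARD('n))"
        using norm_unit_cell_le[OF True] by (intro mult_left_mono) auto
      finally have "(1 + norm z) ^ ?m \<le> (1 + norm k) ^ ?m * N"
        unfolding N_def power_mult_distrib[symmetric] by (intro power_mono) auto
      hence "h k \<le> N * h z"
        unfolding h_def using pos by (simp add: field_simps)
      thus ?thesis
        using True by simp
    qed simp
    have "(\<Sum>k\<in>F. h k) = (\<Sum>k\<in>F. LINT z|lborel. h k * indicator unit_cell (z - k))"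
      using tr(2) by simp
    also have "\<dots> = (LINT z|lborel. (\<Sum>k\<in>F. h k * indicator unit_cell (z - k)))"
      by (rule Bochner_Integration.integral_sum[symmetric]) (rule tr')
    also have "\<dots> \<le> (LINT z|lborel. N * h z)"
    proof (rule integral_mono)
      fix z
      have "(\<Sum>k\<in>F. h k * indicator unit_cell (z - k)) \<le> (\<Sum>k\<in>F. N * h z * indicator unit_cell (z - k))"
        by (intro sum_mono le)
      also have "\<dots> = N * h z * (\<Sum>k\<in>F. indicator unit_cell (z - k))"
        by (simp add: sum_distrib_left)
      also have "\<dots> \<le> N * h z * 1"
        by (intro mult_left_mono sum_indicator_unit_cell F) (simp add: N_def h_def)
      finally show "(\<Sum>k\<in>F. h k * indicator unit_cell (z - k)) \<le> N * h z"
        by simp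
    qed (intro Bochner_Integration.integrable_sum tr' integrable_mult_right hint)+
    finally show ?thesis
      by simp
  qed
  thus "bdd_above (sum (\<lambda>k::real^'n. 1 / (1 + norm k) ^ ?m) ` {F. F \<subseteq> int_lattice \<and> finite F})"
    unfolding h_def by (intro bdd_aboveI[of _ "N * (LINT x|lborel. h x)"]) (auto simp: h_def)
qed auto

lemma lattice_decay:
  fixes V :: "real ^ 'n::finite \<Rightarrow> complex"
  assumes "rapidly_decreasing V"
  obtains K where "K \<ge> 0"
    "\<And>x k R. norm x \<le> R \<Longrightarrow> cmod (V (x - k)) \<le> K * (1 + R) ^ (2 * CARD('n)) * (1 / (1 + norm k) ^ (2 * CARD('n)))"
proof -
  let ?m = "2 * CARD('n)"
  obtain K where K: "K \<ge> 0" "\<And>x. cmod (V x) \<le> K / (1 + norm x) ^ ?m"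
    using rapidly_decreasingE[OF assms, where n = ?m] by metis
  have "cmod (V (x - k)) \<le> K * (1 + R) ^ ?m * (1 / (1 + norm k) ^ ?m)" if R: "norm x \<le> R" for x k R
  proof -
    have pos: "1 + norm (x - k) > 0" "1 + norm k > 0" "1 + R > 0"
      using order_trans[OF norm_ge_zero R] by (auto intro: add_pos_nonneg)
    have "1 + norm k \<le> (1 + norm (x - k)) * (1 + norm x)"
      using norm_triangle_ineq4[of x "x - k"] by (intro one_plus_norm_mult_le) simp
    also have "\<dots> \<le> (1 + norm (x - k)) * (1 + R)"
      using R by (intro mult_left_mono) auto
    finally have "(1 + norm k) ^ ?m \<le> (1 + norm (x - k)) ^ ?m * (1 + R) ^ ?m"
      unfolding power_mult_distrib[symmetric] by (intro power_mono) auto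
    hence "1 / (1 + norm (x - k)) ^ ?m \<le> (1 + R) ^ ?m * (1 / (1 + norm k) ^ ?m)"
      using pos by (simp add: field_simps)
    from mult_left_mono[OF this K(1)] K(2)[of "x - k"] show ?thesis
      by (simp add: mult_ac)
  qed
  thus ?thesis
    using that K(1) by blast
qed

text \<open>The bound is uniform in \<open>x\<close>: a translation of the summation index by the integer part of \<open>x\<close> moves \<open>x\<close>
into the unit cell, where \<open>lattice_decay\<close> applies with a fixed radius.\<close>

lemma lattice_sum_bounded:
  fixes V :: "real ^ 'n::finite \<Rightarrow> complex"
  assumes "rapidly_decreasing V"
  obtains B where "\<And>x F. finite F \<Longrightarrow> F \<subseteq> int_lattice \<Longrightarrow> (\<Sum>k\<in>F. cmod (V (x - k))) \<le> B"
proof -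
  let ?m = "2 * CARD('n)"
  let ?h = "\<lambda>k::real^'n. 1 / (1 + norm k) ^ ?m"
  obtain K where K: "K \<ge> 0" "\<And>x k R. norm x \<le> R \<Longrightarrow> cmod (V (x - k)) \<le> K * (1 + R) ^ ?m * ?h k"
    using lattice_decay[OF assms] by blast
  let ?K = "K * (1 + real CARD('n)) ^ ?m"
  have "(\<Sum>k\<in>F. cmod (V (x - k))) \<le> ?K * infsum ?h int_lattice" if F: "finite F" "F \<subseteq> int_lattice" for x F
  proof -
    let ?j = "(\<chi> i. of_int \<lfloor>x $ i\<rfloor>) :: real ^ 'n"
    have "(\<Sum>k\<in>F. cmod (V (x - k))) = (\<Sum>k\<in>F. cmod (V ((x - ?j) - (k - ?j))))"
      by simp
    also have "\<dots> \<le> (\<Sum>k\<in>F. ?K * ?h (k - ?j))"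
      by (intro sum_mono K norm_unit_cell_le diff_floor_unit_cell)
    also have "\<dots> = ?K * (\<Sum>k\<in>(\<lambda>k. k - ?j) ` F. ?h k)"
      by (subst sum.reindex) (auto simp: sum_distrib_left)
    also have "\<dots> \<le> ?K * infsum ?h int_lattice"
      using F K(1) floor_int_lattice[of x]
      by (intro mult_left_mono finite_sum_le_infsum lattice_summable) (auto intro: int_lattice_diff)
    finally show ?thesis .
  qed
  thus ?thesis
    using that by blast
qed

lemma lattice_sum_continuous:
  fixes V :: "real ^ 'n::finite \<Rightarrow> complex"
  assumes "rapidly_decreasing V" "continuous_on UNIV V"
  shows "continuous_on UNIV (\<lambda>x. \<Sum>\<^sub>\<infinity>k\<in>int_lattice. V (x - k))"
proof -
  let ?m = "2 * CARD('n)"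
  obtain K where K: "K \<ge> 0" "\<And>x k R. norm x \<le> R \<Longrightarrow>
      cmod (V (x - k)) \<le> K * (1 + R) ^ ?m * (1 / (1 + norm k) ^ ?m)"
    using lattice_decay[OF assms(1)] by blast
  have ball: "continuous_on (ball 0 R) (\<lambda>x. \<Sum>\<^sub>\<infinity>k\<in>int_lattice. V (x - k))" for R
  proof (rule uniform_limit_theorem)
    show "uniform_limit (ball 0 R) (\<lambda>F x. \<Sum>k\<in>F. V (x - k)) (\<lambda>x. \<Sum>\<^sub>\<infinity>k\<in>int_lattice. V (x - k)) (finite_subsets_at_top int_lattice)"
    proof (rule Weierstrass_m_test_general)
      show "norm (V (x - k)) \<le> K * (1 + R) ^ ?m * (1 / (1 + norm k) ^ ?m)" if "x \<in> ball 0 R" for k x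
        using that by (intro K) auto
      show "(\<lambda>k::real^'n. K * (1 + R) ^ ?m * (1 / (1 + norm k) ^ ?m)) summable_on int_lattice"
        by (intro summable_on_cmult_right lattice_summable)
    qed
    show "\<forall>\<^sub>F F in finite_subsets_at_top int_lattice. continuous_on (ball 0 R) (\<lambda>x. \<Sum>k\<in>F. V (x - k))"
      by (intro always_eventually allI continuous_intros continuous_on_compose2[OF assms(2)]) auto
  qed simp
  have "continuous_on (\<Union>R\<in>(UNIV :: real set). ball (0 :: real ^ 'n) R) (\<lambda>x. \<Sum>\<^sub>\<infinity>k\<in>int_lattice. V (x - k))"
    by (rule continuous_on_open_UN) (auto intro: ball)
  moreover have "(\<Union>R\<in>(UNIV :: real set). ball (0 :: real ^ 'n) R) = UNIV"
    by (auto intro: lt_ex gt_ex)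
  ultimately show ?thesis
    by simp
qed

lemma lattice_sum_periodic:
  assumes "j \<in> int_lattice"
  shows "(\<Sum>\<^sub>\<infinity>k\<in>int_lattice. V (x + j - k)) = (\<Sum>\<^sub>\<infinity>k\<in>int_lattice. V (x - k))"
  using infsum_reindex_bij_betw[OF bij_betw_add_int_lattice[OF assms], of "\<lambda>k. V (x + j - k)"] by simp

lemma continuous_periodic_bounded:
  fixes D :: "real ^ 'n::finite \<Rightarrow> complex"
  assumes "continuous_on UNIV D" "\<And>x k. k \<in> int_lattice \<Longrightarrow> D (x + k) = D x"
  obtains B where "\<And>x. cmod (D x) \<le> B"
proof -
  have "bounded (D ` cball 0 (real CARD('n)))"
    using assms(1) by (intro compact_imp_bounded compact_continuous_image compact_cball) (auto intro: continuous_on_subset)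
  then obtain B where B: "\<And>x. x \<in> cball 0 (real CARD('n)) \<Longrightarrow> cmod (D x) \<le> B"
    unfolding bounded_iff by blast
  have "cmod (D x) \<le> B" for x
  proof -
    let ?j = "(\<chi> i. of_int \<lfloor>x $ i\<rfloor>) :: real ^ 'n"
    have "D x = D (x - ?j)"
      using assms(2)[OF floor_int_lattice[of x], of "x - ?j"] by simp
    thus ?thesis
      using B[of "x - ?j"] norm_unit_cell_le[OF diff_floor_unit_cell[of x]] by simp
  qed
  thus ?thesis
    using that by blast
qed

lemma trig_polynomials_continuous: "p \<in> trig_polynomials \<Longrightarrow> continuous_on UNIV p"
  by (induction rule: trig_polynomials.induct) (auto intro!: continuous_intros)

lemma trig_polynomials_bounded: "p \<in> trig_polynomials \<Longrightarrow> \<exists>B. \<forall>x. cmod (p x) \<le> B"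
proof (induction rule: trig_polynomials.induct)
  case (trig_add f g)
  then obtain A B where "\<And>x. cmod (f x) \<le> A" "\<And>x. cmod (g x) \<le> B"
    by blast
  hence "cmod (f x + g x) \<le> A + B" for x
    by (intro order_trans[OF norm_triangle_ineq] add_mono)
  then show ?case
    by blast
next
  case (trig_cmult f c)
  then obtain A where "\<And>x. cmod (f x) \<le> A"
    by blast
  hence "cmod (c * f x) \<le> cmod c * A" for x
    by (simp add: norm_mult mult_left_mono)
  then show ?case
    by blast
qed (auto intro: exI[of _ 1])

lemma integrable_mult_bounded_continuous:
  fixes q D :: "'a::euclidean_space \<Rightarrow> complex"
  assumes q: "integrable lebesgue q" and D: "continuous_on UNIV D" "\<And>x. cmod (D x) \<le> B"
  shows "integrable lebesgue (\<lambda>x. q x * D x)"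
    and "cmod (LINT x|lebesgue. q x * D x) \<le> B * (LINT x|lebesgue. cmod (q x))"
proof -
  have le: "cmod (q x * D x) \<le> B * cmod (q x)" for x
    using mult_left_mono[OF D(2)[of x], of "cmod (q x)"] by (simp add: norm_mult mult.commute)
  have "D \<in> borel_measurable lebesgue"
    using D(1) by (intro measurable_completion) (simp add: borel_measurable_continuous_onI)
  hence meas: "(\<lambda>x. q x * D x) \<in> borel_measurable lebesgue"
    using q by (intro borel_measurable_times) auto
  have le': "cmod (q x * D x) \<le> norm (B * cmod (q x))" for x
    using le[of x] by (smt (verit) real_norm_def)
  show int: "integrable lebesgue (\<lambda>x. q x * D x)"
    by (rule Bochner_Integration.integrable_bound[of _ "\<lambda>x. B * cmod (q x)"]) (use q meas le' in auto)
  have "cmod (LINT x|lebesgue. q x * D x) \<le> (LINT x|lebesgue. cmod (q x * D x))"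
    by (rule integral_norm_bound)
  also have "\<dots> \<le> (LINT x|lebesgue. B * cmod (q x))"
    by (rule integral_mono) (use int q le in auto)
  finally show "cmod (LINT x|lebesgue. q x * D x) \<le> B * (LINT x|lebesgue. cmod (q x))"
    by simp
qed

lemma fourier_series_continuous:
  fixes c :: "real ^ 'n::finite \<Rightarrow> complex"
  assumes "(\<lambda>k. cmod (c k)) summable_on int_lattice"
  shows "continuous_on UNIV (\<lambda>x. \<Sum>\<^sub>\<infinity>k\<in>int_lattice. c k * character k x)"
    and "cmod (\<Sum>\<^sub>\<infinity>k\<in>int_lattice. c k * character k x) \<le> (\<Sum>\<^sub>\<infinity>k\<in>int_lattice. cmod (c k))"
proof -
  show "continuous_on UNIV (\<lambda>x. \<Sum>\<^sub>\<infinity>k\<in>int_lattice. c k * character k x)"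
  proof (rule uniform_limit_theorem)
    show "uniform_limit UNIV (\<lambda>F x. \<Sum>k\<in>F. c k * character k x)
        (\<lambda>x. \<Sum>\<^sub>\<infinity>k\<in>int_lattice. c k * character k x) (finite_subsets_at_top int_lattice)"
      by (rule Weierstrass_m_test_general[OF _ assms]) (simp add: norm_mult)
    show "\<forall>\<^sub>F F in finite_subsets_at_top int_lattice. continuous_on UNIV (\<lambda>x. \<Sum>k\<in>F. c k * character k x)"
      by (intro always_eventually allI continuous_intros)
  qed simp
  show "cmod (\<Sum>\<^sub>\<infinity>k\<in>int_lattice. c k * character k x) \<le> (\<Sum>\<^sub>\<infinity>k\<in>int_lattice. cmod (c k))"
    using norm_infsum_bound[of "\<lambda>k. c k * character k x" int_lattice] assms by (simp add: norm_mult)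
qed

lemma integrable_lebesgue_indicator_unit_cell:
  "integrable lebesgue (indicator unit_cell :: real ^ 'n::finite \<Rightarrow> complex)"
  "(LINT x::real^'n|lebesgue. cmod (indicator unit_cell x)) = 1"
proof -
  have m: "(indicator unit_cell :: real ^ 'n \<Rightarrow> complex) \<in> borel_measurable borel"
    by measurable
  have c: "indicator unit_cell = (\<lambda>x::real^'n. complex_of_real (indicator unit_cell x))"
    by (auto simp: fun_eq_iff of_real_indicator)
  have "integrable lborel (indicator unit_cell :: real ^ 'n \<Rightarrow> complex)"
    unfolding c by (intro integrable_of_real integrable_indicator_unit_cell)
  thus "integrable lebesgue (indicator unit_cell :: real ^ 'n \<Rightarrow> complex)"
    using m by (subst integrable_completion) auto
  have "cmod (indicator unit_cell x) = indicator unit_cell x" for x :: "real ^ 'n"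
    by (simp add: indicator_def)
  hence "(LINT x::real^'n|lebesgue. cmod (indicator unit_cell x)) = (LINT x::real^'n|lebesgue. indicator unit_cell x)"
    by simp
  also have "\<dots> = (LINT x::real^'n|lborel. indicator unit_cell x)"
    by (rule integral_completion) measurable
  finally show "(LINT x::real^'n|lebesgue. cmod (indicator unit_cell x)) = 1"
    using integral_indicator_unit_cell[where 'n = 'n] by simp
qed

lemma has_sum_integral_fourier_series:
  fixes c :: "real ^ 'n::finite \<Rightarrow> complex"
  assumes c: "(\<lambda>k. cmod (c k)) summable_on int_lattice"
    and D: "continuous_on UNIV D" "\<And>x. cmod (D x) \<le> B"
  shows "((\<lambda>k. c k * (LINT x|lebesgue. indicator unit_cell x * (character k x * D x))) has_sum
    (LINT x|lebesgue. indicator unit_cell x * ((\<Sum>\<^sub>\<infinity>k\<in>int_lattice. c k * character k x) * D x))) int_lattice"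
proof -
  let ?F = "\<lambda>k x. indicator unit_cell x * (c k * character k x * D x)"
  have int: "integrable lebesgue (\<lambda>x. indicator unit_cell x * (character k x * D x))" for k :: "real ^ 'n"
    by (rule integrable_mult_bounded_continuous[OF integrable_lebesgue_indicator_unit_cell(1), of _ B])
      (use D in \<open>auto intro!: continuous_intros simp: norm_mult\<close>)
  have bound: "(LINT x|lebesgue. cmod (indicator unit_cell x * (character k x * D x))) \<le> B" for k :: "real ^ 'n"
  proof -
    have "(LINT x|lebesgue. cmod (indicator unit_cell x * (character k x * D x))) \<le>
        (LINT x::real^'n|lebesgue. B * cmod (indicator unit_cell x))"
    proof (rule integral_mono)
      fix x
      show "cmod (indicator unit_cell x * (character k x * D x)) \<le> B * cmod (indicator unit_cell x)"
        using D(2)[of x] by (auto simp: norm_mult indicator_def)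
    qed (intro integrable_norm int integrable_mult_right integrable_lebesgue_indicator_unit_cell(1))+
    thus ?thesis
      by (simp add: integrable_lebesgue_indicator_unit_cell(2))
  qed
  have F: "?F k x = c k * (indicator unit_cell x * (character k x * D x))" for k x
    by (simp add: mult_ac)
  have "((\<lambda>k. LINT x|lebesgue. ?F k x) has_sum (LINT x|lebesgue. (\<Sum>\<^sub>\<infinity>k\<in>int_lattice. ?F k x))) int_lattice"
  proof (rule has_sum_integral[OF countable_int_lattice infinite_int_lattice])
    show "integrable lebesgue (?F k)" for k
      unfolding F by (intro integrable_mult_right int)
    show "(\<lambda>k. LINT x|lebesgue. cmod (?F k x)) summable_on int_lattice"
    proof (rule summable_on_comparison_test)
      show "(\<lambda>k. cmod (c k) * B) summable_on int_lattice"
        by (rule summable_on_cmult_left[OF c])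
      show "(LINT x|lebesgue. cmod (?F k x)) \<le> cmod (c k) * B" for k
        unfolding F norm_mult[of "c k"] using mult_left_mono[OF bound[of k], of "cmod (c k)"] by simp
    qed auto
  qed
  moreover have "(LINT x|lebesgue. ?F k x) = c k * (LINT x|lebesgue. indicator unit_cell x * (character k x * D x))" for k
    unfolding F by (rule integral_mult_right_zero)
  moreover have "(\<Sum>\<^sub>\<infinity>k\<in>int_lattice. ?F k x) = indicator unit_cell x * ((\<Sum>\<^sub>\<infinity>k\<in>int_lattice. c k * character k x) * D x)" for x
    by (simp only: infsum_cmult_left' infsum_cmult_right')
  ultimately show ?thesis
    by simp
qed

lemma dual_lattice_inner:
  "(inv_transpose L *v k) \<bullet> y = k \<bullet> (matrix_inv L *v y)"
  unfolding inv_transpose_def by (simp add: dot_lmul_matrix matrix_vector_mul_assoc flip: vector_transpose_matrix)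

lemma matrix_inv_vector:
  fixes L :: "real ^ 'n::finite ^ 'n"
  assumes "invertible L"
  shows "matrix_inv L *v (L *v x) = x" "L *v (matrix_inv L *v x) = x"
  using someI_ex[OF assms[unfolded invertible_def]]
  by (simp_all add: matrix_vector_mul_assoc matrix_inv_def)

lemma continuous_on_matrix_vector [continuous_intros]:
  fixes A :: "real ^ 'n::finite ^ 'm::finite"
  shows "continuous_on S f \<Longrightarrow> continuous_on S (\<lambda>x. A *v f x)"
  by (rule bounded_linear.continuous_on[OF matrix_vector_mul_bounded_linear])

text \<open>The functional \<open>E\<close> of the proof is the difference of both sides. It is bounded with respect to the supremum norm, and it
vanishes on exponentials: the left-hand side is a Fourier coefficient of \<open>q\<close> by definition, the right-hand
side by orthogonality. Hence it vanishes on trigonometric polynomials, and by density on all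
continuous periodic functions.\<close>

lemma integral_periodic_pairing:
  fixes q :: "real ^ 'n::finite \<Rightarrow> complex" and L :: "real ^ 'n ^ 'n"
  assumes L: "invertible L" and q: "integrable lebesgue q"
    and c: "(\<lambda>k. cmod (fourier q (inv_transpose L *v k))) summable_on int_lattice"
    and D: "continuous_on UNIV D" "\<And>x k. k \<in> int_lattice \<Longrightarrow> D (x + k) = D x"
  shows "(LINT z|lebesgue. q z * D (matrix_inv L *v z)) =
    (LINT x|lebesgue. indicator unit_cell x *
       ((\<Sum>\<^sub>\<infinity>k\<in>int_lattice. fourier q (inv_transpose L *v k) * character k x) * D x))"
proof -
  define cf where "cf k = fourier q (inv_transpose L *v k)" for k
  define S where "S x = (\<Sum>\<^sub>\<infinity>k\<in>int_lattice. cf k * character k x)" for x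
  define M where "M = (\<Sum>\<^sub>\<infinity>k\<in>int_lattice. cmod (cf k))"
  have cf: "(\<lambda>k. cmod (cf k)) summable_on int_lattice"
    using c by (simp add: cf_def)
  have S: "continuous_on UNIV S" "\<And>x. cmod (S x) \<le> M"
    unfolding S_def[abs_def] M_def using fourier_series_continuous[OF cf] by blast+
  define E where "E f = (LINT z|lebesgue. q z * f (matrix_inv L *v z)) - (LINT x|lebesgue. indicator unit_cell x * (S x * f x))" for f
  have int: "integrable lebesgue (\<lambda>z. q z * f (matrix_inv L *v z))"
      "integrable lebesgue (\<lambda>x. indicator unit_cell x * (S x * f x))"
      "cmod (E f) \<le> B * ((LINT z|lebesgue. cmod (q z)) + M)"
    if f: "continuous_on UNIV f" "\<And>x. cmod (f x) \<le> B" for f B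
  proof -
    have cont: "continuous_on UNIV (\<lambda>z. f (matrix_inv L *v z))"
      by (intro continuous_on_compose2[OF f(1)] continuous_intros) auto
    have M: "M \<ge> 0"
      unfolding M_def by (intro infsum_nonneg) auto
    have SfB: "cmod (S x * f x) \<le> M * B" for x
      unfolding norm_mult using S(2) f(2) M by (intro mult_mono) auto
    have Sf: "continuous_on UNIV (\<lambda>x. S x * f x)"
      by (intro continuous_intros S f)
    show "integrable lebesgue (\<lambda>z. q z * f (matrix_inv L *v z))"
      by (rule integrable_mult_bounded_continuous[OF q cont f(2)])
    show "integrable lebesgue (\<lambda>x. indicator unit_cell x * (S x * f x))"
      by (rule integrable_mult_bounded_continuous[OF integrable_lebesgue_indicator_unit_cell(1) Sf SfB])
    have "cmod (E f) \<le> cmod (LINT z|lebesgue. q z * f (matrix_inv L *v z)) + cmod (LINT x|lebesgue. indicator unit_cell x * (S x * f x))"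
      unfolding E_def by (rule norm_triangle_ineq4)
    also have "\<dots> \<le> B * (LINT z|lebesgue. cmod (q z)) + M * B * (LINT x::real^'n|lebesgue. cmod (indicator unit_cell x))"
      by (intro add_mono integrable_mult_bounded_continuous(2)[OF q cont f(2)]
          integrable_mult_bounded_continuous(2)[OF integrable_lebesgue_indicator_unit_cell(1) Sf SfB])
    finally show "cmod (E f) \<le> B * ((LINT z|lebesgue. cmod (q z)) + M)"
      by (simp add: integrable_lebesgue_indicator_unit_cell(2) algebra_simps)
  qed
  have E_char: "E (character j) = 0" if j: "j \<in> int_lattice" for j
  proof -
    have "(LINT z|lebesgue. q z * character j (matrix_inv L *v z)) = cf (- j)"
      unfolding cf_def fourier_def character_def dual_lattice_inner by (simp add: inner_minus_left)
    have hs: "((\<lambda>k. cf k * (LINT x|lebesgue. indicator unit_cell x * (character k x * character j x))) has_sum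
        (LINT x|lebesgue. indicator unit_cell x * (S x * character j x))) int_lattice"
      unfolding S_def by (rule has_sum_integral_fourier_series[OF cf, of _ 1]) (auto intro: continuous_intros)
    have val: "cf k * (LINT x|lebesgue. indicator unit_cell x * (character k x * character j x)) = (if k = - j then cf (- j) else 0)"
      if k: "k \<in> int_lattice" for k
    proof -
      have "(LINT x|lebesgue. indicator unit_cell x * (character k x * character j x)) =
          (LINT x|lborel. indicator unit_cell x * character (k + j) x)"
        unfolding character_mult by (rule integral_completion) measurable
      also have "\<dots> = (if k + j = 0 then 1 else 0)"
        by (rule integral_character_unit_cell(2)[OF int_lattice_add[OF k j]])
      finally show ?thesis
        by (auto simp: add_eq_0_iff2)
    qed
    from hs have "((\<lambda>k. if k = - j then cf (- j) else 0) has_sum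
        (LINT x|lebesgue. indicator unit_cell x * (S x * character j x))) int_lattice"
      by (rule has_sum_cong[THEN iffD1, rotated]) (rule val)
    moreover have "((\<lambda>k. if k = - j then cf (- j) else 0) has_sum cf (- j)) int_lattice"
      using has_sum_finite_neutralI[of "{- j}" int_lattice "\<lambda>k. if k = - j then cf (- j) else 0" "cf (- j)"]
        int_lattice_uminus[OF j] by simp
    ultimately have "(LINT x|lebesgue. indicator unit_cell x * (S x * character j x)) = cf (- j)"
      by (rule has_sum_unique)
    with \<open>(LINT z|lebesgue. q z * character j (matrix_inv L *v z)) = cf (- j)\<close> show ?thesis
      by (simp add: E_def)
  qed
  have E_add: "E (\<lambda>x. f x + g x) = E f + E g"
    if "continuous_on UNIV f" "\<And>x. cmod (f x) \<le> A" "continuous_on UNIV g" "\<And>x. cmod (g x) \<le> B" for f g A B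
    unfolding E_def using int(1,2)[OF that(1,2)] int(1,2)[OF that(3,4)] by (simp add: distrib_left)
  have E_cmult: "E (\<lambda>x. a * f x) = a * E f" for f a
    unfolding E_def mult.left_commute[of _ a] integral_mult_right_zero by (simp add: algebra_simps)
  have E_trig: "E p = 0" if "p \<in> trig_polynomials" for p
    using that
  proof induction
    case (trig_add f g)
    obtain A B where "\<And>x. cmod (f x) \<le> A" "\<And>x. cmod (g x) \<le> B"
      using trig_polynomials_bounded trig_add.hyps by meson
    thus ?case
      using trig_add E_add[of f A g B] trig_polynomials_continuous by auto
  qed (simp_all add: E_char E_cmult)
  obtain BD where BD: "\<And>x. cmod (D x) \<le> BD"
    using continuous_periodic_bounded[OF D] by blast
  have small: "cmod (E D) \<le> e * ((LINT z|lebesgue. cmod (q z)) + M)" if "e > 0" for e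
  proof -
    obtain p where p: "p \<in> trig_polynomials" "\<And>x. cmod (D x - p x) < e"
      using trig_dense[OF D \<open>e > 0\<close>] by blast
    obtain B where B: "\<And>x. cmod (p x) \<le> B"
      using trig_polynomials_bounded[OF p(1)] by blast
    have cont: "continuous_on UNIV (\<lambda>x. D x - p x)"
      by (intro continuous_intros D trig_polynomials_continuous p)
    have "E D = E (\<lambda>x. (D x - p x) + p x)"
      by simp
    also have "\<dots> = E (\<lambda>x. D x - p x) + E p"
      by (rule E_add[OF cont _ trig_polynomials_continuous[OF p(1)] B]) (rule less_imp_le[OF p(2)])
    also have "\<dots> = E (\<lambda>x. D x - p x)"
      by (simp add: E_trig[OF p(1)])
    finally show ?thesis
      using int(3)[OF cont less_imp_le[OF p(2)]] by simp
  qed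
  have "E D = 0"
  proof (rule ccontr)
    assume "E D \<noteq> 0"
    let ?A = "(LINT z|lebesgue. cmod (q z)) + M"
    have A: "?A \<ge> 0"
      unfolding M_def by (intro add_nonneg_nonneg infsum_nonneg) auto
    have "cmod (E D) \<le> (cmod (E D) / 2 / (?A + 1)) * ?A"
      using \<open>E D \<noteq> 0\<close> A by (intro small) auto
    also have "\<dots> \<le> cmod (E D) / 2"
      using A by (simp add: field_simps)
    finally show False
      using \<open>E D \<noteq> 0\<close> by simp
  qed
  thus ?thesis
    by (simp add: E_def S_def cf_def)
qed

lemma rapidly_decreasing_matrix:
  fixes L :: "real ^ 'n::finite ^ 'n"
  assumes L: "invertible L" and W: "rapidly_decreasing W"
  shows "rapidly_decreasing (\<lambda>x. W (L *v x))"
proof (rule rapidly_decreasingI)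
  fix n
  obtain K where K: "\<And>x. (1 + norm x) ^ n * cmod (W x) \<le> K"
    using W unfolding rapidly_decreasing_def by blast
  obtain B where B: "B > 0" "\<And>x. norm (matrix_inv L *v x) \<le> norm x * B"
    using bounded_linear.pos_bounded[OF matrix_vector_mul_bounded_linear[of "matrix_inv L"]] by blast
  have "(1 + norm x) ^ n * cmod (W (L *v x)) \<le> (1 + B) ^ n * K" for x
  proof -
    have "norm x \<le> norm (L *v x) * B"
      using B(2)[of "L *v x"] by (simp add: matrix_inv_vector[OF L])
    also have "\<dots> \<le> B + (1 + B) * norm (L *v x)"
      using B(1) by (simp add: algebra_simps)
    finally have "1 + norm x \<le> (1 + B) * (1 + norm (L *v x))"
      by (simp add: algebra_simps)
    hence "(1 + norm x) ^ n \<le> (1 + B) ^ n * (1 + norm (L *v x)) ^ n"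
      unfolding power_mult_distrib[symmetric] by (intro power_mono) auto
    hence "(1 + norm x) ^ n * cmod (W (L *v x)) \<le> (1 + B) ^ n * (1 + norm (L *v x)) ^ n * cmod (W (L *v x))"
      by (intro mult_right_mono) auto
    also have "\<dots> = (1 + B) ^ n * ((1 + norm (L *v x)) ^ n * cmod (W (L *v x)))"
      by simp
    also have "\<dots> \<le> (1 + B) ^ n * K"
      using B(1) by (intro mult_left_mono K) auto
    finally show ?thesis .
  qed
  thus "\<exists>K. \<forall>x. (1 + norm x) ^ n * cmod (W (L *v x)) \<le> K"
    by blast
qed

text \<open>A form of the Poisson summation formula in which the coefficients of \<open>q\<close>, instead of those of
\<open>W\<close>, are summable. The integral of \<open>q\<^sub>L W\<close> is the pairing of \<open>q\<close> with the continuous periodic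
function \<open>P\<close>, the periodization of \<open>W \<circ> L\<close>; the Fourier coefficients of \<open>P\<close> are obtained by
unfolding and by the substitution \<open>z = L x\<close>.\<close>

theorem has_sum_integral_periodization:
  fixes q :: "real ^ 'n::finite \<Rightarrow> complex" and L :: "real ^ 'n ^ 'n"
  assumes L: "invertible L" and q: "integrable lebesgue q"
    and c: "(\<lambda>k. cmod (fourier q (inv_transpose L *v k))) summable_on int_lattice"
    and W: "continuous_on UNIV W" "rapidly_decreasing W"
  shows "((\<lambda>k. fourier q (inv_transpose L *v k) / \<bar>det L\<bar> *
      (LINT z|lborel. wave (inv_transpose L *v k) z * W z)) has_sum
    (LINT z|lebesgue. periodization L q z * W z)) int_lattice"
proof -
  define V where "V x = W (L *v x)" for x
  have V: "rapidly_decreasing V" "continuous_on UNIV V"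
    unfolding V_def[abs_def]
    by (auto intro!: rapidly_decreasing_matrix L W continuous_on_compose2[OF W(1)] continuous_intros)
  obtain B where B: "\<And>x F. finite F \<Longrightarrow> F \<subseteq> int_lattice \<Longrightarrow> (\<Sum>k\<in>F. cmod (V (x - k))) \<le> B"
    using lattice_sum_bounded[OF V(1)] by blast
  define P where "P x = (\<Sum>\<^sub>\<infinity>k\<in>int_lattice. V (x - k))" for x
  have P: "continuous_on UNIV P" "\<And>x k. k \<in> int_lattice \<Longrightarrow> P (x + k) = P x"
    unfolding P_def[abs_def] by (auto intro: lattice_sum_continuous V lattice_sum_periodic)
  obtain BP where BP: "\<And>x. cmod (P x) \<le> BP"
    using continuous_periodic_bounded[OF P] by blast
  have VW: "W (z - L *v k) = V (matrix_inv L *v z - k)" for z k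
    by (simp add: V_def matrix_vector_mult_diff_distrib matrix_inv_vector[OF L])
  have "(LINT z|lebesgue. periodization L q z * W z) = (LINT z|lebesgue. q z * P (matrix_inv L *v z))"
    unfolding periodization_def P_def VW[symmetric]
    by (rule integral_unfolding[OF countable_int_lattice infinite_int_lattice q, of _ _ B])
      (use W B in \<open>auto simp: VW intro: borel_measurable_continuous_onI\<close>)
  also have "\<dots> = (LINT x|lebesgue. indicator unit_cell x *
       ((\<Sum>\<^sub>\<infinity>k\<in>int_lattice. fourier q (inv_transpose L *v k) * character k x) * P x))"
    by (rule integral_periodic_pairing[OF L q c P])
  finally have pairing: "(LINT z|lebesgue. periodization L q z * W z) =
     (LINT x|lebesgue. indicator unit_cell x *
       ((\<Sum>\<^sub>\<infinity>k\<in>int_lattice. fourier q (inv_transpose L *v k) * character k x) * P x))" .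
  have coeff: "(LINT x|lebesgue. indicator unit_cell x * (character k x * P x)) =
      (LINT z|lborel. wave (inv_transpose L *v k) z * W z) / \<bar>det L\<bar>"
    if k: "k \<in> int_lattice" for k
  proof -
    let ?f = "\<lambda>x. character k x * V x" and ?g = "\<lambda>z. wave (inv_transpose L *v k) z * W z"
    have f_meas: "?f \<in> borel_measurable borel"
      by (intro borel_measurable_continuous_onI continuous_intros V)
    have "rapidly_decreasing ?f"
      by (rule rapidly_decreasing_mono[OF V(1), of _ 1 0]) (auto simp: norm_mult)
    hence f: "integrable lebesgue ?f"
      using f_meas by (subst integrable_completion) (auto intro: integrable_rapidly_decreasing)
    have per: "(\<Sum>\<^sub>\<infinity>j\<in>int_lattice. ?f (x + j)) = character k x * P x" for x
    proof -
      have "(\<Sum>\<^sub>\<infinity>j\<in>int_lattice. ?f (x + j)) = (\<Sum>\<^sub>\<infinity>j\<in>int_lattice. character k x * V (x + j))"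
        by (intro infsum_cong) (simp add: character_periodic k)
      also have "\<dots> = character k x * (\<Sum>\<^sub>\<infinity>j\<in>int_lattice. V (x + j))"
        by (rule infsum_cmult_right')
      also have "(\<Sum>\<^sub>\<infinity>j\<in>int_lattice. V (x + j)) = P x"
        unfolding P_def using infsum_reindex_bij_betw[OF bij_betw_uminus_int_lattice, of "\<lambda>j. V (x + j)"] by simp
      finally show ?thesis .
    qed
    have "(LINT x|lebesgue. indicator unit_cell x * (character k x * P x)) =
        (LINT x|lebesgue. (\<Sum>\<^sub>\<infinity>j\<in>int_lattice. ?f (x + j)) * indicator unit_cell x)"
      unfolding per by (simp add: mult.commute)
    also have "\<dots> = (LINT x|lebesgue. ?f x * (\<Sum>\<^sub>\<infinity>j\<in>int_lattice. indicator unit_cell (x - j)))"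
    proof (rule integral_unfolding[OF countable_int_lattice infinite_int_lattice f])
      fix x and F :: "(real ^ 'n) set" assume F: "finite F" "F \<subseteq> int_lattice"
      have "cmod (indicator unit_cell y) = indicator unit_cell y" for y :: "real ^ 'n"
        by (simp add: indicator_def)
      thus "(\<Sum>j\<in>F. cmod (indicator unit_cell (x - j))) \<le> 1"
        using sum_indicator_unit_cell[OF F, of x] by simp
    qed measurable
    also have "\<dots> = (LINT x|lebesgue. ?f x)"
      by (simp add: infsum_indicator_unit_cell)
    also have "\<dots> = (LINT x|lborel. ?f x)"
      by (rule integral_completion) (use f_meas in simp)
    also have "\<dots> = (LINT x|lborel. ?g (L *v x))"
      unfolding dual_lattice_inner matrix_inv_vector[OF L] character_def V_def ..
    also have "\<dots> = (LINT z|lborel. ?g z) / \<bar>det L\<bar>"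
    proof -
      have det: "det L \<noteq> 0"
        using L by (simp add: invertible_det_nz)
      have "?g \<in> borel_measurable borel"
        by (intro borel_measurable_continuous_onI continuous_intros W)
      hence "(LINT z|lborel. ?g z) = \<bar>det (matrix ((*v) L))\<bar> * (LINT x|lborel. ?g (L *v x))"
        using det by (intro integral_linear_change_of_variables) (auto simp: matrix_of_matrix_vector_mul)
      thus ?thesis
        using det by (simp add: matrix_of_matrix_vector_mul)
    qed
    finally show ?thesis .
  qed
  have "((\<lambda>k. fourier q (inv_transpose L *v k) * (LINT x|lebesgue. indicator unit_cell x * (character k x * P x))) has_sum
     (LINT z|lebesgue. periodization L q z * W z)) int_lattice"
    unfolding pairing by (rule has_sum_integral_fourier_series[OF c P(1) BP])
  thus ?thesis
    by (rule has_sum_cong[THEN iffD1, rotated]) (simp add: coeff)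
qed


section \<open>Complex linear operators\<close>

lemma scaleC_one [simp]: "1 *\<^sub>C x = x"
  using scaleR_scaleC[of 1 x] by simp

lemma bounded_linear_scaleC: "bounded_linear (\<lambda>x::'x::complex_banach. c *\<^sub>C x)"
proof (rule bounded_linear_intro)
  fix r and x :: 'x
  show "c *\<^sub>C (r *\<^sub>R x) = r *\<^sub>R (c *\<^sub>C x)"
    by (simp add: scaleR_scaleC scaleC_scaleC mult.commute)
  show "norm (c *\<^sub>C x) \<le> norm x * cmod c"
    by (simp add: norm_scaleC)
qed (rule scaleC_add_right)

definition scalar_op :: "complex \<Rightarrow> 'x::complex_banach \<Rightarrow>\<^sub>L 'x" where
  "scalar_op c = Blinfun (\<lambda>x. c *\<^sub>C x)"

lemma scalar_op_apply [simp]: "blinfun_apply (scalar_op c) x = c *\<^sub>C x"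
  unfolding scalar_op_def by (simp add: bounded_linear_Blinfun_apply bounded_linear_scaleC)

lemma norm_scalar_op_le: "norm (scalar_op c :: 'x::complex_banach \<Rightarrow>\<^sub>L 'x) \<le> cmod c"
  by (rule norm_blinfun_bound) (simp_all add: norm_scaleC)

lemma scaleC_diff_right: "c *\<^sub>C (x - y) = c *\<^sub>C x - c *\<^sub>C (y :: 'x::complex_banach)"
  using linear_diff[OF bounded_linear.linear[OF bounded_linear_scaleC]] by blast

lemma scaleC_left_commute: "a *\<^sub>C b *\<^sub>C x = b *\<^sub>C a *\<^sub>C (x :: 'x::complex_banach)"
  by (simp add: scaleC_scaleC mult.commute)

text \<open>The equation \<open>c x + R x = y\<close> is the fixed point equation of \<open>x \<mapsto> c\<^sup>-\<^sup>1 (y - R x)\<close>, a contraction. Linearity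
of the solution operator follows from uniqueness, its norm bound from \<open>\<bar>c\<bar> \<bar>x\<bar> - \<parallel>R\<parallel> \<bar>x\<bar> \<le> \<bar>c x + R x\<bar>\<close>.\<close>

lemma perturbed_scalar_inverse:
  fixes R :: "'x::complex_banach \<Rightarrow>\<^sub>L 'x"
  assumes R: "complex_linear R" "norm R < cmod c"
  obtains B where "complex_linear B" "(scalar_op c + R) o\<^sub>L B = id_blinfun" "B o\<^sub>L (scalar_op c + R) = id_blinfun"
    "norm B \<le> 1 / (cmod c - norm R)"
proof -
  let ?A = "scalar_op c + R"
  have c: "cmod c > 0" "c \<noteq> 0"
    using R(2) norm_ge_zero[of R] by auto
  have A: "blinfun_apply ?A x = c *\<^sub>C x + R x" for x
    by (simp add: blinfun.add_left)
  have lower: "(cmod c - norm R) * norm x \<le> norm (?A x)" for x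
  proof -
    have "cmod c * norm x - norm R * norm x \<le> norm (c *\<^sub>C x) - norm (R x)"
      using norm_blinfun[of R x] by (simp add: norm_scaleC)
    also have "\<dots> \<le> norm (?A x)"
      using norm_diff_ineq[of "c *\<^sub>C x" "R x"] by (simp add: A)
    finally show ?thesis
      by (simp add: left_diff_distrib)
  qed
  have inj: "x = y" if "?A x = ?A y" for x y
  proof -
    have "(cmod c - norm R) * norm (x - y) \<le> 0"
      using lower[of "x - y"] that by (simp add: blinfun.diff_right)
    hence "norm (x - y) \<le> 0"
      using R(2) by (simp add: mult_le_0_iff)
    thus ?thesis
      by simp
  qed
  have "\<exists>x. ?A x = y" for y
  proof -
    let ?g = "\<lambda>x. inverse c *\<^sub>C (y - R x)"
    have "\<exists>!x. ?g x = x"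
    proof (rule banach_fix_type[of "norm R / cmod c"])
      show "0 \<le> norm R / cmod c" "norm R / cmod c < 1"
        using R(2) c by auto
      show "\<forall>x x'. dist (?g x) (?g x') \<le> norm R / cmod c * dist x x'"
      proof (intro allI)
        fix x x'
        have "dist (?g x) (?g x') = inverse (cmod c) * norm (R (x' - x))"
          by (simp add: dist_norm norm_scaleC norm_inverse blinfun.diff_right flip: scaleC_diff_right)
        also have "\<dots> \<le> inverse (cmod c) * (norm R * norm (x' - x))"
          by (intro mult_left_mono norm_blinfun) auto
        finally show "dist (?g x) (?g x') \<le> norm R / cmod c * dist x x'"
          by (simp add: dist_norm norm_minus_commute field_simps)
      qed
    qed
    then obtain x where "?g x = x"
      by blast
    hence "c *\<^sub>C ?g x = c *\<^sub>C x"
      by simp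
    hence "y - R x = c *\<^sub>C x"
      using c by (simp add: scaleC_scaleC)
    thus ?thesis
      unfolding A by (metis add.commute diff_add_cancel)
  qed
  then obtain g where g: "\<And>y. ?A (g y) = y"
    by metis
  have g_bound: "norm (g y) \<le> norm y * (1 / (cmod c - norm R))" for y
    using lower[of "g y", unfolded g] R(2) by (simp add: field_simps)
  have Asc: "?A (a *\<^sub>C x) = a *\<^sub>C ?A x" for a x
    using R(1) unfolding A complex_linear_def by (simp add: scaleC_add_right scaleC_left_commute)
  have g_add: "g (x + y) = g x + g y" for x y
    by (rule inj) (simp only: g blinfun.add_right)
  have g_scaleC: "g (a *\<^sub>C x) = a *\<^sub>C g x" for a x
    by (rule inj) (simp only: g Asc)
  have g_lin: "bounded_linear g"
    by (rule bounded_linear_intro[OF g_add _ g_bound]) (simp add: scaleR_scaleC g_scaleC)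
  note B = bounded_linear_Blinfun_apply[OF g_lin]
  show ?thesis
  proof (rule that[of "Blinfun g"])
    show "complex_linear (Blinfun g)"
      unfolding complex_linear_def B by (simp add: g_scaleC)
    show "?A o\<^sub>L Blinfun g = id_blinfun"
      by (rule blinfun_eqI) (simp add: B g)
    show "Blinfun g o\<^sub>L ?A = id_blinfun"
      by (rule blinfun_eqI) (simp add: B inj g)
    show "norm (Blinfun g) \<le> 1 / (cmod c - norm R)"
      using R(2) g_bound by (intro norm_blinfun_bound) (simp_all add: B mult.commute)
  qed
qed

section \<open>Time-frequency shifts\<close>

lemma tf_shift_apply: "tf_shift z u \<phi> = u (translation (- pos z) (modulation (freq z) \<phi>))"
  by (simp add: tf_shift_def modulation_distr_def translation_distr_def)

lemma tf_shift_zero [simp]: "tf_shift 0 u = u"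
  by (simp add: fun_eq_iff tf_shift_apply translation_def modulation_def
      linear_0[OF bounded_linear.linear[OF bounded_linear_pos]] linear_0[OF bounded_linear.linear[OF bounded_linear_freq]])

lemma tf_shift_fun_distr:
  assumes "f \<in> schwartz" "\<phi> \<in> schwartz"
  shows "tf_shift z (fun_distr f) \<phi> = (LINT t|lborel. f (t - pos z) * (wave (freq z) t * \<phi> t))"
proof -
  let ?h = "\<lambda>t. f (t - pos z) * modulation (freq z) \<phi> t"
  have psi: "translation (- pos z) (modulation (freq z) \<phi>) \<in> schwartz"
    by (intro schwartz_translation schwartz_modulation assms)
  have h: "?h \<in> borel_measurable borel"
    using schwartz_measurable[OF schwartz_translation[OF assms(1), of "pos z"]]
      schwartz_measurable[OF schwartz_modulation[OF assms(2), of "freq z"]]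
    by (auto simp: translation_def)
  have "(\<lambda>t. f t * translation (- pos z) (modulation (freq z) \<phi>) t) \<in> borel_measurable borel"
    using schwartz_measurable[OF assms(1)] schwartz_measurable[OF psi] by measurable
  hence "tf_shift z (fun_distr f) \<phi> = (LINT t|lborel. f t * translation (- pos z) (modulation (freq z) \<phi>) t)"
    unfolding tf_shift_apply fun_distr_def using psi by (simp add: integral_completion)
  also have "\<dots> = (LINT t|lborel. ?h (t + pos z))"
    by (simp add: translation_def)
  also have "\<dots> = (LINT t|lborel. ?h t)"
    by (rule integral_lborel_translate[OF h])
  finally show ?thesis
    by (simp add: modulation_def)
qed

lemma banach_distribution_spaceD:
  assumes "banach_distribution_space \<iota>"
  shows "inj \<iota>" "\<iota> (u + w) \<phi> = \<iota> u \<phi> + \<iota> w \<phi>" "\<iota> (c *\<^sub>C u) \<phi> = c * \<iota> u \<phi>"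
    and "\<phi> \<notin> schwartz \<Longrightarrow> \<iota> u \<phi> = 0"
    and "\<phi> \<in> schwartz \<Longrightarrow> bounded_linear (\<lambda>u. \<iota> u \<phi>)"
proof -
  show "inj \<iota>" and add: "\<iota> (u + w) \<phi> = \<iota> u \<phi> + \<iota> w \<phi>" and scale: "\<iota> (c *\<^sub>C u) \<phi> = c * \<iota> u \<phi>" for u w c
    using assms unfolding banach_distribution_space_def by simp_all
  have "range \<iota> \<subseteq> tempered_distributions"
    using assms unfolding banach_distribution_space_def by (elim conjE)
  hence "\<iota> u \<in> tempered_distributions"
    by blast
  thus "\<phi> \<notin> schwartz \<Longrightarrow> \<iota> u \<phi> = 0"
    unfolding tempered_distributions_def by blast
  assume \<phi>: "\<phi> \<in> schwartz"
  have "\<forall>\<phi>\<in>schwartz. \<exists>K. \<forall>u. cmod (\<iota> u \<phi>) \<le> K * norm u"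
    using assms unfolding banach_distribution_space_def by (elim conjE)
  then obtain K where "\<And>u. cmod (\<iota> u \<phi>) \<le> K * norm u"
    using \<phi> by blast
  thus "bounded_linear (\<lambda>u. \<iota> u \<phi>)"
    by (intro bounded_linear_intro[where K = K])
      (simp_all add: add scale scaleR_scaleC mult.commute scaleR_conv_of_real)
qed

text \<open>The invariance of the space only provides some element \<open>w\<close> for each \<open>u\<close>. It is unique because \<open>\<iota>\<close> is
injective, and therefore depends linearly on \<open>u\<close>.\<close>

lemma tf_shift_operator:
  assumes "tf_shifts_invariant \<iota> v C"
  obtains T :: "real ^ ('d::finite + 'd) \<Rightarrow> 'x::complex_banach \<Rightarrow>\<^sub>L 'x"
  where "\<And>z u. \<iota> (T z u) = tf_shift z (\<iota> u)" "\<And>z. norm (T z) \<le> C * v z" "\<And>z. complex_linear (T z)"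
proof -
  have b: "banach_distribution_space \<iota>"
    using assms by (simp add: tf_shifts_invariant_def)
  note \<iota> = banach_distribution_spaceD[OF b]
  obtain S where S: "\<And>z u. \<iota> (S z u) = tf_shift z (\<iota> u)" "\<And>z u. norm (S z u) \<le> C * v z * norm u"
  proof -
    have "\<forall>z u. \<exists>w. \<iota> w = tf_shift z (\<iota> u) \<and> norm w \<le> C * v z * norm u"
      using assms unfolding tf_shifts_invariant_def by blast
    then obtain S where "\<forall>z u. \<iota> (S z u) = tf_shift z (\<iota> u) \<and> norm (S z u) \<le> C * v z * norm u"
      unfolding choice_iff by blast
    thus ?thesis
      using that by blast
  qed
  have add: "S z (u + w) = S z u + S z w" for z u w
    by (rule injD[OF \<iota>(1)]) (auto simp: fun_eq_iff S \<iota>(2) tf_shift_apply)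
  have scale: "S z (c *\<^sub>C u) = c *\<^sub>C S z u" for z c u
    by (rule injD[OF \<iota>(1)]) (auto simp: fun_eq_iff S \<iota>(3) tf_shift_apply)
  have lin: "bounded_linear (S z)" for z
    by (rule bounded_linear_intro[where K = "C * v z"])
      (use S(2) in \<open>simp_all add: add scale scaleR_scaleC mult.commute\<close>)
  note app = bounded_linear_Blinfun_apply[OF lin]
  obtain s where v: "v = (\<lambda>z. (1 + norm z) powr s)" and C: "C > 0"
    using assms unfolding tf_shifts_invariant_def polynomial_weight_def by blast
  show ?thesis
  proof (rule that[of "\<lambda>z. Blinfun (S z)"])
    show "\<iota> (blinfun_apply (Blinfun (S z)) u) = tf_shift z (\<iota> u)" for z u
      unfolding app by (rule S)
    show "norm (Blinfun (S z)) \<le> C * v z" for z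
      using C S(2) by (intro norm_blinfun_bound) (auto simp: app v)
    show "complex_linear (Blinfun (S z))" for z
      unfolding complex_linear_def app by (simp add: scale)
  qed
qed

lemma pos_symplectic_J: "pos (symplectic_J *v \<theta>) = - freq \<theta>"
  and freq_symplectic_J: "freq (symplectic_J *v \<theta>) = pos \<theta>"
  by (simp_all add: vec_eq_iff pos_def freq_def symplectic_J_def matrix_vector_mult_def sum_UNIV_Plus
      if_distrib if_distribR sum.delta' cong: if_cong)

lemma complex_linear_infsum:
  fixes G :: "'i \<Rightarrow> 'x::complex_banach \<Rightarrow>\<^sub>L 'x"
  assumes "G summable_on I" "\<And>i. i \<in> I \<Longrightarrow> complex_linear (G i)"
  shows "complex_linear (infsum G I)"
  unfolding complex_linear_def
proof (intro allI)
  fix c and u :: 'x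
  have app: "((\<lambda>i. G i w) has_sum infsum G I w) I" for w
    using has_sum_bounded_linear[OF blinfun.bounded_linear_left has_sum_infsum[OF assms(1)], of w] by (simp add: o_def)
  have "((\<lambda>i. c *\<^sub>C G i u) has_sum c *\<^sub>C infsum G I u) I"
    using has_sum_bounded_linear[OF bounded_linear_scaleC app[of u], of c] by (simp add: o_def)
  hence "((\<lambda>i. G i (c *\<^sub>C u)) has_sum c *\<^sub>C infsum G I u) I"
    by (rule has_sum_cong[THEN iffD1, rotated]) (use assms(2) in \<open>simp add: complex_linear_def\<close>)
  thus "infsum G I (c *\<^sub>C u) = c *\<^sub>C infsum G I u"
    using app[of "c *\<^sub>C u"] has_sum_unique by blast
qed

theorem proposition3p2:
  fixes \<iota> :: "'x::complex_banach \<Rightarrow> (real ^ 'd::finite) functional"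
    and v :: "real ^ ('d + 'd) \<Rightarrow> real"
    and C :: real
    and L :: "real ^ ('d + 'd) ^ ('d + 'd)"
    and q :: "real ^ ('d + 'd) \<Rightarrow> complex"
  assumes "tf_shifts_invariant \<iota> v C"
    and "invertible L"
    and "integrable lebesgue q"
    and "(LINT z|lebesgue. q z) \<noteq> 0"
    and "sigma_term L v q summable_on (int_lattice - {0})"
    and "(\<Sum>\<^sub>\<infinity>\<kappa>\<in>int_lattice - {0}. sigma_term L v q \<kappa>) < 1 / C * cmod (LINT z|lebesgue. q z)"
  shows "\<forall>\<tau>\<in>{0..1}. \<exists>A B :: 'x \<Rightarrow>\<^sub>L 'x.
           bounded_extension \<iota> (Op_tau \<tau> (fun_distr (periodization L q))) A \<and>
           complex_linear B \<and> A o\<^sub>L B = id_blinfun \<and> B o\<^sub>L A = id_blinfun \<and>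
           norm B \<le> \<bar>det L\<bar> / ((1 + C) * sigma0 q - C * sigma_Lv L v q)"
proof
  fix \<tau> :: real assume \<tau>: "\<tau> \<in> {0..1}"
  have b: "banach_distribution_space \<iota>" and C: "C > 0"
    using assms(1) by (auto simp: tf_shifts_invariant_def)
  obtain s where v: "v = (\<lambda>z. (1 + norm z) powr s)" and s: "s \<ge> 0"
    using assms(1) unfolding tf_shifts_invariant_def polynomial_weight_def by blast
  note \<iota> = banach_distribution_spaceD[OF b]
  obtain T :: "real ^ ('d + 'd) \<Rightarrow> 'x \<Rightarrow>\<^sub>L 'x" where
    T: "\<And>z u. \<iota> (T z u) = tf_shift z (\<iota> u)" "\<And>z. norm (T z) \<le> C * v z" "\<And>z. complex_linear (T z)"
    using tf_shift_operator[OF assms(1)] by blast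
  \<comment> \<open>The leading term is exactly a scalar, of norm \<open>\<bar>a 0\<bar>\<close> and not just \<open>C \<bar>a 0\<bar>\<close>; hence the form of the denominator.\<close>
  have T0: "T 0 u = u" for u
    by (rule injD[OF \<iota>(1)]) (simp add: T)
  have det: "\<bar>det L\<bar> > 0"
    using assms(2) by (simp add: invertible_det_nz)

  define \<theta> where "\<theta> \<kappa> = inv_transpose L *v \<kappa>" for \<kappa>
  define a where "a \<kappa> = fourier q (\<theta> \<kappa>) / \<bar>det L\<bar> * cis (2 * pi * \<tau> * (pos (\<theta> \<kappa>) \<bullet> freq (\<theta> \<kappa>)))" for \<kappa>
  define G where "G \<kappa> = scalar_op (a \<kappa>) o\<^sub>L T (symplectic_J *v \<theta> \<kappa>)" for \<kappa>
  define R where "R = infsum G (int_lattice - {0})"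
  define A where "A = scalar_op (a 0) + R"

  have v1: "v z \<ge> 1" for z
    using s by (simp add: v ge_one_powr_ge_zero)
  have sig_term: "sigma_term L v q \<kappa> = v (symplectic_J *v \<theta> \<kappa>) * cmod (fourier q (\<theta> \<kappa>))" for \<kappa>
    by (simp add: sigma_term_def \<theta>_def)
  have sig_ge: "cmod (fourier q (\<theta> \<kappa>)) \<le> sigma_term L v q \<kappa>" for \<kappa>
    unfolding sig_term using mult_right_mono[OF v1[of "symplectic_J *v \<theta> \<kappa>"], of "cmod (fourier q (\<theta> \<kappa>))"] by simp
  have sig_nonneg: "sigma_term L v q \<kappa> \<ge> 0" for \<kappa>
    using order_trans[OF norm_ge_zero sig_ge] .
  have cmod_a: "cmod (a \<kappa>) = cmod (fourier q (\<theta> \<kappa>)) / \<bar>det L\<bar>" for \<kappa>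
    by (simp add: a_def norm_mult norm_divide)
  have G_bound: "norm (G \<kappa>) \<le> C / \<bar>det L\<bar> * sigma_term L v q \<kappa>" for \<kappa>
  proof -
    have "norm (G \<kappa>) \<le> norm (scalar_op (a \<kappa>) :: 'x \<Rightarrow>\<^sub>L 'x) * norm (T (symplectic_J *v \<theta> \<kappa>))"
      unfolding G_def by (rule norm_blinfun_compose)
    also have "\<dots> \<le> cmod (a \<kappa>) * (C * v (symplectic_J *v \<theta> \<kappa>))"
      by (intro mult_mono norm_scalar_op_le T) auto
    finally show ?thesis
      by (simp add: cmod_a sig_term mult_ac)
  qed
  have lattice: "int_lattice = insert 0 (int_lattice - {0 :: real ^ ('d + 'd)})"
    using zero_int_lattice by blast
  have norm_sum: "(\<lambda>\<kappa>. norm (G \<kappa>)) summable_on (int_lattice - {0})"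
    by (rule summable_on_comparison_test[OF summable_on_cmult_right[OF assms(5)] G_bound]) auto
  have sum: "G summable_on (int_lattice - {0})"
    by (rule abs_summable_summable[OF norm_sum])
  have fourier_sum: "(\<lambda>\<kappa>. cmod (fourier q (inv_transpose L *v \<kappa>))) summable_on int_lattice"
  proof -
    have "(\<lambda>\<kappa>. cmod (fourier q (\<theta> \<kappa>))) summable_on (int_lattice - {0})"
      by (rule summable_on_comparison_test[OF assms(5) sig_ge]) auto
    thus ?thesis
      unfolding \<theta>_def by (subst lattice) (simp only: summable_on_insert_iff)
  qed

  have \<theta>0: "\<theta> 0 = 0"
    by (simp add: \<theta>_def)
  have G0: "G 0 = scalar_op (a 0)"
    by (rule blinfun_eqI) (simp add: G_def \<theta>0 T0)
  have fourier0: "fourier q 0 = (LINT z|lebesgue. q z)"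
    by (simp add: fourier_def)
  have sigma: "sigma_Lv L v q = sigma0 q + (\<Sum>\<^sub>\<infinity>\<kappa>\<in>int_lattice - {0}. sigma_term L v q \<kappa>)"
  proof -
    have "sigma_Lv L v q = sigma_term L v q 0 + (\<Sum>\<^sub>\<infinity>\<kappa>\<in>int_lattice - {0}. sigma_term L v q \<kappa>)"
      unfolding sigma_Lv_def by (subst lattice, rule infsum_insert[OF assms(5)]) simp
    moreover have "v 0 = 1"
      by (simp add: v)
    ultimately show ?thesis
      by (simp add: sig_term \<theta>0 fourier0 sigma0_def)
  qed
  have denom: "(1 + C) * sigma0 q - C * sigma_Lv L v q =
      sigma0 q - C * (\<Sum>\<^sub>\<infinity>\<kappa>\<in>int_lattice - {0}. sigma_term L v q \<kappa>)"
    unfolding sigma by (simp add: algebra_simps)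
  have denom_pos: "(1 + C) * sigma0 q - C * sigma_Lv L v q > 0"
    unfolding denom unfolding sigma0_def using assms(6) C by (simp add: field_simps)
  have norm_a0: "cmod (a 0) = sigma0 q / \<bar>det L\<bar>"
    unfolding cmod_a \<theta>0 fourier0 sigma0_def ..
  have norm_R: "norm R \<le> C / \<bar>det L\<bar> * (\<Sum>\<^sub>\<infinity>\<kappa>\<in>int_lattice - {0}. sigma_term L v q \<kappa>)"
  proof -
    have "norm R \<le> (\<Sum>\<^sub>\<infinity>\<kappa>\<in>int_lattice - {0}. norm (G \<kappa>))"
      unfolding R_def by (rule norm_infsum_bound[OF norm_sum])
    also have "\<dots> \<le> (\<Sum>\<^sub>\<infinity>\<kappa>\<in>int_lattice - {0}. C / \<bar>det L\<bar> * sigma_term L v q \<kappa>)"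
      by (rule infsum_mono[OF norm_sum summable_on_cmult_right[OF assms(5)] G_bound])
    finally show ?thesis
      by (simp only: infsum_cmult_right')
  qed
  have gap: "((1 + C) * sigma0 q - C * sigma_Lv L v q) / \<bar>det L\<bar> \<le> cmod (a 0) - norm R"
    using norm_R unfolding denom norm_a0 by (simp add: diff_divide_distrib)
  hence "norm R < cmod (a 0)"
    using divide_pos_pos[OF denom_pos det] by linarith
  moreover have G_lin: "complex_linear (G \<kappa>)" for \<kappa>
    using T(3) by (simp add: complex_linear_def G_def scaleC_left_commute)
  have "complex_linear R"
    unfolding R_def by (rule complex_linear_infsum[OF sum G_lin])
  ultimately obtain B where B: "complex_linear B" "A o\<^sub>L B = id_blinfun" "B o\<^sub>L A = id_blinfun"
      "norm B \<le> 1 / (cmod (a 0) - norm R)"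
    unfolding A_def using perturbed_scalar_inverse by blast
  have "norm B \<le> 1 / (((1 + C) * sigma0 q - C * sigma_Lv L v q) / \<bar>det L\<bar>)"
    using gap divide_pos_pos[OF denom_pos det] by (intro order_trans[OF B(4)] divide_left_mono mult_pos_pos) linarith+
  hence norm_B: "norm B \<le> \<bar>det L\<bar> / ((1 + C) * sigma0 q - C * sigma_Lv L v q)"
    by simp

  \<comment> \<open>It remains to identify \<open>A\<close>. Both sides are tested on \<open>\<phi>\<close> and expanded into a series over the lattice.\<close>
  have A_sum: "(G has_sum A) int_lattice"
    using has_sum_insert[OF _ has_sum_infsum[OF sum], of 0] unfolding A_def R_def G0 lattice[symmetric] by simp
  have "bounded_extension \<iota> (Op_tau \<tau> (fun_distr (periodization L q))) A"
    unfolding bounded_extension_def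
  proof (intro conjI ballI allI impI)
    show "complex_linear A"
      using \<open>complex_linear R\<close> by (simp add: complex_linear_def A_def blinfun.add_left scaleC_add_right scaleC_left_commute)
    fix f u assume f: "f \<in> schwartz" and u: "\<iota> u = fun_distr f"
    show "\<iota> (A u) = Op_tau \<tau> (fun_distr (periodization L q)) f"
    proof
      fix \<phi>
      show "\<iota> (A u) \<phi> = Op_tau \<tau> (fun_distr (periodization L q)) f \<phi>"
      proof (cases "\<phi> \<in> schwartz")
        case True
        let ?W = "wigner_tau \<tau> f \<phi>"
        have W: "?W \<in> schwartz"
          by (rule wigner_tau_schwartz[OF f True \<tau>])
        have "((\<lambda>\<kappa>. G \<kappa> u) has_sum A u) int_lattice"
          using has_sum_bounded_linear[OF blinfun.bounded_linear_left A_sum, of u] by (simp add: o_def)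
        hence 1: "((\<lambda>\<kappa>. \<iota> (G \<kappa> u) \<phi>) has_sum \<iota> (A u) \<phi>) int_lattice"
          by (rule has_sum_bounded_linear[OF \<iota>(5)[OF True]])
        have "\<iota> (G \<kappa> u) \<phi> = fourier q (\<theta> \<kappa>) / \<bar>det L\<bar> * (LINT z|lborel. wave (\<theta> \<kappa>) z * ?W z)" for \<kappa>
        proof -
          have "\<iota> (G \<kappa> u) \<phi> = a \<kappa> * tf_shift (symplectic_J *v \<theta> \<kappa>) (fun_distr f) \<phi>"
            by (simp add: G_def \<iota>(3) T u)
          thus ?thesis
            unfolding integral_exponential_wigner_tau[OF f True \<tau>] tf_shift_fun_distr[OF f True]
              pos_symplectic_J freq_symplectic_J a_def by simp
        qed
        with 1 have "((\<lambda>\<kappa>. fourier q (\<theta> \<kappa>) / \<bar>det L\<bar> * (LINT z|lborel. wave (\<theta> \<kappa>) z * ?W z)) has_sum \<iota> (A u) \<phi>) int_lattice"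
          by simp
        moreover have "((\<lambda>\<kappa>. fourier q (\<theta> \<kappa>) / \<bar>det L\<bar> * (LINT z|lborel. wave (\<theta> \<kappa>) z * ?W z)) has_sum
            (LINT z|lebesgue. periodization L q z * ?W z)) int_lattice"
          unfolding \<theta>_def
          by (rule has_sum_integral_periodization[OF assms(2,3) fourier_sum schwartz_continuous[OF W] schwartz_rapidly_decreasing[OF W]])
        ultimately have "\<iota> (A u) \<phi> = (LINT z|lebesgue. periodization L q z * ?W z)"
          by (rule has_sum_unique)
        thus ?thesis
          using True W by (simp add: Op_tau_def fun_distr_def)
      next
        case False
        thus ?thesis
          by (simp add: Op_tau_def \<iota>(4))
      qed
    qed
  qed
  with B norm_B show "\<exists>A B :: 'x \<Rightarrow>\<^sub>L 'x.
           bounded_extension \<iota> (Op_tau \<tau> (fun_distr (periodization L q))) A \<and>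
           complex_linear B \<and> A o\<^sub>L B = id_blinfun \<and> B o\<^sub>L A = id_blinfun \<and>
           norm B \<le> \<bar>det L\<bar> / ((1 + C) * sigma0 q - C * sigma_Lv L v q)"
    by blast
qed

end
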